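(* Let $$\mathcal A=\begin{pmatrix}A&B^T\\-B&0\end{pmatrix},\qquad \mathcal M_D=\begin{pmatrix}H_{\bm w}&0\\0&H_p\end{pmatrix},$$ where $H_{\bm w}:\bm W_h'\to\bm W_h$ and $H_p:Q_h'\to Q_h$ are symmetric positive definite and satisfy, for all $\bm r\in\bm W_h'$ and $q\in Q_h'$, $$c_{1,\bm w}(H_{\bm w}\bm r,\bm r)\le(A^{-1}\bm r,\bm r)\le c_{2,\bm w}(H_{\bm w}\bm r,\bm r),$$ $$c_{1,p}(H_pq,q)\le((BD_A^{-1}B^T)^{-1}q,q)\le c_{2,p}(H_pq,q),$$ with constants $c_{1,\bm w},c_{2,\bm w},c_{1,p},c_{2,p}>0$ independent of discretization and physical parameters. Then $$\kappa(\mathcal M_D\mathcal A)\le\frac{\alpha c_2}{\beta c_1},\qquad c_2=\max\{c_{2,\bm w},c_{2,p}\},\quad c_1=\min\{c_{1,\bm w},c_{1,p}\},$$ where $\alpha,\beta>0$ are the continuity and inf-sup constants, with respect to the norm $|||\cdot|||$, of the bilinear form $\mathcal L(\bm w_h,p_h;\bm r_h,q_h)=a(\bm w_h,\bm r_h)+a^D(\bm D_hp_h,\bm r_h)+a^D(\bm D_hq_h,\bm w_h)$ on $\bm W_h\times Q_h$.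
   Context: **Geometry.** Let $n\in\{2,3\}$. A fractured porous medium of rectangular type (fractures are line segments if $n=2$, flat surfaces if $n=3$) is decomposed by the fractures into $n$-dimensional subdomains $\Omega_i^n$, $i\in I^n$; fractures and their intersections are lower-dimensional subdomains $\Omega_i^d$, $i\in I^d$, $0\le d<n$. For $0\le d\le n-1$ and $i\in I^d$, $\Gamma_{ij}^d$ ($j\in J_i^d$) are the interfaces between $\Omega_i^d$ and the adjacent $(d+1)$-dimensional subdomains. Set $\Omega^d=\bigcup_i\Omega_i^d$, $\Gamma^d=\bigcup_i\bigcup_j\Gamma_{ij}^d$, $\Omega=\bigcup_{d=0}^n\Omega^d$, $\Gamma=\bigcup_{d=0}^{n-1}\Gamma^d$. The boundary splits disjointly as $\partial\Omega=\partial\Omega_D\cup\partial\Omega_N$ with $\partial\Omega_D$ of positive measure; $\partial\Omega_N^d$ is the part of $\partial\Omega_N$ on $\partial\Omega^d$; $\bm\nu$ is the outward unit normal. **Physical parameters.** The permeability $K$ (on $\Omega$) and normal permeability $K_{\bm\nu}$ (on $\Gamma$) are symmetric positive definite tensors bounded above and below; $\gamma>0$ on $\Gamma$ (distance from $\Gamma_{ij}^d$ to $\Omega_i^d$; the aperture for $d=n-1$). All are assumed constant on each subdomain/interface. **Spaces.** $\bm V^d=\{\bm v\in (L^2(\Omega^d))^d:\nabla\cdot\bm v\in L^2(\Omega^d),\ \bm v\cdot\bm\nu=0 \text{ on }\partial\Omega_N^d\}$ for $1\le d\le n$; $\bm V_0^d=\{\bm v\in\bm V^d:\bm v\cdot\bm\nu=0\text{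 on }\Gamma^{d-1}\}$; $\Lambda^d=L^2(\Gamma^d)$ for $0\le d\le n-1$; $Q^d=L^2(\Omega^d)$ for $0\le d\le n$. On shape-regular simplicial triangulations $\mathcal T^d_\Omega$ of $\Omega^d$ and $\mathcal T^d_\Gamma$ of $\Gamma^d$ (maximal mesh size $h$), $\bm V_h^d\subset\bm V^d$ and $\bm V_{0h}^d\subset\bm V_0^d$ are lowest-order Raviart–Thomas spaces $\mathbb{RT}_0(\mathcal T_\Omega^d)$, $\Lambda_h^d=\mathbb P_0(\mathcal T_\Gamma^d)$ and $Q_h^d=\mathbb P_0(\mathcal T_\Omega^d)$ (piecewise constants). Put $\bm V_{0h}=\bigoplus_{d=1}^n\bm V_{0h}^d$, $\Lambda_h=\bigoplus_{d=0}^{n-1}\Lambda_h^d$, $Q_h=\bigoplus_{d=0}^nQ_h^d$, $\bm W_h=\bm V_{0h}\times\Lambda_h$. **Discrete extension.** $\widehat\Pi_h^d:\Lambda_h^d\to\bm V_h^{d+1}\cdot\bm\nu|_{\Gamma^d}$ is the $L^2$-projection, $(\widehat\Pi_h^d\mu-\mu,\bm v\cdot\bm\nu)_{L^2(\Gamma^d)}=0$ for all $\bm v\in\bm V_h^{d+1}$. $R_h^d:\Lambda_h^d\to\bm V_h^{d+1}$ is defined by $R_h^d\lambda\cdot\bm\nu=\widehat\Pi_h^d\lambda$ on $\Gamma^d$ and $0$ elsewhere (all other facet normal components vanish); $R_h=\bigoplus_{d=0}^{n-1}R_h^d$. **Forms.** $(\cdot,\cdot)_\Omega$, $(\cdot,\cdot)_\Gamma$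 are the sums of the $L^2$ inner products over all subdomains, respectively interfaces, with the convention that flux components for $d=0$ and mortar components for $d=n$ are zero. The jump is $\llbracket\lambda\rrbracket|_{\Omega_i^d}=-\sum_{j\in J_i^d}\lambda_{ij}^d$, and $\bm D\cdot[\bm u,\lambda]=\nabla\cdot\bm u+\llbracket\lambda\rrbracket$. For $\bm w_h=[\bm u_{0h},\lambda_h]$, $\bm r_h=[\bm v_{0h},\mu_h]\in\bm W_h$, $q_h\in Q_h$: $$a(\bm w_h,\bm r_h)=(K^{-1}(\bm u_{0h}+R_h\lambda_h),\bm v_{0h}+R_h\mu_h)_\Omega+(\gamma K_{\bm\nu}^{-1}\lambda_h,\mu_h)_\Gamma,$$ $$b(\bm r_h,q_h)=-(q_h,\bm D\cdot[\bm v_{0h}+R_h\mu_h,\mu_h])_\Omega,$$ $$a^D(\bm w_h,\bm r_h)=(K^{-1}(\bm u_{0h}+R_h\lambda_h),\bm v_{0h}+R_h\mu_h)_{D,\Omega}+(\gamma K_{\bm\nu}^{-1}\lambda_h,\mu_h)_\Gamma,$$ where $$(K^{-1}\bm u,\bm v)_{D,\Omega}=\sum_{d=0}^n\sum_{T\in\mathcal T_\Omega^d}\sum_{f\in\partial T}(\bm u\cdot\bm\nu_f)(\bm v\cdot\bm\nu_f)(K^{-1}\bm\phi_f,\bm\phi_f)_T.$$ Here $f$ runs over the faces of the element $T$, $\bm\nu_f$ is the unit outer normal of $f$, and $\bm\phi_f\in\mathbb{RT}_0(T)$ is the basis function of face $f$ (so $\bm v|_T=\sum_f(\bm v\cdot\bm\nu_f)\bm\phi_f$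 for $\bm v\in\mathbb{RT}_0(T)$). The discrete gradient $\bm D_h:Q_h\to\bm W_h$ is defined by $a^D(\bm D_hp_h,\bm r_h)=b(\bm r_h,p_h)$ for all $\bm r_h\in\bm W_h$. **Operators and norm.** With primes for dual spaces and $\langle\cdot,\cdot\rangle$ (or $(\cdot,\cdot)$) for duality pairings: $A:\bm W_h\to\bm W_h'$, $\langle A\bm w_h,\bm r_h\rangle=a(\bm w_h,\bm r_h)$; $D_A:\bm W_h\to\bm W_h'$, $\langle D_A\bm w_h,\bm r_h\rangle=a^D(\bm w_h,\bm r_h)$; $B:\bm W_h\to Q_h'$, $\langle B\bm r_h,q_h\rangle=b(\bm r_h,q_h)$, with transpose $B^T:Q_h\to\bm W_h'$. The norm is $|||(\bm r_h,q_h)|||^2=a(\bm r_h,\bm r_h)+a^D(\bm D_hq_h,\bm D_hq_h)$. **Constants.** $\alpha,\beta>0$ satisfy $|\mathcal L(x;y)|\le\alpha|||x|||\,|||y|||$ for all $x,y\in\bm W_h\times Q_h$ and $\inf_{y\ne0}\sup_{x\neq0}\mathcal L(x;y)/(|||x|||\,|||y|||)\ge\beta$. "Discretization and physical parameters" are $h$, $K$, $K_{\bm\nu}$, $\gamma$. **Condition number.** For an invertible operator $T$ on $\bm W_h\times Q_h$, $\kappa(T)=\|T\|\,\|T^{-1}\|$, with operator norms induced by $|||\cdot|||$. *)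

theory Defs
  imports "HOL-Analysis.Analysis" "HOL-Library.Function_Algebras"
begin

section \<open>Linear algebra on carrier sets\<close>

text \<open>
  The finite element spaces depend on a mesh, so they are sets of functions rather than types.
  Functions carry the pointwise vector space structure.
\<close>

instantiation "fun" :: (type, real_vector) real_vector
begin

definition scaleR_fun :: "real \<Rightarrow> ('a \<Rightarrow> 'b) \<Rightarrow> 'a \<Rightarrow> 'b"
  where "scaleR_fun c f = (\<lambda>x. c *\<^sub>R f x)"

instance
  by standard (simp_all add: scaleR_fun_def fun_eq_iff scaleR_add_right scaleR_add_left)

end

lemma scaleR_fun_apply [simp]: "(c *\<^sub>R f) x = c *\<^sub>R f x"
  by (simp add: scaleR_fun_def)

definition linear_on :: "'v::real_vector set \<Rightarrow> ('v \<Rightarrow> 'w::real_vector) \<Rightarrow> bool"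
  where "linear_on V f \<longleftrightarrow>
    (\<forall>x\<in>V. \<forall>y\<in>V. f (x + y) = f x + f y) \<and> (\<forall>c. \<forall>x\<in>V. f (c *\<^sub>R x) = c *\<^sub>R f x)"

text \<open>A functional on \<open>V\<close> is represented by its extension by zero outside \<open>V\<close>.\<close>

definition dual :: "'v::real_vector set \<Rightarrow> ('v \<Rightarrow> real) set"
  where "dual V = {F. linear_on V F \<and> (\<forall>x. x \<notin> V \<longrightarrow> F x = 0)}"

definition functional :: "'v::real_vector set \<Rightarrow> ('v \<Rightarrow> real) \<Rightarrow> 'v \<Rightarrow> real"
  where "functional V F = (\<lambda>x. if x \<in> V then F x else 0)"

definition spd_operator :: "'v::real_vector set \<Rightarrow> (('v \<Rightarrow> real) \<Rightarrow> 'v) \<Rightarrow> bool"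
  where "spd_operator V H \<longleftrightarrow>
    H ` dual V \<subseteq> V \<and> linear_on (dual V) H \<and>
    (\<forall>r\<in>dual V. \<forall>s\<in>dual V. r (H s) = s (H r)) \<and>
    (\<forall>r\<in>dual V. r \<noteq> 0 \<longrightarrow> r (H r) > 0)"

text \<open>Operator norm induced by a norm \<open>N\<close> on \<open>V\<close>; compare \<open>onorm\<close> (recall \<open>0 / 0 = 0\<close>).\<close>

definition operator_norm :: "('v \<Rightarrow> real) \<Rightarrow> 'v set \<Rightarrow> ('v \<Rightarrow> 'v) \<Rightarrow> real"
  where "operator_norm N V T = (SUP x\<in>V. N (T x) / N x)"

definition condition_number :: "('v \<Rightarrow> real) \<Rightarrow> 'v set \<Rightarrow> ('v \<Rightarrow> 'v) \<Rightarrow> real"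
  where "condition_number N V T = operator_norm N V T * operator_norm N V (inv_into V T)"


section \<open>Flat pieces of the ambient space\<close>

definition tangent :: "'a::euclidean_space set \<Rightarrow> 'a set"
  where "tangent S = span {x - y | x y. x \<in> S \<and> y \<in> S}"

definition tangent_frame :: "'a::euclidean_space set \<Rightarrow> 'a set"
  where "tangent_frame S = (SOME B. B \<subseteq> tangent S \<and> pairwise orthogonal B \<and>
    (\<forall>b\<in>B. norm b = 1) \<and> span B = tangent S)"

text \<open>
  The \<open>d\<close>-dimensional Lebesgue measure on the affine hull of a set of dimension \<open>d\<close>, transported
  by an isometric parametrization (a Dirac measure for \<open>d = 0\<close>).
\<close>

definition flat_measure :: "'a::euclidean_space set \<Rightarrow> 'a measure"
  where "flat_measure S =
    distr (\<Pi>\<^sub>M b\<in>tangent_frame S. (lborel :: real measure)) borel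
      (\<lambda>t. (SOME z. z \<in> affine hull S) + (\<Sum>b\<in>tangent_frame S. t b *\<^sub>R b))"

definition flat_div :: "'a::euclidean_space set \<Rightarrow> ('a \<Rightarrow> 'a) \<Rightarrow> 'a \<Rightarrow> real"
  where "flat_div S v x = (\<Sum>b\<in>tangent_frame S. frechet_derivative v (at x) b \<bullet> b)"

text \<open>The function that agrees with \<open>g T\<close> in the relative interior of each element \<open>T\<close>.\<close>

definition piecewise :: "'a::euclidean_space set set \<Rightarrow> ('a set \<Rightarrow> 'a \<Rightarrow> 'b::real_vector) \<Rightarrow> 'a \<Rightarrow> 'b"
  where "piecewise \<T> g x = (\<Sum>T\<in>\<T>. indicator (rel_interior T) x *\<^sub>R g T x)"


section \<open>Fractured media\<close>

text \<open>
  \<open>Dom\<close> is the open region occupied by the medium, \<open>Fracs\<close> the set of fractures,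
  \<open>Sub G d i\<close> with \<open>i \<in> Idx G d\<close> the \<open>d\<close>-dimensional subdomains, and \<open>BdD\<close>, \<open>BdN\<close> the
  Dirichlet and Neumann parts of the boundary.
\<close>

record 'a geometry =
  Dom :: "'a set"
  Fracs :: "'a set set"
  Idx :: "nat \<Rightarrow> nat set"
  Sub :: "nat \<Rightarrow> nat \<Rightarrow> 'a set"
  BdD :: "'a set"
  BdN :: "'a set"

definition Omega :: "'a::euclidean_space geometry \<Rightarrow> 'a set"
  where "Omega G = (\<Union>d\<in>{..DIM('a)}. \<Union>i\<in>Idx G d. Sub G d i)"

definition intersections :: "'a geometry \<Rightarrow> 'a set"
  where "intersections G = \<Union>{F \<inter> F' | F F'. F \<in> Fracs G \<and> F' \<in> Fracs G \<and> F \<noteq> F'}"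

text \<open>
  An interface between the \<open>d\<close>-dimensional subdomain \<open>i\<close> and an adjacent subdomain \<open>k\<close> of dimension
  \<open>d + 1\<close> is identified by \<open>j = (k, \<nu>)\<close>, where \<open>\<nu>\<close> is the unit normal on the interface pointing out of
  subdomain \<open>k\<close>. Thus the two sides of a fracture are different interfaces even if both belong
  to the same subdomain. Geometrically, every interface coincides with \<open>Sub G d i\<close>.
\<close>

definition approaches :: "'a::euclidean_space set \<Rightarrow> 'a \<Rightarrow> 'a \<Rightarrow> bool"
  where "approaches S \<nu> x \<longleftrightarrow> (\<exists>\<epsilon>>0. \<forall>t. 0 < t \<and> t < \<epsilon> \<longrightarrow> x - t *\<^sub>R \<nu> \<in> S)"

definition interfaces :: "'a::euclidean_space geometry \<Rightarrow> nat \<Rightarrow> nat \<Rightarrow> (nat \<times> 'a) set"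
  where "interfaces G d i = {(k, \<nu>). k \<in> Idx G (Suc d) \<and> \<nu> \<in> tangent (Sub G (Suc d) k) \<and>
    norm \<nu> = 1 \<and> (\<forall>y\<in>tangent (Sub G d i). \<nu> \<bullet> y = 0) \<and>
    (\<forall>x\<in>Sub G d i. approaches (Sub G (Suc d) k) \<nu> x)}"

text \<open>
  The subdomains are relatively open. Boundary points of a fracture inside the medium (immersed
  tips) belong to no subdomain; they are therefore part of the boundary \<open>closure \<Omega> - \<Omega>\<close>.
\<close>

definition fractured_medium :: "'a::euclidean_space geometry \<Rightarrow> bool"
  where "fractured_medium G \<longleftrightarrow>
    open (Dom G) \<and> bounded (Dom G) \<and> Dom G \<noteq> {} \<and>
    finite (Fracs G) \<and>
    (\<forall>F\<in>Fracs G. compact F \<and> connected F \<and> F \<subseteq> closure (Dom G) \<and>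
       aff_dim F = int DIM('a) - 1 \<and> closure (rel_interior F) = F) \<and>
    (\<forall>d\<le>DIM('a). finite (Idx G d) \<and>
       (\<forall>i\<in>Idx G d. Sub G d i \<subseteq> Dom G \<and> connected (Sub G d i) \<and> aff_dim (Sub G d i) = int d \<and>
          openin (top_of_set (affine hull (Sub G d i))) (Sub G d i))) \<and>
    (\<forall>d\<le>DIM('a). \<forall>d'\<le>DIM('a). \<forall>i\<in>Idx G d. \<forall>i'\<in>Idx G d'.
       (d, i) \<noteq> (d', i') \<longrightarrow> Sub G d i \<inter> Sub G d' i' = {}) \<and>
    (\<Union>i\<in>Idx G (DIM('a)). Sub G (DIM('a)) i) = Dom G - \<Union>(Fracs G) \<and>
    (\<Union>i\<in>Idx G (DIM('a) - 1). Sub G (DIM('a) - 1) i) =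
      (\<Union>F\<in>Fracs G. rel_interior F \<inter> Dom G - \<Union>(Fracs G - {F})) \<and>
    (\<Union>d\<in>{..<DIM('a) - 1}. \<Union>i\<in>Idx G d. Sub G d i) \<subseteq> intersections G \<and>
    intersections G \<inter> Dom G \<subseteq> (\<Union>d\<in>{..<DIM('a) - 1}. \<Union>i\<in>Idx G d. closure (Sub G d i)) \<and>
    (\<forall>d<DIM('a). \<forall>i\<in>Idx G d. \<forall>i'\<in>Idx G d. i \<noteq> i' \<longrightarrow>
       closure (Sub G d i) \<inter> closure (Sub G d i') \<inter> Dom G
         \<subseteq> (\<Union>d'\<in>{..<d}. \<Union>k\<in>Idx G d'. closure (Sub G d' k))) \<and>
    (\<forall>d<DIM('a). \<forall>i\<in>Idx G d. \<forall>k\<in>Idx G (Suc d). \<forall>\<nu>\<in>tangent (Sub G (Suc d) k).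
       norm \<nu> = 1 \<and> (\<forall>y\<in>tangent (Sub G d i). \<nu> \<bullet> y = 0) \<and>
       (\<exists>x\<in>Sub G d i. approaches (Sub G (Suc d) k) \<nu> x) \<longrightarrow> (k, \<nu>) \<in> interfaces G d i) \<and>
    BdD G \<union> BdN G = closure (Omega G) - Omega G \<and> BdD G \<inter> BdN G = {} \<and>
    (\<exists>H. affine H \<and> aff_dim H = int DIM('a) - 1 \<and> emeasure (flat_measure H) (BdD G \<inter> H) > 0)"


section \<open>Physical parameters\<close>

text \<open>
  The permeability of a subdomain acts on its tangent space. On an interface the mortar flux is
  scalar, hence so is the normal permeability. All parameters are constant on each subdomain or
  interface, and there are finitely many of these, so two-sided bounds hold automatically.
\<close>

record 'a params =
  Perm :: "nat \<Rightarrow> nat \<Rightarrow> 'a \<Rightarrow> 'a"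
  PermN :: "nat \<Rightarrow> nat \<Rightarrow> nat \<times> 'a \<Rightarrow> real"
  Gam :: "nat \<Rightarrow> nat \<Rightarrow> nat \<times> 'a \<Rightarrow> real"

definition spd_tensor :: "'a::euclidean_space set \<Rightarrow> ('a \<Rightarrow> 'a) \<Rightarrow> bool"
  where "spd_tensor S K \<longleftrightarrow> linear K \<and> K ` S \<subseteq> S \<and>
    (\<forall>x\<in>S. \<forall>y\<in>S. K x \<bullet> y = x \<bullet> K y) \<and> (\<forall>x\<in>S. x \<noteq> 0 \<longrightarrow> K x \<bullet> x > 0)"

definition physical_parameters :: "'a::euclidean_space geometry \<Rightarrow> 'a params \<Rightarrow> bool"
  where "physical_parameters G P \<longleftrightarrow>
    (\<forall>d\<le>DIM('a). \<forall>i\<in>Idx G d. spd_tensor (tangent (Sub G d i)) (Perm P d i)) \<and>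
    (\<forall>d<DIM('a). \<forall>i\<in>Idx G d. \<forall>j\<in>interfaces G d i. PermN P d i j > 0 \<and> Gam P d i j > 0)"

definition Kinv :: "'a::euclidean_space geometry \<Rightarrow> 'a params \<Rightarrow> nat \<Rightarrow> nat \<Rightarrow> 'a \<Rightarrow> 'a"
  where "Kinv G P d i = inv_into (tangent (Sub G d i)) (Perm P d i)"


section \<open>Meshes\<close>

definition shape_regular :: "real \<Rightarrow> 'a::euclidean_space set \<Rightarrow> bool"
  where "shape_regular \<sigma> T \<longleftrightarrow>
    (\<exists>x r. x \<in> T \<and> 0 \<le> r \<and> cball x r \<inter> affine hull T \<subseteq> T \<and> diameter T \<le> \<sigma> * r)"

definition triangulates :: "real \<Rightarrow> nat \<Rightarrow> 'a::euclidean_space set \<Rightarrow> 'a set set \<Rightarrow> bool"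
  where "triangulates \<sigma> d S \<T> \<longleftrightarrow> triangulation \<T> \<and> \<Union>\<T> = closure S \<and>
    (\<forall>T\<in>\<T>. int d simplex T \<and> rel_interior T \<subseteq> S \<and> shape_regular \<sigma> T)"

text \<open>
  \<open>MO M d i\<close> triangulates the subdomain and \<open>MG M d i j\<close> the interface. They need not match each
  other or the traces of the meshes of the adjacent subdomains.
\<close>

record 'a mesh =
  MO :: "nat \<Rightarrow> nat \<Rightarrow> 'a set set"
  MG :: "nat \<Rightarrow> nat \<Rightarrow> nat \<times> 'a \<Rightarrow> 'a set set"

text \<open>
  The last condition says that each facet lies inside its subdomain, on one lower-dimensional
  subdomain, or on one part of the boundary.
\<close>

definition admissible_mesh :: "'a::euclidean_space geometry \<Rightarrow> real \<Rightarrow> 'a mesh \<Rightarrow> bool"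
  where "admissible_mesh G \<sigma> M \<longleftrightarrow>
    (\<forall>d\<le>DIM('a). \<forall>i\<in>Idx G d. triangulates \<sigma> d (Sub G d i) (MO M d i)) \<and>
    (\<forall>d<DIM('a). \<forall>i\<in>Idx G d. \<forall>j\<in>interfaces G d i. triangulates \<sigma> d (Sub G d i) (MG M d i j)) \<and>
    (\<forall>d<DIM('a). \<forall>k\<in>Idx G (Suc d). \<forall>T\<in>MO M (Suc d) k. \<forall>f. f facet_of T \<longrightarrow>
       rel_interior f \<subseteq> Sub G (Suc d) k \<or> (\<exists>i\<in>Idx G d. rel_interior f \<subseteq> Sub G d i) \<or>
       rel_interior f \<subseteq> BdD G \<or> rel_interior f \<subseteq> BdN G)"

definition mesh_elements :: "'a geometry \<Rightarrow> 'a mesh \<Rightarrow> nat \<Rightarrow> 'a set set"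
  where "mesh_elements G M d = (\<Union>i\<in>Idx G d. MO M d i)"

definition outer_normal :: "'a::euclidean_space set \<Rightarrow> 'a set \<Rightarrow> 'a"
  where "outer_normal T f =
    (THE \<nu>. \<nu> \<in> tangent T \<and> norm \<nu> = 1 \<and> (\<forall>x\<in>f. \<forall>y\<in>T. (y - x) \<bullet> \<nu> \<le> 0))"

text \<open>The facet \<open>f\<close> of the element \<open>T\<close> in the mesh of subdomain \<open>k\<close> lies on the interface \<open>(i, (k, \<nu>))\<close>.\<close>

definition iface_facets :: "'a::euclidean_space geometry \<Rightarrow> 'a mesh \<Rightarrow> nat \<Rightarrow> nat \<Rightarrow> nat \<times> 'a
    \<Rightarrow> ('a set \<times> 'a set) set"
  where "iface_facets G M d i j = {(T, f). i \<in> Idx G d \<and> j \<in> interfaces G d i \<and>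
    T \<in> MO M (Suc d) (fst j) \<and> f facet_of T \<and> rel_interior f \<subseteq> Sub G d i \<and> outer_normal T f = snd j}"

definition on_Gamma :: "'a::euclidean_space geometry \<Rightarrow> 'a mesh \<Rightarrow> nat \<Rightarrow> 'a set \<Rightarrow> 'a set \<Rightarrow> bool"
  where "on_Gamma G M d T f \<longleftrightarrow> (\<exists>i j. (T, f) \<in> iface_facets G M d i j)"


section \<open>Finite element spaces\<close>

text \<open>
  A discrete flux in dimension \<open>d\<close> is a function \<open>v\<close> that assigns to each element \<open>T\<close> the
  polynomial field \<open>v T\<close> whose restriction to \<open>T\<close> is the restriction of the flux; similarly for
  piecewise constants.
\<close>

definition rt0 :: "'a::euclidean_space set \<Rightarrow> ('a \<Rightarrow> 'a) set"
  where "rt0 T = {v. \<exists>a\<in>tangent T. \<exists>c. \<exists>z\<in>T. v = (\<lambda>x. a + c *\<^sub>R (x - z))}"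

text \<open>The normal component of a field in \<open>rt0 T\<close> is constant on each facet.\<close>

definition flux :: "'a::euclidean_space set \<Rightarrow> 'a set \<Rightarrow> ('a \<Rightarrow> 'a) \<Rightarrow> real"
  where "flux T f v = (THE c. \<forall>x\<in>f. v x \<bullet> outer_normal T f = c)"

definition rt0_basis :: "'a::euclidean_space set \<Rightarrow> 'a set \<Rightarrow> 'a \<Rightarrow> 'a"
  where "rt0_basis T f = (THE \<phi>. \<phi> \<in> rt0 T \<and>
    (\<forall>g. g facet_of T \<longrightarrow> flux T g \<phi> = (if g = f then 1 else 0)))"

text \<open>
  Continuity of the normal components across facets inside a subdomain is what square
  integrability of the divergence means for elementwise \<open>rt0\<close> fields.
\<close>

definition Vh :: "'a::euclidean_space geometry \<Rightarrow> 'a mesh \<Rightarrow> nat \<Rightarrow> ('a set \<Rightarrow> 'a \<Rightarrow> 'a) set"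
  where "Vh G M d = {v.
    (\<forall>T. T \<notin> mesh_elements G M d \<longrightarrow> v T = 0) \<and>
    (\<forall>T\<in>mesh_elements G M d. v T \<in> rt0 T) \<and>
    (\<forall>i\<in>Idx G d. \<forall>T\<in>MO M d i. \<forall>T'\<in>MO M d i. \<forall>f. T \<noteq> T' \<and> f facet_of T \<and> f facet_of T' \<and>
       rel_interior f \<subseteq> Sub G d i \<longrightarrow> flux T f (v T) + flux T' f (v T') = 0) \<and>
    (\<forall>T\<in>mesh_elements G M d. \<forall>f. f facet_of T \<and> rel_interior f \<subseteq> BdN G \<longrightarrow> flux T f (v T) = 0)}"

definition V0h_dim :: "'a::euclidean_space geometry \<Rightarrow> 'a mesh \<Rightarrow> nat \<Rightarrow> ('a set \<Rightarrow> 'a \<Rightarrow> 'a) set"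
  where "V0h_dim G M d = {v \<in> Vh G M d. \<forall>T f. on_Gamma G M (d - 1) T f \<longrightarrow> flux T f (v T) = 0}"

definition Lh :: "'a::euclidean_space geometry \<Rightarrow> 'a mesh \<Rightarrow> nat
    \<Rightarrow> (nat \<Rightarrow> nat \<times> 'a \<Rightarrow> 'a set \<Rightarrow> real) set"
  where "Lh G M d = {\<mu>. \<forall>i j S. \<not> (i \<in> Idx G d \<and> j \<in> interfaces G d i \<and> S \<in> MG M d i j) \<longrightarrow> \<mu> i j S = 0}"

definition Qh_dim :: "'a geometry \<Rightarrow> 'a mesh \<Rightarrow> nat \<Rightarrow> ('a set \<Rightarrow> real) set"
  where "Qh_dim G M d = {q. \<forall>T. T \<notin> mesh_elements G M d \<longrightarrow> q T = 0}"

type_synonym 'a fluxes = "nat \<Rightarrow> 'a set \<Rightarrow> 'a \<Rightarrow> 'a"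
type_synonym 'a mortars = "nat \<Rightarrow> nat \<Rightarrow> nat \<times> 'a \<Rightarrow> 'a set \<Rightarrow> real"
type_synonym 'a pressures = "nat \<Rightarrow> 'a set \<Rightarrow> real"

definition direct_sum :: "nat set \<Rightarrow> (nat \<Rightarrow> 'v::zero set) \<Rightarrow> (nat \<Rightarrow> 'v) set"
  where "direct_sum D V = {v. (\<forall>d\<in>D. v d \<in> V d) \<and> (\<forall>d. d \<notin> D \<longrightarrow> v d = 0)}"

definition Wh :: "'a::euclidean_space geometry \<Rightarrow> 'a mesh \<Rightarrow> ('a fluxes \<times> 'a mortars) set"
  where "Wh G M = direct_sum {1..DIM('a)} (V0h_dim G M) \<times> direct_sum {..<DIM('a)} (Lh G M)"

definition Qh :: "'a::euclidean_space geometry \<Rightarrow> 'a mesh \<Rightarrow> 'a pressures set"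
  where "Qh G M = direct_sum {..DIM('a)} (Qh_dim G M)"


section \<open>Discrete extension\<close>

definition mortar :: "'a::euclidean_space mesh \<Rightarrow> nat \<Rightarrow> (nat \<Rightarrow> nat \<times> 'a \<Rightarrow> 'a set \<Rightarrow> real)
    \<Rightarrow> nat \<Rightarrow> nat \<times> 'a \<Rightarrow> 'a \<Rightarrow> real"
  where "mortar M d \<mu> i j = piecewise (MG M d i j) (\<lambda>S _. \<mu> i j S)"

definition normal_trace :: "'a::euclidean_space geometry \<Rightarrow> 'a mesh \<Rightarrow> nat \<Rightarrow> ('a set \<Rightarrow> 'a \<Rightarrow> 'a)
    \<Rightarrow> nat \<Rightarrow> nat \<times> 'a \<Rightarrow> 'a \<Rightarrow> real"
  where "normal_trace G M d v i j x =
    (\<Sum>(T, f)\<in>iface_facets G M d i j. indicator (rel_interior f) x * flux T f (v T))"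

definition ip_Gamma :: "'a::euclidean_space geometry \<Rightarrow> nat \<Rightarrow> (nat \<Rightarrow> nat \<times> 'a \<Rightarrow> 'a \<Rightarrow> real)
    \<Rightarrow> (nat \<Rightarrow> nat \<times> 'a \<Rightarrow> 'a \<Rightarrow> real) \<Rightarrow> real"
  where "ip_Gamma G d \<xi> \<eta> = (\<Sum>i\<in>Idx G d. \<Sum>j\<in>interfaces G d i.
    LINT x:Sub G d i|flat_measure (Sub G d i). \<xi> i j x * \<eta> i j x)"

definition proj_trace :: "'a::euclidean_space geometry \<Rightarrow> 'a mesh \<Rightarrow> nat
    \<Rightarrow> (nat \<Rightarrow> nat \<times> 'a \<Rightarrow> 'a set \<Rightarrow> real) \<Rightarrow> nat \<Rightarrow> nat \<times> 'a \<Rightarrow> 'a \<Rightarrow> real"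
  where "proj_trace G M d \<mu> = (THE \<xi>. \<xi> \<in> normal_trace G M d ` Vh G M (Suc d) \<and>
    (\<forall>v\<in>Vh G M (Suc d). ip_Gamma G d (\<xi> - mortar M d \<mu>) (normal_trace G M d v) = 0))"

definition Rh_dim :: "'a::euclidean_space geometry \<Rightarrow> 'a mesh \<Rightarrow> nat
    \<Rightarrow> (nat \<Rightarrow> nat \<times> 'a \<Rightarrow> 'a set \<Rightarrow> real) \<Rightarrow> 'a set \<Rightarrow> 'a \<Rightarrow> 'a"
  where "Rh_dim G M d \<mu> = (THE v. v \<in> Vh G M (Suc d) \<and> normal_trace G M d v = proj_trace G M d \<mu> \<and>
    (\<forall>T\<in>mesh_elements G M (Suc d). \<forall>f. f facet_of T \<and> \<not> on_Gamma G M d T f \<longrightarrow> flux T f (v T) = 0))"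

definition Rh :: "'a::euclidean_space geometry \<Rightarrow> 'a mesh \<Rightarrow> 'a mortars \<Rightarrow> 'a fluxes"
  where "Rh G M \<mu> = (\<lambda>d. if d \<in> {1..DIM('a)} then Rh_dim G M (d - 1) (\<mu> (d - 1)) else 0)"


section \<open>Forms, norm and operators\<close>

definition K_form :: "'a::euclidean_space geometry \<Rightarrow> 'a mesh \<Rightarrow> 'a params \<Rightarrow> 'a fluxes \<Rightarrow> 'a fluxes \<Rightarrow> real"
  where "K_form G M P u v = (\<Sum>d\<le>DIM('a). \<Sum>i\<in>Idx G d. LINT x:Sub G d i|flat_measure (Sub G d i).
    Kinv G P d i (piecewise (MO M d i) (u d) x) \<bullet> piecewise (MO M d i) (v d) x)"

definition K_form_diag :: "'a::euclidean_space geometry \<Rightarrow> 'a mesh \<Rightarrow> 'a params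
    \<Rightarrow> 'a fluxes \<Rightarrow> 'a fluxes \<Rightarrow> real"
  where "K_form_diag G M P u v = (\<Sum>d\<le>DIM('a). \<Sum>i\<in>Idx G d. \<Sum>T\<in>MO M d i. \<Sum>f | f facet_of T.
    flux T f (u d T) * flux T f (v d T) *
    (LINT x:T|flat_measure T. Kinv G P d i (rt0_basis T f x) \<bullet> rt0_basis T f x))"

definition Gamma_form :: "'a::euclidean_space geometry \<Rightarrow> 'a mesh \<Rightarrow> 'a params \<Rightarrow> 'a mortars \<Rightarrow> 'a mortars \<Rightarrow> real"
  where "Gamma_form G M P \<theta> \<mu> = (\<Sum>d<DIM('a). ip_Gamma G d
    (\<lambda>i j x. Gam P d i j * inverse (PermN P d i j) * mortar M d (\<theta> d) i j x) (mortar M d (\<mu> d)))"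

definition a_form :: "'a::euclidean_space geometry \<Rightarrow> 'a mesh \<Rightarrow> 'a params
    \<Rightarrow> 'a fluxes \<times> 'a mortars \<Rightarrow> 'a fluxes \<times> 'a mortars \<Rightarrow> real"
  where "a_form G M P = (\<lambda>(u, \<theta>) (v, \<mu>).
    K_form G M P (u + Rh G M \<theta>) (v + Rh G M \<mu>) + Gamma_form G M P \<theta> \<mu>)"

definition aD_form :: "'a::euclidean_space geometry \<Rightarrow> 'a mesh \<Rightarrow> 'a params
    \<Rightarrow> 'a fluxes \<times> 'a mortars \<Rightarrow> 'a fluxes \<times> 'a mortars \<Rightarrow> real"
  where "aD_form G M P = (\<lambda>(u, \<theta>) (v, \<mu>).
    K_form_diag G M P (u + Rh G M \<theta>) (v + Rh G M \<mu>) + Gamma_form G M P \<theta> \<mu>)"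

definition jump :: "'a::euclidean_space geometry \<Rightarrow> 'a mesh \<Rightarrow> 'a mortars \<Rightarrow> nat \<Rightarrow> nat \<Rightarrow> 'a \<Rightarrow> real"
  where "jump G M \<mu> d i x = - (\<Sum>j\<in>interfaces G d i. mortar M d (\<mu> d) i j x)"

text \<open>
  For members of \<open>Wh\<close>, the convention that fluxes vanish for \<open>d = 0\<close> and mortars for \<open>d = n\<close> is
  built into \<open>direct_sum\<close>, so that the sums over all dimensions need no case distinction.
\<close>

definition mixed_div :: "'a::euclidean_space geometry \<Rightarrow> 'a mesh \<Rightarrow> 'a fluxes \<times> 'a mortars
    \<Rightarrow> nat \<Rightarrow> nat \<Rightarrow> 'a \<Rightarrow> real"
  where "mixed_div G M = (\<lambda>(u, \<mu>) d i x.
    piecewise (MO M d i) (\<lambda>T. flat_div T (u d T)) x + jump G M \<mu> d i x)"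

definition b_form :: "'a::euclidean_space geometry \<Rightarrow> 'a mesh \<Rightarrow> 'a fluxes \<times> 'a mortars \<Rightarrow> 'a pressures \<Rightarrow> real"
  where "b_form G M = (\<lambda>(v, \<mu>) q. - (\<Sum>d\<le>DIM('a). \<Sum>i\<in>Idx G d.
    LINT x:Sub G d i|flat_measure (Sub G d i).
      piecewise (MO M d i) (\<lambda>T _. q d T) x * mixed_div G M (v + Rh G M \<mu>, \<mu>) d i x))"

definition Dh :: "'a::euclidean_space geometry \<Rightarrow> 'a mesh \<Rightarrow> 'a params \<Rightarrow> 'a pressures \<Rightarrow> 'a fluxes \<times> 'a mortars"
  where "Dh G M P p = (THE w. w \<in> Wh G M \<and> (\<forall>r\<in>Wh G M. aD_form G M P w r = b_form G M r p))"

definition L_form :: "'a::euclidean_space geometry \<Rightarrow> 'a mesh \<Rightarrow> 'a params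
    \<Rightarrow> ('a fluxes \<times> 'a mortars) \<times> 'a pressures \<Rightarrow> ('a fluxes \<times> 'a mortars) \<times> 'a pressures \<Rightarrow> real"
  where "L_form G M P = (\<lambda>(w, p) (r, q).
    a_form G M P w r + aD_form G M P (Dh G M P p) r + aD_form G M P (Dh G M P q) w)"

definition triple_norm :: "'a::euclidean_space geometry \<Rightarrow> 'a mesh \<Rightarrow> 'a params
    \<Rightarrow> ('a fluxes \<times> 'a mortars) \<times> 'a pressures \<Rightarrow> real"
  where "triple_norm G M P = (\<lambda>(r, q). sqrt (a_form G M P r r + aD_form G M P (Dh G M P q) (Dh G M P q)))"

definition A_op :: "'a::euclidean_space geometry \<Rightarrow> 'a mesh \<Rightarrow> 'a params
    \<Rightarrow> 'a fluxes \<times> 'a mortars \<Rightarrow> 'a fluxes \<times> 'a mortars \<Rightarrow> real"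
  where "A_op G M P w = functional (Wh G M) (a_form G M P w)"

definition DA_op :: "'a::euclidean_space geometry \<Rightarrow> 'a mesh \<Rightarrow> 'a params
    \<Rightarrow> 'a fluxes \<times> 'a mortars \<Rightarrow> 'a fluxes \<times> 'a mortars \<Rightarrow> real"
  where "DA_op G M P w = functional (Wh G M) (aD_form G M P w)"

definition B_op :: "'a::euclidean_space geometry \<Rightarrow> 'a mesh
    \<Rightarrow> 'a fluxes \<times> 'a mortars \<Rightarrow> 'a pressures \<Rightarrow> real"
  where "B_op G M r = functional (Qh G M) (b_form G M r)"

definition BT_op :: "'a::euclidean_space geometry \<Rightarrow> 'a mesh
    \<Rightarrow> 'a pressures \<Rightarrow> 'a fluxes \<times> 'a mortars \<Rightarrow> real"
  where "BT_op G M q = functional (Wh G M) (\<lambda>r. b_form G M r q)"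

definition A_inv :: "'a::euclidean_space geometry \<Rightarrow> 'a mesh \<Rightarrow> 'a params
    \<Rightarrow> ('a fluxes \<times> 'a mortars \<Rightarrow> real) \<Rightarrow> 'a fluxes \<times> 'a mortars"
  where "A_inv G M P = inv_into (Wh G M) (A_op G M P)"

definition schur :: "'a::euclidean_space geometry \<Rightarrow> 'a mesh \<Rightarrow> 'a params \<Rightarrow> 'a pressures \<Rightarrow> 'a pressures \<Rightarrow> real"
  where "schur G M P q = B_op G M (inv_into (Wh G M) (DA_op G M P) (BT_op G M q))"

definition schur_inv :: "'a::euclidean_space geometry \<Rightarrow> 'a mesh \<Rightarrow> 'a params \<Rightarrow> ('a pressures \<Rightarrow> real) \<Rightarrow> 'a pressures"
  where "schur_inv G M P = inv_into (Qh G M) (schur G M P)"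

definition saddle_op :: "'a::euclidean_space geometry \<Rightarrow> 'a mesh \<Rightarrow> 'a params
    \<Rightarrow> ('a fluxes \<times> 'a mortars) \<times> 'a pressures
    \<Rightarrow> ('a fluxes \<times> 'a mortars \<Rightarrow> real) \<times> ('a pressures \<Rightarrow> real)"
  where "saddle_op G M P = (\<lambda>(w, p). (A_op G M P w + BT_op G M p, - B_op G M w))"

definition block_diag :: "(('w \<Rightarrow> real) \<Rightarrow> 'w) \<Rightarrow> (('q \<Rightarrow> real) \<Rightarrow> 'q) \<Rightarrow> ('w \<Rightarrow> real) \<times> ('q \<Rightarrow> real) \<Rightarrow> 'w \<times> 'q"
  where "block_diag Hw Hp = (\<lambda>(r, q). (Hw r, Hp q))"

end

theory Submission
  imports Defs
begin

text \<open>
  The operator \<open>\<A>\<close> belongs to the form \<open>\<L>\<close> up to the sign of the second test function: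
  \<open>\<langle>\<A> x, (r, q)\<rangle> = \<L> (x; (r, - q))\<close>, and the sign does not change \<open>|||(r, q)|||\<close>. The square of the
  norm is the quadratic form of \<open>N = diag (A, B D_A\<^sup>-\<^sup>1 B\<^sup>T)\<close>, because
  \<open>a\<^sup>D (D\<^sub>h p, D\<^sub>h q) = b (D\<^sub>h p, q)\<close>. Hence the Riesz representer \<open>N\<^sup>-\<^sup>1 \<A> x\<close> satisfies
  \<open>\<beta> |||x||| \<le> |||N\<^sup>-\<^sup>1 \<A> x||| \<le> \<alpha> |||x|||\<close>: the upper bound is continuity tested with the representer itself
  (\<open>representer_upper\<close>), the lower one is the inf-sup condition, where the symmetry of \<open>\<L>\<close> is used to
  exchange the arguments (\<open>representer_lower\<close>).

  It remains to replace \<open>N\<^sup>-\<^sup>1\<close> by the preconditioner. If \<open>c\<^sub>1 H \<le> N\<^sup>-\<^sup>1 \<le> c\<^sub>2 H\<close> as quadratic forms on the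
  dual space, then \<open>c\<^sub>1 |||H f||| \<le> |||N\<^sup>-\<^sup>1 f||| \<le> c\<^sub>2 |||H f|||\<close> for every functional \<open>f\<close>
  (\<open>preconditioner_equivalence\<close>); the two blocks are treated separately. So the preconditioned operator
  is bounded by \<open>\<alpha> / c\<^sub>1\<close> and bounded below by \<open>\<beta> / c\<^sub>2\<close>. Being injective on a finite-dimensional space it
  is bijective, and the product of the two operator norms is at most \<open>\<alpha> c\<^sub>2 / (\<beta> c\<^sub>1)\<close>.

  This argument is carried out for an abstract saddle point problem. The other half of the text shows
  that the mixed-dimensional discretization is an instance: its spaces are finite-dimensional, \<open>a\<close>
  and \<open>a\<^sup>D\<close> are symmetric bilinear forms, \<open>b\<close> is bilinear, and \<open>a\<^sup>D\<close> is positive definite. Three facts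
  about meshes carry this. A lowest-order Raviart-Thomas field on a simplex is determined by arbitrary
  prescribed facet fluxes (\<open>rt0_eq_0\<close>, \<open>rt0_exists\<close>). The facets on one side of an interface have
  disjoint relative interiors (\<open>facets_with_same_normal\<close>), so that the normal traces form a
  finite-dimensional inner product space; the \<open>L\<^sup>2\<close> projection onto it exists, and the discrete
  extension \<open>R\<^sub>h\<close> is a well-defined linear map (\<open>linear_Rh_dim\<close>). Finally, the flat measures are finite on
  bounded sets and positive on nonempty relatively open sets, which makes all integrals finite and the
  diagonal entries of \<open>a\<^sup>D\<close> positive.

  Positive definiteness of \<open>a\<close> and of the Schur complement, and the invertibility of their operators, come
  out of the lower spectral bounds on \<open>H\<^bsub>w\<^esub>\<close> and \<open>H\<^bsub>p\<^esub>\<close> themselves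
  (\<open>form_operator_bij_if_bounded_below\<close>).
\<close>

section \<open>Linear algebra on subspaces\<close>

definition finite_dimensional :: "'v::real_vector set \<Rightarrow> bool"
  where "finite_dimensional V \<longleftrightarrow> (\<exists>B. finite B \<and> V = span B)"

text \<open>Linearity in the second argument suffices; the first argument follows by symmetry.\<close>

definition symmetric_form :: "'v::real_vector set \<Rightarrow> ('v \<Rightarrow> 'v \<Rightarrow> real) \<Rightarrow> bool"
  where "symmetric_form V g \<longleftrightarrow>
    (\<forall>x\<in>V. \<forall>y\<in>V. g x y = g y x) \<and> (\<forall>x\<in>V. linear_on V (g x))"

definition positive_form :: "'v::real_vector set \<Rightarrow> ('v \<Rightarrow> 'v \<Rightarrow> real) \<Rightarrow> bool"
  where "positive_form V g \<longleftrightarrow> symmetric_form V g \<and> (\<forall>x\<in>V. x \<noteq> 0 \<longrightarrow> g x x > 0)"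

lemma linear_onI:
  assumes "\<And>x y. x \<in> V \<Longrightarrow> y \<in> V \<Longrightarrow> f (x + y) = f x + f y"
    and "\<And>c x. x \<in> V \<Longrightarrow> f (c *\<^sub>R x) = c *\<^sub>R f x"
  shows "linear_on V f"
  using assms by (auto simp: linear_on_def)

lemma linear_on_add: "linear_on V f \<Longrightarrow> x \<in> V \<Longrightarrow> y \<in> V \<Longrightarrow> f (x + y) = f x + f y"
  by (auto simp: linear_on_def)

lemma linear_on_scale: "linear_on V f \<Longrightarrow> x \<in> V \<Longrightarrow> f (c *\<^sub>R x) = c *\<^sub>R f x"
  by (auto simp: linear_on_def)

lemma linear_on_zero: "linear_on V f \<Longrightarrow> subspace V \<Longrightarrow> f 0 = 0"
  using linear_on_scale[of V f 0 0] by (auto simp: subspace_0)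

lemma linear_on_neg: "linear_on V f \<Longrightarrow> x \<in> V \<Longrightarrow> f (- x) = - f x"
  using linear_on_scale[of V f x "-1"] by auto

lemma linear_on_diff:
  assumes "linear_on V f" "subspace V" "x \<in> V" "y \<in> V"
  shows "f (x - y) = f x - f y"
proof -
  have "f (x + - y) = f x + f (- y)"
    by (rule linear_on_add) (use assms in \<open>auto simp: subspace_neg\<close>)
  then show ?thesis using linear_on_neg[OF assms(1,4)] by simp
qed

lemma linear_on_subset: "linear_on V f \<Longrightarrow> U \<subseteq> V \<Longrightarrow> linear_on U f"
  by (auto simp: linear_on_def subset_iff)

lemma form_linear_right: "symmetric_form V g \<Longrightarrow> x \<in> V \<Longrightarrow> linear_on V (g x)"
  by (auto simp: symmetric_form_def)

lemma positive_form_subset: "positive_form V g \<Longrightarrow> U \<subseteq> V \<Longrightarrow> positive_form U g"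
  unfolding positive_form_def symmetric_form_def
  by (intro conjI ballI; elim conjE) (simp_all add: subset_iff linear_on_def)

lemma form_sym: "symmetric_form V g \<Longrightarrow> x \<in> V \<Longrightarrow> y \<in> V \<Longrightarrow> g x y = g y x"
  by (auto simp: symmetric_form_def)

lemma form_linear_left:
  assumes "symmetric_form V g" "subspace V" "y \<in> V"
  shows "linear_on V (\<lambda>x. g x y)"
proof (rule linear_onI)
  fix x x' assume "x \<in> V" "x' \<in> V"
  then show "g (x + x') y = g x y + g x' y"
    using linear_on_add[OF form_linear_right[OF assms(1,3)]] form_sym[OF assms(1,3)]
    by (simp add: subspace_add[OF assms(2)])
next
  fix c x assume "x \<in> V"
  then show "g (c *\<^sub>R x) y = c *\<^sub>R g x y"
    using linear_on_scale[OF form_linear_right[OF assms(1,3)]] form_sym[OF assms(1,3)]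
    by (simp add: subspace_scale[OF assms(2)])
qed

lemma subspace_common_kernel:
  assumes "subspace V" "\<And>\<phi>. \<phi> \<in> \<Phi> \<Longrightarrow> linear_on V (\<phi> :: _ \<Rightarrow> real)"
  shows "subspace {v \<in> V. \<forall>\<phi>\<in>\<Phi>. \<phi> v = 0}"
proof -
  have "subspace {v \<in> V. \<phi> v = 0}" if "linear_on V \<phi>" for \<phi> :: "'a \<Rightarrow> real"
    using assms(1) linear_on_zero[OF that assms(1)] linear_on_add[OF that] linear_on_scale[OF that]
    by (simp add: subspace_def)
  then show ?thesis using assms unfolding subspace_def by blast
qed

text \<open>
  Every functional of the family raises the dimension by at most one: the space is spanned by the
  kernel of the functional and a single further vector.
\<close>

lemma finite_dimensional_separated:
  assumes "finite \<Phi>" "subspace V" "\<And>\<phi>. \<phi> \<in> \<Phi> \<Longrightarrow> linear_on V (\<phi> :: _ \<Rightarrow> real)"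
    and "\<And>x. x \<in> V \<Longrightarrow> (\<And>\<phi>. \<phi> \<in> \<Phi> \<Longrightarrow> \<phi> x = 0) \<Longrightarrow> x = 0"
  shows "finite_dimensional V"
  using assms
proof (induction \<Phi> arbitrary: V rule: finite_induct)
  case empty
  then have "V = {0}" using subspace_0[OF empty.prems(1)] by blast
  then have "V = span {}" by simp
  then show ?case unfolding finite_dimensional_def by blast
next
  case (insert \<phi> \<Phi>)
  note sub = insert.prems(1)
  have lin: "linear_on V \<phi>" using insert.prems(2) by simp
  let ?K = "{x \<in> V. \<phi> x = 0}"
  have "subspace ?K"
    using subspace_common_kernel[OF sub, of "{\<phi>}"] lin by simp
  then have "finite_dimensional ?K"
  proof (rule insert.IH)
    show "linear_on ?K \<psi>" if "\<psi> \<in> \<Phi>" for \<psi>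
      by (rule linear_on_subset[OF insert.prems(2)]) (use that in auto)
    show "x = 0" if "x \<in> ?K" "\<And>\<psi>. \<psi> \<in> \<Phi> \<Longrightarrow> \<psi> x = 0" for x
      using that insert.prems(3)[of x] by auto
  qed
  then obtain B where B: "finite B" "?K = span B"
    unfolding finite_dimensional_def by blast
  show ?case
  proof (cases "?K = V")
    case True then show ?thesis using B unfolding finite_dimensional_def by blast
  next
    case False
    then obtain e where e: "e \<in> V" "\<phi> e \<noteq> 0" by blast
    have "V \<subseteq> span (insert e B)"
    proof
      fix x assume x: "x \<in> V"
      have "x - (\<phi> x / \<phi> e) *\<^sub>R e \<in> V"
        using x e sub by (simp add: subspace_diff subspace_scale)
      moreover have "\<phi> (x - (\<phi> x / \<phi> e) *\<^sub>R e) = 0"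
        using x e sub by (simp add: linear_on_diff[OF lin sub] linear_on_scale[OF lin] subspace_scale)
      ultimately have "x - (\<phi> x / \<phi> e) *\<^sub>R e \<in> span B" using B(2) by blast
      then show "x \<in> span (insert e B)" by (auto simp: span_insert)
    qed
    moreover have "span (insert e B) \<subseteq> V"
    proof (rule span_minimal[OF _ sub])
      have "B \<subseteq> ?K" using B(2) span_superset[of B] by simp
      then show "insert e B \<subseteq> V" using e(1) by auto
    qed
    ultimately show ?thesis using B(1) unfolding finite_dimensional_def by blast
  qed
qed

lemma finite_dimensional_Times:
  assumes "finite_dimensional V" "finite_dimensional U"
  shows "finite_dimensional (V \<times> U)"
proof -
  obtain B C where B: "finite B" "V = span B" and C: "finite C" "U = span C"
    using assms unfolding finite_dimensional_def by blast
  let ?i = "\<lambda>x::'a. (x, 0::'b)" and ?j = "\<lambda>y::'b. (0::'a, y)"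
  have li: "linear ?i" and lj: "linear ?j" by (auto intro!: linearI)
  have "V \<times> U = span (?i ` B \<union> ?j ` C)"
    unfolding span_Un linear_span_image[OF li] linear_span_image[OF lj] B(2) C(2)
    by force
  moreover have "finite (?i ` B \<union> ?j ` C)" using B(1) C(1) by simp
  ultimately show ?thesis unfolding finite_dimensional_def by (intro exI conjI)
qed

lemma finite_dimensional_image:
  assumes "finite_dimensional V" "linear_on V f" "subspace V"
  shows "subspace (f ` V) \<and> finite_dimensional (f ` V)"
proof -
  obtain B where B: "finite B" "V = span B" using assms(1) unfolding finite_dimensional_def by blast
  have sub: "subspace (f ` V)"
    unfolding subspace_def
  proof (intro conjI ballI allI)
    show "0 \<in> f ` V" using linear_on_zero[OF assms(2,3)] subspace_0[OF assms(3)] by force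
    show "x + y \<in> f ` V" if "x \<in> f ` V" "y \<in> f ` V" for x y
      using that linear_on_add[OF assms(2)] subspace_add[OF assms(3)] by (auto simp: image_iff) metis
    show "c *\<^sub>R x \<in> f ` V" if "x \<in> f ` V" for c x
      using that linear_on_scale[OF assms(2)] subspace_scale[OF assms(3)] by (auto simp: image_iff) metis
  qed
  have "f x \<in> span (f ` B) \<and> x \<in> V" if "x \<in> span B" for x
    using that
  proof (induction rule: span_induct_alt)
    case base
    then show ?case using linear_on_zero[OF assms(2,3)] by (simp add: span_zero subspace_0[OF assms(3)])
  next
    case (step c x y)
    have x: "x \<in> V" "c *\<^sub>R x \<in> V" using step(1) B(2) by (auto intro: span_base span_scale)
    then show ?case
      using step linear_on_add[OF assms(2) x(2)] linear_on_scale[OF assms(2) x(1)] subspace_add[OF assms(3)]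
      by (simp add: span_add span_scale span_base)
  qed
  then have "f ` V \<subseteq> span (f ` B)" using B(2) by blast
  moreover have "span (f ` B) \<subseteq> f ` V"
    by (rule span_minimal[OF _ sub]) (use B(2) in \<open>auto intro: span_base\<close>)
  ultimately show ?thesis using sub B(1) unfolding finite_dimensional_def by blast
qed

text \<open>
  Gram-Schmidt in disguise. A new spanning vector enters through its component \<open>e\<close> orthogonal to the
  previous span, and a multiple of \<open>e\<close> corrects the representer found so far.
\<close>

lemma riesz_finite_dimensional:
  assumes pos: "positive_form V g" and fin: "finite_dimensional V" and l: "linear_on V l"
  shows "\<exists>w\<in>V. \<forall>x\<in>V. g w x = l x"
proof -
  obtain B where "finite B" "V = span B" using fin unfolding finite_dimensional_def by blast
  from \<open>finite B\<close> have "positive_form (span B) g \<Longrightarrow> linear_on (span B) l \<Longrightarrow>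
      \<exists>w\<in>span B. \<forall>x\<in>span B. g w x = l x" for l
  proof (induction B arbitrary: l rule: finite_induct)
    case empty
    have "l 0 = 0" using linear_on_zero[OF empty.prems(2)] by simp
    moreover have "g 0 0 = 0"
      using linear_on_zero[OF form_linear_right[of "span {}" g 0]] empty.prems(1)
      by (simp add: positive_form_def)
    ultimately show ?case by simp
  next
    case (insert b B)
    let ?V = "span (insert b B)"
    have sub: "span B \<subseteq> ?V" by (simp add: span_mono subset_insertI)
    have bV: "b \<in> ?V" by (simp add: span_base)
    have sym: "symmetric_form ?V g" using insert.prems(1) by (simp add: positive_form_def)
    have posB: "positive_form (span B) g"
      by (rule positive_form_subset[OF insert.prems(1) sub])
    have lB: "linear_on (span B) l" using linear_on_subset[OF insert.prems(2) sub] .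
    show ?case
    proof (cases "b \<in> span B")
      case True
      then have "?V = span B" by (simp add: span_redundant)
      then show ?thesis using insert.IH[OF posB lB] by simp
    next
      case False
      have "linear_on (span B) (g b)"
        by (rule linear_on_subset[OF form_linear_right[OF sym bV] sub])
      from insert.IH[OF posB this] obtain p
        where p: "p \<in> span B" "\<And>x. x \<in> span B \<Longrightarrow> g p x = g b x" by blast
      from insert.IH[OF posB lB] obtain w
        where w: "w \<in> span B" "\<And>x. x \<in> span B \<Longrightarrow> g w x = l x" by blast
      define e where "e = b - p"
      have e: "e \<in> ?V" "e \<noteq> 0"
        using p(1) False sub bV by (auto simp: e_def span_diff)
      have orth: "g e x = 0" if "x \<in> span B" for x
      proof -
        have "g (b - p) x = g b x - g p x"
          by (rule linear_on_diff[OF form_linear_left[OF sym]]) (use that p sub bV in auto)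
        then show ?thesis using p(2)[OF that] by (simp add: e_def)
      qed
      have ee: "g e e > 0" using insert.prems(1) e by (auto simp: positive_form_def)
      \<comment> \<open>
        With this factor the new representer is correct at \<open>e\<close>; at the old span it
        stays so by orthogonality.
      \<close>
      define t where "t = (l e - g w e) / g e e"
      let ?w = "w + t *\<^sub>R e"
      have wV: "?w \<in> ?V" using w(1) e(1) sub by (auto intro: span_add span_scale)
      have L: "g ?w x = g w x + t * g e x" if "x \<in> ?V" for x
        using linear_on_add[OF form_linear_left[OF sym subspace_span that], of w "t *\<^sub>R e"]
          linear_on_scale[OF form_linear_left[OF sym subspace_span that] e(1), of t]
          subsetD[OF sub w(1)] span_scale[OF e(1), of t] by simp
      have "g ?w x = l x" if x: "x \<in> ?V" for x
      proof -
        obtain s where s: "x - s *\<^sub>R b \<in> span B" using x by (auto simp: span_insert)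
        define y where "y = x - s *\<^sub>R e"
        have "y = (x - s *\<^sub>R b) + s *\<^sub>R p" by (simp add: y_def e_def scaleR_diff_right)
        then have y: "y \<in> span B" using s p(1) by (simp add: span_add span_scale)
        have xe: "x = y + s *\<^sub>R e" by (simp add: y_def)
        have split: "h x = h y + s * h e" if "linear_on ?V h" for h :: "'a \<Rightarrow> real"
          using linear_on_add[OF that, of y "s *\<^sub>R e"] linear_on_scale[OF that e(1), of s]
            subsetD[OF sub y] span_scale[OF e(1), of s] xe by simp
        have "g ?w y = l y" using L[of y] y sub orth[OF y] w(2)[OF y] by auto
        moreover have "g ?w e = l e" using L[OF e(1)] ee by (simp add: t_def)
        ultimately show ?thesis
          using split[OF form_linear_right[OF sym wV]] split[OF insert.prems(2)] by simp
      qed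
      then show ?thesis using wV by blast
    qed
  qed
  then show ?thesis using assms \<open>V = span B\<close> by simp
qed

text \<open>
  The image of a basis is independent and has the size of the basis, so by the exchange lemma it spans
  the space.
\<close>

lemma injective_endomorphism_surjective:
  assumes fin: "finite_dimensional V" and lin: "linear_on V f" and maps: "f ` V \<subseteq> V"
    and inj: "\<And>x. x \<in> V \<Longrightarrow> f x = 0 \<Longrightarrow> x = 0"
  shows "bij_betw f V V"
proof -
  obtain B0 where "finite B0" "V = span B0" using fin unfolding finite_dimensional_def by blast
  then obtain B where B: "finite B" "V = span B" "independent B"
    by (metis finite_subset maximal_independent_subset span_mono span_span subset_antisym)
  have sub: "subspace V" by (simp add: B(2))
  obtain g where g: "linear g" "\<And>x. x \<in> B \<Longrightarrow> g x = f x"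
    using linear_independent_extend[OF B(3), of f] by blast
  have "x \<in> V \<and> g x = f x" if "x \<in> span B" for x
    using that
  proof (induction rule: span_induct_alt)
    case base
    then show ?case using linear_on_zero[OF lin sub] linear_0[OF g(1)] subspace_0[OF sub] by simp
  next
    case (step c x y)
    have "x \<in> V" "c *\<^sub>R x \<in> V" using B(2) step(1) by (auto intro: span_base span_scale)
    then show ?case using step g subspace_add[OF sub]
      by (simp add: linear_on_add[OF lin] linear_on_scale[OF lin] linear_add linear_scale)
  qed
  then have eq: "g x = f x" if "x \<in> span B" for x using that by blast
  have injf: "inj_on f V"
  proof (rule inj_onI)
    fix x y assume xy: "x \<in> V" "y \<in> V" "f x = f y"
    then have "f (x - y) = 0" by (simp add: linear_on_diff[OF lin sub])
    then show "x = y" using inj[of "x - y"] xy sub by (simp add: subspace_diff)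
  qed
  then have injg: "inj_on g (span B)" using eq B(2) by (metis inj_on_cong)
  have "independent (g ` B)" by (rule linear_independent_injective_image[OF g(1) B(3) injg])
  have card: "card (g ` B) = card B"
    by (rule card_image[OF inj_on_subset[OF injg span_superset]])
  have "V \<subseteq> span (g ` B)"
  proof
    fix x assume x: "x \<in> V"
    show "x \<in> span (g ` B)"
    proof (rule ccontr)
      assume n: "x \<notin> span (g ` B)"
      then have "independent (insert x (g ` B))"
        using \<open>independent (g ` B)\<close> by (simp add: independent_insert)
      moreover have "insert x (g ` B) \<subseteq> span B"
        using x maps eq B(2) by (auto simp: span_base)
      ultimately have "card (insert x (g ` B)) \<le> card B"
        using independent_span_bound[OF B(1)] by blast
      moreover have "x \<notin> g ` B" using n span_base[of x "g ` B"] by blast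
      ultimately show False using card B(1) by simp
    qed
  qed
  also have "span (g ` B) = f ` V" unfolding linear_span_image[OF g(1)] B(2) by (rule image_cong[OF refl eq])
  finally show ?thesis using maps injf by (auto simp: bij_betw_def)
qed

section \<open>Preconditioning a symmetric operator\<close>

lemma functional_in_dual:
  "subspace V \<Longrightarrow> linear_on V F \<Longrightarrow> functional V F \<in> dual V"
  by (auto simp: dual_def functional_def linear_on_def subspace_add subspace_scale)

lemma functional_apply [simp]: "x \<in> V \<Longrightarrow> functional V F x = F x"
  by (simp add: functional_def)

lemma dual_eqI:
  assumes "F \<in> dual V" "F' \<in> dual V" "\<And>x. x \<in> V \<Longrightarrow> F x = F' x"
  shows "F = F'"
proof
  show "F x = F' x" for x using assms by (cases "x \<in> V") (auto simp: dual_def)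
qed

lemma dual_linear: "F \<in> dual V \<Longrightarrow> linear_on V F"
  by (simp add: dual_def)

lemma subspace_dual: "subspace (dual V)"
  by (auto simp: subspace_def dual_def linear_on_def algebra_simps)

text \<open>A functional on the line through \<open>x\<close> extends to the whole space.\<close>

lemma dual_separates:
  assumes "subspace V" "x \<in> V" "x \<noteq> 0"
  shows "\<exists>F\<in>dual V. F x \<noteq> 0"
proof -
  have "independent {x}" using assms(3) by simp
  then obtain g :: "'a \<Rightarrow> real" where g: "linear g" "g x = 1"
    using linear_independent_extend[of "{x}" "\<lambda>_. 1"] by auto
  then have "functional V g \<in> dual V"
    by (intro functional_in_dual[OF assms(1)] linear_onI) (auto simp: linear_add linear_scale)
  then show ?thesis using g(2) assms(2) by (intro bexI[of _ "functional V g"]) auto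
qed

definition form_operator :: "'v::real_vector set \<Rightarrow> ('v \<Rightarrow> 'v \<Rightarrow> real) \<Rightarrow> 'v \<Rightarrow> 'v \<Rightarrow> real"
  where "form_operator V g x = functional V (g x)"

lemma form_operator_in_dual:
  "subspace V \<Longrightarrow> symmetric_form V g \<Longrightarrow> x \<in> V \<Longrightarrow> form_operator V g x \<in> dual V"
  by (simp add: form_operator_def functional_in_dual form_linear_right)

lemma spd_operator_nonneg:
  assumes "spd_operator V H" "r \<in> dual V" "subspace V"
  shows "0 \<le> r (H r)"
proof (cases "r = 0")
  case False then show ?thesis using assms by (auto simp: spd_operator_def less_imp_le)
qed simp

text \<open>
  A functional outside the range of the operator and its negative would both be sent by \<open>inv_into\<close> to one
  and the same default vector, but the lower bound asks both of them to be positive there. So the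
  operator is onto. By symmetry, all functionals then vanish on its kernel, which is therefore trivial.
\<close>

lemma form_operator_bij_if_bounded_below:
  assumes V: "subspace V" and g: "symmetric_form V g" and H: "spd_operator V H" and c: "c > 0"
    and lower: "\<And>r. r \<in> dual V \<Longrightarrow> c * r (H r) \<le> r (inv_into V (form_operator V g) r)"
  shows "bij_betw (form_operator V g) V (dual V)" and "positive_form V g"
proof -
  let ?G = "form_operator V g"
  have range: "?G x \<in> dual V" if "x \<in> V" for x by (rule form_operator_in_dual[OF V g that])
  have neg: "?G (- x) = - ?G x" if "x \<in> V" for x
  proof (rule dual_eqI[of _ V])
    show "?G (- x) \<in> dual V" "- ?G x \<in> dual V"
      using that range V subspace_dual[of V] by (auto simp: subspace_neg)
    show "?G (- x) y = (- ?G x) y" if "y \<in> V" for y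
      using linear_on_neg[OF form_linear_left[OF g V that] \<open>x \<in> V\<close>] that
      by (simp add: form_operator_def)
  qed
  have surj: "r \<in> ?G ` V" if r: "r \<in> dual V" for r
  proof (rule ccontr)
    assume n: "r \<notin> ?G ` V"
    have mr: "- r \<in> dual V" using r subspace_dual by (rule subspace_neg[rotated])
    have n': "- r \<notin> ?G ` V"
    proof
      assume "- r \<in> ?G ` V"
      then obtain x where "x \<in> V" "- r = ?G x" by blast
      then have "r = ?G (- x)" using neg[of x] by (metis minus_minus)
      then show False using n \<open>x \<in> V\<close> V by (auto simp: subspace_neg)
    qed
    have same: "inv_into V ?G r = inv_into V ?G (- r)"
    proof -
      have "(x \<in> V \<and> ?G x = r) = (x \<in> V \<and> ?G x = - r)" for x using n n' by (metis image_eqI)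
      then show ?thesis by (simp add: inv_into_def)
    qed
    have "r \<noteq> 0"
    proof
      assume "r = 0"
      moreover have "?G 0 = 0"
        by (rule dual_eqI[of _ V])
          (use V range[of 0] subspace_0[OF subspace_dual[of V]] linear_on_zero[OF form_linear_left[OF g V] V]
            in \<open>auto simp: subspace_0 form_operator_def\<close>)
      ultimately show False using n V subspace_0 by force
    qed
    then have "- r \<noteq> 0" by simp
    have "r (H r) > 0" "(- r) (H (- r)) > 0"
      using H r mr \<open>r \<noteq> 0\<close> \<open>- r \<noteq> 0\<close> unfolding spd_operator_def by blast+
    then have "r (inv_into V ?G r) > 0" "(- r) (inv_into V ?G (- r)) > 0"
      using lower[OF r] lower[OF mr] c by (meson less_le_trans mult_pos_pos)+
    then show False using same by simp
  qed
  have zero: "x = 0" if x: "x \<in> V" "?G x = 0" for x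
  proof (rule ccontr)
    assume "x \<noteq> 0"
    then obtain F where F: "F \<in> dual V" "F x \<noteq> 0" using dual_separates[OF V x(1)] by blast
    then obtain y where y: "y \<in> V" "F = ?G y" using surj by blast
    then have "F x = ?G x y" using form_sym[OF g] x(1) by (simp add: form_operator_def)
    then show False using F(2) x(2) by simp
  qed
  have inj: "inj_on ?G V"
  proof (rule inj_onI)
    fix x y assume xy: "x \<in> V" "y \<in> V" "?G x = ?G y"
    have d: "x - y \<in> V" using xy V by (simp add: subspace_diff)
    have "?G (x - y) = 0"
    proof (rule dual_eqI[of _ V])
      show "?G (x - y) z = 0 z" if z: "z \<in> V" for z
      proof -
        have "?G x z = ?G y z" using xy(3) by simp
        then show ?thesis
          using linear_on_diff[OF form_linear_left[OF g V z] V xy(1,2)] z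
          by (simp add: form_operator_def)
      qed
    qed (use range[OF d] subspace_0[OF subspace_dual] in auto)
    then show "x = y" using zero[OF d] by simp
  qed
  show "bij_betw ?G V (dual V)" using inj surj range by (auto simp: bij_betw_def)
  have "g x x > 0" if x: "x \<in> V" "x \<noteq> 0" for x
  proof -
    have "?G x \<noteq> 0" using zero x by blast
    then have "?G x (H (?G x)) > 0" using H range[OF x(1)] by (auto simp: spd_operator_def)
    then have "?G x (inv_into V ?G (?G x)) > 0"
      using lower[OF range[OF x(1)]] c by (meson less_le_trans mult_pos_pos)
    then show ?thesis unfolding inv_into_f_f[OF inj x(1)] using x(1) by (simp add: form_operator_def)
  qed
  then show "positive_form V g" using g by (simp add: positive_form_def)
qed

text \<open>
  The form is only assumed to be semidefinite, since the lemma is also applied to \<open>(r, s) \<mapsto> r (H s)\<close> on the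
  dual space, where nonnegativity is what is at hand.
\<close>

lemma cauchy_schwarz_on:
  assumes V: "subspace V" and g: "symmetric_form V g" and nonneg: "\<And>x. x \<in> V \<Longrightarrow> 0 \<le> g x x"
    and x: "x \<in> V" and y: "y \<in> V"
  shows "(g x y)\<^sup>2 \<le> g x x * g y y"
proof -
  have exp: "g (s *\<^sub>R x + t *\<^sub>R y) (s *\<^sub>R x + t *\<^sub>R y) = s\<^sup>2 * g x x + 2 * s * t * g x y + t\<^sup>2 * g y y"
    for s t
  proof -
    have m: "s *\<^sub>R x \<in> V" "t *\<^sub>R y \<in> V" "s *\<^sub>R x + t *\<^sub>R y \<in> V"
      using V x y by (auto intro: subspace_add subspace_scale)
    show ?thesis
      using form_sym[OF g y x]
      by (simp add: linear_on_add[OF form_linear_left[OF g V m(3)] m(1,2)]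
          linear_on_scale[OF form_linear_left[OF g V m(3)] x]
          linear_on_scale[OF form_linear_left[OF g V m(3)] y]
          linear_on_add[OF form_linear_right[OF g x] m(1,2)]
          linear_on_add[OF form_linear_right[OF g y] m(1,2)]
          linear_on_scale[OF form_linear_right[OF g x] x]
          linear_on_scale[OF form_linear_right[OF g x] y]
          linear_on_scale[OF form_linear_right[OF g y] x]
          linear_on_scale[OF form_linear_right[OF g y] y] algebra_simps power2_eq_square)
  qed
  have pos: "0 \<le> s\<^sup>2 * g x x + 2 * s * t * g x y + t\<^sup>2 * g y y" for s t
    using nonneg[of "s *\<^sub>R x + t *\<^sub>R y"] exp V x y by (simp add: subspace_add subspace_scale)
  show ?thesis
  proof (cases "g y y = 0")
    case True
    have "g x y = 0"
    proof (rule ccontr)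
      assume n: "g x y \<noteq> 0"
      \<comment> \<open>The right-hand side is \<open>- 1\<close>.\<close>
      have "0 \<le> g x x + 2 * (- (g x x + 1) / (2 * g x y)) * g x y"
        using pos[of 1 "- (g x x + 1) / (2 * g x y)"] True by simp
      then show False using n by (simp add: field_simps)
    qed
    then show ?thesis using True by simp
  next
    case False
    then have p: "g y y > 0" using nonneg[OF y] by simp
    have "0 \<le> g y y * (g x x * g y y - (g x y)\<^sup>2)"
      using pos[of "g y y" "- g x y"] by (simp add: algebra_simps power2_eq_square)
    then show ?thesis using p by (simp add: zero_le_mult_iff)
  qed
qed

text \<open>
  With \<open>f = G z\<close>, \<open>u = H f\<close> and \<open>F = f (H f)\<close>, the hypotheses compare \<open>F\<close> with
  \<open>f (G\<^sup>-\<^sup>1 f) = g z z\<close>. The constants enter a second time in the comparison of \<open>F\<close> with \<open>g u u\<close>: since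
  \<open>g u u = G u (H f)\<close> and \<open>F = g z u\<close>, Cauchy-Schwarz for \<open>H\<close> gives \<open>c1 * g u u \<le> F\<close>, and Cauchy-Schwarz for
  \<open>g\<close> gives \<open>F \<le> c2 * g u u\<close>.
\<close>

lemma preconditioner_equivalence:
  assumes V: "subspace V" and g: "positive_form V g" and bij: "bij_betw (form_operator V g) V (dual V)"
    and H: "spd_operator V H" and c1: "c1 > 0" and c2: "c2 > 0"
    and lower: "\<And>r. r \<in> dual V \<Longrightarrow> c1 * r (H r) \<le> r (inv_into V (form_operator V g) r)"
    and upper: "\<And>r. r \<in> dual V \<Longrightarrow> r (inv_into V (form_operator V g) r) \<le> c2 * r (H r)"
    and z: "z \<in> V"
  defines "u \<equiv> H (form_operator V g z)"
  shows "c1\<^sup>2 * g u u \<le> g z z" and "g z z \<le> c2\<^sup>2 * g u u"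
proof -
  let ?G = "form_operator V g"
  have sym: "symmetric_form V g" using g by (simp add: positive_form_def)
  have nonneg: "0 \<le> g x x" if "x \<in> V" for x
    using g that linear_on_zero[OF form_linear_right[OF sym that] V]
    by (cases "x = 0") (auto simp: positive_form_def less_imp_le)
  have range: "?G x \<in> dual V" if "x \<in> V" for x by (rule form_operator_in_dual[OF V sym that])
  have inv: "inv_into V ?G (?G x) = x" if "x \<in> V" for x
    using bij that by (simp add: bij_betw_def inv_into_f_f)
  let ?f = "?G z"
  have f: "?f \<in> dual V" using range[OF z] .
  have u: "u \<in> V" using H f unfolding u_def spd_operator_def by blast
  define h where "h r s = r (H s)" for r s :: "'a \<Rightarrow> real"
  have hform: "symmetric_form (dual V) h"
    unfolding symmetric_form_def
  proof (intro conjI ballI linear_onI)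
    fix r s assume r: "r \<in> dual V" and s: "s \<in> dual V"
    show "h r s = h s r" using H r s by (auto simp: h_def spd_operator_def)
    show "h r (s + s') = h r s + h r s'" if "s' \<in> dual V" for s'
    proof -
      have "H (s + s') = H s + H s'" "H s \<in> V" "H s' \<in> V"
        using H s that by (auto simp: spd_operator_def linear_on_def)
      then show ?thesis using linear_on_add[OF dual_linear[OF r]] by (simp add: h_def)
    qed
    show "h r (c *\<^sub>R s) = c *\<^sub>R h r s" for c
    proof -
      have "H (c *\<^sub>R s) = c *\<^sub>R H s" "H s \<in> V"
        using H s by (auto simp: spd_operator_def linear_on_def)
      then show ?thesis using linear_on_scale[OF dual_linear[OF r]] by (simp add: h_def)
    qed
  qed
  have hpos: "0 \<le> h r r" if "r \<in> dual V" for r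
    unfolding h_def by (rule spd_operator_nonneg[OF H that V])
  let ?F = "h ?f ?f"
  have Hf: "H ?f = u" by (simp add: u_def)
  have F: "?F = g z u" unfolding h_def Hf using u by (simp add: form_operator_def)
  have zF1: "c1 * ?F \<le> g z z" and zF2: "g z z \<le> c2 * ?F"
    using lower[OF f] upper[OF f] inv[OF z] z by (simp_all add: h_def form_operator_def)
  have uF: "c1 * g u u \<le> ?F"
  proof -
    have "g u u = h (?G u) ?f" unfolding h_def Hf using u by (simp add: form_operator_def)
    then have "(g u u)\<^sup>2 \<le> h (?G u) (?G u) * ?F"
      using cauchy_schwarz_on[OF subspace_dual hform hpos range[OF u] f] by simp
    moreover have "c1 * h (?G u) (?G u) \<le> g u u"
      using lower[OF range[OF u]] inv[OF u] u by (simp add: h_def form_operator_def)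
    then have "c1 * (h (?G u) (?G u) * ?F) \<le> g u u * ?F"
      unfolding mult.assoc[symmetric] by (rule mult_right_mono) (rule hpos[OF f])
    ultimately have "c1 * (g u u)\<^sup>2 \<le> g u u * ?F"
      using c1 mult_left_mono[of "(g u u)\<^sup>2" "h (?G u) (?G u) * ?F" c1] by linarith
    then have "g u u * (c1 * g u u) \<le> g u u * ?F"
      by (simp add: power2_eq_square ac_simps)
    then show ?thesis
      using nonneg[OF u] hpos[OF f] by (cases "g u u = 0") auto
  qed
  have Fu: "?F \<le> c2 * g u u"
  proof -
    have "?F\<^sup>2 \<le> g z z * g u u" unfolding F by (rule cauchy_schwarz_on[OF V sym nonneg z u])
    also have "\<dots> \<le> c2 * ?F * g u u" by (rule mult_right_mono[OF zF2 nonneg[OF u]])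
    finally have "?F * ?F \<le> ?F * (c2 * g u u)" by (simp add: power2_eq_square mult.commute mult.left_commute)
    then show ?thesis using hpos[OF f] nonneg[OF u] c2 by (cases "?F = 0") auto
  qed
  have "c1\<^sup>2 * g u u = c1 * (c1 * g u u)" by (simp add: power2_eq_square)
  also have "\<dots> \<le> c1 * ?F" using uF c1 by simp
  finally show "c1\<^sup>2 * g u u \<le> g z z" using zF1 by simp
  have "c2 * ?F \<le> c2 * (c2 * g u u)" using Fu c2 by simp
  then show "g z z \<le> c2\<^sup>2 * g u u" using zF2 by (simp add: power2_eq_square)
qed

section \<open>Preconditioned saddle point operators\<close>

text \<open>
  The forms \<open>a\<close> and \<open>aD\<close> share the space of fluxes and mortars. Only \<open>aD\<close>, which defines the discrete
  gradient, has to be definite from the outset.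
\<close>

locale saddle_point =
  fixes W :: "'v::real_vector set" and Q :: "'q::real_vector set"
    and a :: "'v \<Rightarrow> 'v \<Rightarrow> real" and aD :: "'v \<Rightarrow> 'v \<Rightarrow> real" and b :: "'v \<Rightarrow> 'q \<Rightarrow> real"
  assumes W: "subspace W" and Q: "subspace Q"
    and finW: "finite_dimensional W" and finQ: "finite_dimensional Q"
    and a: "symmetric_form W a" and aD: "positive_form W aD"
    and b_left: "\<And>q. q \<in> Q \<Longrightarrow> linear_on W (\<lambda>r. b r q)"
    and b_right: "\<And>r. r \<in> W \<Longrightarrow> linear_on Q (b r)"
begin

definition grad :: "'q \<Rightarrow> 'v"
  where "grad p = (THE w. w \<in> W \<and> (\<forall>r\<in>W. aD w r = b r p))"

definition schur_form :: "'q \<Rightarrow> 'q \<Rightarrow> real"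
  where "schur_form p q = aD (grad p) (grad q)"

definition energy_norm :: "'v \<times> 'q \<Rightarrow> real"
  where "energy_norm = (\<lambda>(r, q). sqrt (a r r + aD (grad q) (grad q)))"

definition lform :: "'v \<times> 'q \<Rightarrow> 'v \<times> 'q \<Rightarrow> real"
  where "lform = (\<lambda>(w, p) (r, q). a w r + aD (grad p) r + aD (grad q) w)"

definition saddle :: "'v \<times> 'q \<Rightarrow> ('v \<Rightarrow> real) \<times> ('q \<Rightarrow> real)"
  where "saddle = (\<lambda>(w, p). (functional W (a w) + functional W (\<lambda>r. b r p), - functional Q (b w)))"

lemma aD_sym: "symmetric_form W aD"
  using aD by (simp add: positive_form_def)

lemma aD_cancel:
  assumes "w \<in> W" "w' \<in> W" "\<And>r. r \<in> W \<Longrightarrow> aD w r = aD w' r"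
  shows "w = w'"
proof (rule ccontr)
  assume "w \<noteq> w'"
  then have "aD (w - w') (w - w') > 0"
    using aD assms W by (auto simp: positive_form_def subspace_diff)
  moreover have "aD (w - w') (w - w') = aD w (w - w') - aD w' (w - w')"
    using assms W by (intro linear_on_diff[OF form_linear_left[OF aD_sym W] W]) (auto simp: subspace_diff)
  ultimately show False using assms(3)[of "w - w'"] W assms by (simp add: subspace_diff)
qed

lemma grad:
  assumes "q \<in> Q"
  shows grad_in: "grad q \<in> W" and aD_grad: "r \<in> W \<Longrightarrow> aD (grad q) r = b r q"
proof -
  have "\<exists>!w. w \<in> W \<and> (\<forall>r\<in>W. aD w r = b r q)"
    using riesz_finite_dimensional[OF aD finW b_left[OF assms]] aD_cancel by (metis (no_types, lifting))
  then have "grad q \<in> W \<and> (\<forall>r\<in>W. aD (grad q) r = b r q)"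
    unfolding grad_def by (rule theI')
  then show "grad q \<in> W" "r \<in> W \<Longrightarrow> aD (grad q) r = b r q" by auto
qed

lemma schur_form_eq: "p \<in> Q \<Longrightarrow> q \<in> Q \<Longrightarrow> schur_form p q = b (grad p) q"
  using aD_grad[of q "grad p"] form_sym[OF aD_sym grad_in grad_in] grad_in[of p]
  by (simp add: schur_form_def)

lemma symmetric_schur_form: "symmetric_form Q schur_form"
  unfolding symmetric_form_def
proof (intro conjI ballI linear_onI)
  fix p q assume p: "p \<in> Q" and q: "q \<in> Q"
  show "schur_form p q = schur_form q p"
    unfolding schur_form_def by (rule form_sym[OF aD_sym grad_in[OF p] grad_in[OF q]])
  show "schur_form p (q + q') = schur_form p q + schur_form p q'" if "q' \<in> Q" for q'
    using linear_on_add[OF b_right[OF grad_in[OF p]] q that] p q that Q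
    by (simp add: schur_form_eq subspace_add)
  show "schur_form p (c *\<^sub>R q) = c *\<^sub>R schur_form p q" for c
    using linear_on_scale[OF b_right[OF grad_in[OF p]] q] p q Q
    by (simp add: schur_form_eq subspace_scale)
qed

lemma lform_eq:
  assumes "w \<in> W" "p \<in> Q" "r \<in> W" "q \<in> Q"
  shows "lform (w, p) (r, q) = a w r + b r p + b w q"
  using assms by (simp add: lform_def aD_grad)

lemma lform_sym: "x \<in> W \<times> Q \<Longrightarrow> y \<in> W \<times> Q \<Longrightarrow> lform x y = lform y x"
  using form_sym[OF a] by (auto simp: lform_eq)

text \<open>
  The left-hand side is \<open>B D_A\<^sup>-\<^sup>1 B\<^sup>T q\<close>: inverting \<open>D_A\<close> on \<open>B\<^sup>T q\<close> is the definition of the discrete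
  gradient.
\<close>

lemma schur_operator_eq:
  assumes "q \<in> Q"
  shows "functional Q (b (inv_into W (\<lambda>w. functional W (aD w)) (functional W (\<lambda>r. b r q))))
    = form_operator Q schur_form q"
proof -
  have inj: "inj_on (\<lambda>w. functional W (aD w)) W"
  proof (rule inj_onI, rule aD_cancel)
    fix x y r assume "functional W (aD x) = functional W (aD y)" "r \<in> W"
    then show "aD x r = aD y r" by (metis functional_apply)
  qed
  have "functional W (\<lambda>r. b r q) = functional W (aD (grad q))"
    using aD_grad[OF assms] by (auto simp: functional_def fun_eq_iff)
  then have "inv_into W (\<lambda>w. functional W (aD w)) (functional W (\<lambda>r. b r q)) = grad q"
    using inv_into_f_f[OF inj grad_in[OF assms]] by simp
  then show ?thesis
    using schur_form_eq[OF assms] by (auto simp: form_operator_def functional_def fun_eq_iff)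
qed

context
  fixes Hw :: "('v \<Rightarrow> real) \<Rightarrow> 'v" and Hp :: "('q \<Rightarrow> real) \<Rightarrow> 'q"
    and \<alpha> \<beta> c1w c2w c1p c2p :: real
  assumes Hw: "spd_operator W Hw" and Hp: "spd_operator Q Hp"
    and cpos: "c1w > 0" "c2w > 0" "c1p > 0" "c2p > 0"
    and Hw_lower: "\<And>r. r \<in> dual W \<Longrightarrow> c1w * r (Hw r) \<le> r (inv_into W (form_operator W a) r)"
    and Hw_upper: "\<And>r. r \<in> dual W \<Longrightarrow> r (inv_into W (form_operator W a) r) \<le> c2w * r (Hw r)"
    and Hp_lower: "\<And>q. q \<in> dual Q \<Longrightarrow> c1p * q (Hp q) \<le> q (inv_into Q (form_operator Q schur_form) q)"
    and Hp_upper: "\<And>q. q \<in> dual Q \<Longrightarrow> q (inv_into Q (form_operator Q schur_form) q) \<le> c2p * q (Hp q)"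
    and \<alpha>: "\<alpha> > 0" and \<beta>: "\<beta> > 0"
    and continuity: "\<And>x y. x \<in> W \<times> Q \<Longrightarrow> y \<in> W \<times> Q \<Longrightarrow>
          \<bar>lform x y\<bar> \<le> \<alpha> * energy_norm x * energy_norm y"
    and inf_sup: "(INF y\<in>W \<times> Q - {0}. SUP x\<in>W \<times> Q - {0}.
          lform x y / (energy_norm x * energy_norm y)) \<ge> \<beta>"
begin

lemma a_positive: "positive_form W a" and A_bij: "bij_betw (form_operator W a) W (dual W)"
  using form_operator_bij_if_bounded_below[OF W a Hw cpos(1) Hw_lower] by blast+

lemma schur_positive: "positive_form Q schur_form"
  and schur_bij: "bij_betw (form_operator Q schur_form) Q (dual Q)"
  using form_operator_bij_if_bounded_below[OF Q symmetric_schur_form Hp cpos(3) Hp_lower] by blast+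

text \<open>
  The inner product of the triple norm, that is, of the operator \<open>N = diag (A, B D_A\<^sup>-\<^sup>1 B\<^sup>T)\<close>.
\<close>

definition energy :: "'v \<times> 'q \<Rightarrow> 'v \<times> 'q \<Rightarrow> real"
  where "energy x y = a (fst x) (fst y) + schur_form (snd x) (snd y)"

lemma subspace_WQ: "subspace (W \<times> Q)"
  by (rule subspace_Times[OF W Q])

lemma positive_energy: "positive_form (W \<times> Q) energy"
proof -
  have zero: "a 0 0 = 0" "schur_form 0 0 = 0"
    using linear_on_zero[OF form_linear_right[OF a subspace_0[OF W]] W]
      linear_on_zero[OF form_linear_right[OF symmetric_schur_form subspace_0[OF Q]] Q] by auto
  have "energy x x > 0" if "x \<in> W \<times> Q" "x \<noteq> 0" for x
    using that a_positive schur_positive zero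
    by (cases x; cases "fst x = 0"; cases "snd x = 0")
      (auto simp: positive_form_def energy_def zero_prod_def intro: add_pos_pos)
  moreover have "symmetric_form (W \<times> Q) energy"
    unfolding symmetric_form_def linear_on_def energy_def
    using form_sym[OF a] form_sym[OF symmetric_schur_form] linear_on_add[OF form_linear_right[OF a]]
      linear_on_add[OF form_linear_right[OF symmetric_schur_form]]
      linear_on_scale[OF form_linear_right[OF a]]
      linear_on_scale[OF form_linear_right[OF symmetric_schur_form]]
    by (auto simp: algebra_simps)
  ultimately show ?thesis by (simp add: positive_form_def)
qed

lemma energy_norm_eq: "energy_norm x = sqrt (energy x x)"
  by (simp add: energy_norm_def energy_def schur_form_def case_prod_beta)

lemma energy_nonneg: "x \<in> W \<times> Q \<Longrightarrow> 0 \<le> energy x x"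
  using positive_energy linear_on_zero[OF form_linear_right[of "W \<times> Q" energy 0] subspace_WQ]
  by (cases "x = 0") (auto simp: positive_form_def less_imp_le subspace_0[OF subspace_WQ])

lemma energy_norm_nonneg: "x \<in> W \<times> Q \<Longrightarrow> 0 \<le> energy_norm x"
  by (simp add: energy_norm_eq energy_nonneg)

lemma energy_norm_pos: "x \<in> W \<times> Q \<Longrightarrow> x \<noteq> 0 \<Longrightarrow> 0 < energy_norm x"
  using positive_energy unfolding energy_norm_eq positive_form_def by (metis real_sqrt_gt_zero)

lemma energy_norm_0: "energy_norm 0 = 0"
  using linear_on_zero[OF form_linear_right[of "W \<times> Q" energy 0] subspace_WQ] positive_energy
  by (simp add: energy_norm_eq positive_form_def subspace_0[OF subspace_WQ])

lemma energy_cauchy_schwarz: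
  assumes "x \<in> W \<times> Q" "y \<in> W \<times> Q"
  shows "energy x y \<le> energy_norm x * energy_norm y"
proof -
  have "symmetric_form (W \<times> Q) energy" using positive_energy by (simp add: positive_form_def)
  then have "(energy x y)\<^sup>2 \<le> energy x x * energy y y"
    by (rule cauchy_schwarz_on[OF subspace_WQ _ _ assms]) (rule energy_nonneg)
  then have "\<bar>energy x y\<bar> \<le> sqrt (energy x x * energy y y)" by (simp add: real_le_rsqrt)
  then show ?thesis by (simp add: energy_norm_eq real_sqrt_mult)
qed

lemma saddle_in_dual:
  assumes "x \<in> W \<times> Q"
  shows "fst (saddle x) \<in> dual W" "snd (saddle x) \<in> dual Q"
proof -
  obtain w p where x: "x = (w, p)" "w \<in> W" "p \<in> Q" using assms by auto
  have "functional W (a w) \<in> dual W" "functional W (\<lambda>r. b r p) \<in> dual W" "functional Q (b w) \<in> dual Q"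
    using x by (auto intro!: functional_in_dual W Q form_linear_right[OF a] b_left b_right)
  then show "fst (saddle x) \<in> dual W" "snd (saddle x) \<in> dual Q"
    by (auto simp: saddle_def x(1) subspace_add[OF subspace_dual] subspace_neg[OF subspace_dual])
qed

text \<open>
  The Riesz representer \<open>N\<^sup>-\<^sup>1 \<A> x\<close> of the saddle point operator with respect to \<open>energy\<close>.
\<close>

definition representer :: "'v \<times> 'q \<Rightarrow> 'v \<times> 'q"
  where "representer x = (inv_into W (form_operator W a) (fst (saddle x)),
    inv_into Q (form_operator Q schur_form) (snd (saddle x)))"

lemma representer:
  assumes x: "x \<in> W \<times> Q"
  shows "representer x \<in> W \<times> Q"
    and "form_operator W a (fst (representer x)) = fst (saddle x)"
    and "form_operator Q schur_form (snd (representer x)) = snd (saddle x)"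
proof -
  have "fst (saddle x) \<in> form_operator W a ` W"
    using saddle_in_dual(1)[OF x] A_bij by (simp add: bij_betw_def)
  moreover have "snd (saddle x) \<in> form_operator Q schur_form ` Q"
    using saddle_in_dual(2)[OF x] schur_bij by (simp add: bij_betw_def)
  ultimately show "representer x \<in> W \<times> Q"
    "form_operator W a (fst (representer x)) = fst (saddle x)"
    "form_operator Q schur_form (snd (representer x)) = snd (saddle x)"
    by (simp_all add: representer_def inv_into_into f_inv_into_f)
qed

text \<open>
  The second row of the saddle point operator is \<open>- B\<close>, which amounts to a change of sign of \<open>q\<close>.
\<close>

lemma energy_representer:
  assumes x: "x \<in> W \<times> Q" and r: "r \<in> W" and q: "q \<in> Q"
  shows "energy (representer x) (r, q) = lform x (r, - q)"
proof -
  obtain w p where xx: "x = (w, p)" "w \<in> W" "p \<in> Q" using x by auto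
  have "energy (representer x) (r, q) = form_operator W a (fst (representer x)) r
      + form_operator Q schur_form (snd (representer x)) q"
    using r q by (simp add: energy_def form_operator_def)
  also have "\<dots> = a w r + b r p - b w q"
    unfolding representer(2,3)[OF x] using r q by (simp add: saddle_def xx(1))
  also have "\<dots> = lform x (r, - q)"
    using linear_on_neg[OF b_right[OF xx(2)] q] xx r q Q by (simp add: lform_eq subspace_neg)
  finally show ?thesis .
qed

lemma energy_norm_flip:
  assumes "r \<in> W" "q \<in> Q"
  shows "energy_norm (r, - q) = energy_norm (r, q)"
proof -
  have "schur_form (- q) (- q) = schur_form q q"
    using linear_on_neg[OF form_linear_right[OF symmetric_schur_form] assms(2), of "- q"]
      linear_on_neg[OF form_linear_left[OF symmetric_schur_form Q] assms(2), of q] assms(2) Q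
    by (simp add: subspace_neg)
  then show ?thesis by (simp add: energy_norm_eq energy_def)
qed

text \<open>Continuity of the form, tested with the representer.\<close>

lemma representer_upper:
  assumes x: "x \<in> W \<times> Q"
  shows "energy_norm (representer x) \<le> \<alpha> * energy_norm x"
proof -
  let ?z = "representer x"
  have z: "?z \<in> W \<times> Q" by (rule representer(1)[OF x])
  then obtain r q where rq: "?z = (r, q)" "r \<in> W" "q \<in> Q" by auto
  have "energy_norm ?z * energy_norm ?z = energy ?z ?z"
    using energy_nonneg[OF z] by (simp add: energy_norm_eq)
  also have "\<dots> = lform x (r, - q)" using energy_representer[OF x rq(2,3)] rq(1) by simp
  also have "\<dots> \<le> \<alpha> * energy_norm x * energy_norm (r, - q)"
    using continuity[OF x, of "(r, - q)"] rq Q by (simp add: subspace_neg)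
  also have "energy_norm (r, - q) = energy_norm ?z" using energy_norm_flip rq by simp
  finally show ?thesis
    using energy_norm_nonneg[OF z] energy_norm_nonneg[OF x] \<alpha>
    by (cases "energy_norm ?z = 0") auto
qed

text \<open>
  The infimum and the suprema are taken in the reals, where they bound their families only if these are
  bounded. Continuity bounds the quotients from above, and every supremum is nonnegative because \<open>x\<close> may
  be replaced by \<open>- x\<close>.
\<close>

lemma inf_sup_pointwise:
  assumes y: "y \<in> W \<times> Q" "y \<noteq> 0"
  shows "\<beta> \<le> (SUP x\<in>W \<times> Q - {0}. lform x y / (energy_norm x * energy_norm y))"
proof -
  let ?X = "W \<times> Q - {0}"
  let ?R = "\<lambda>x y. lform x y / (energy_norm x * energy_norm y)"
  have bdd: "bdd_above ((\<lambda>x. ?R x z) ` ?X)" if z: "z \<in> ?X" for z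
  proof (rule bdd_aboveI2)
    fix x assume "x \<in> ?X"
    then show "?R x z \<le> \<alpha>"
      using continuity[of x z] energy_norm_pos[of x] energy_norm_pos[of z] z
      by (simp add: pos_divide_le_eq mult.assoc)
  qed
  have "0 \<le> (SUP x\<in>?X. ?R x z)" if z: "z \<in> ?X" for z
  proof -
    have mz: "- z \<in> ?X" using z subspace_neg[OF subspace_WQ] by auto
    have "lform (- z) z = - lform z z"
    proof -
      obtain r q where rq: "z = (r, q)" "r \<in> W" "q \<in> Q" using z by auto
      then show ?thesis
        using linear_on_neg[OF form_linear_left[OF a W], of r r] linear_on_neg[OF b_left, of q r]
          linear_on_neg[OF b_right, of r q] W Q
        by (simp add: lform_eq subspace_neg)
    qed
    moreover have "0 < energy_norm z * energy_norm z" "0 < energy_norm (- z) * energy_norm z"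
      using energy_norm_pos[of z] energy_norm_pos[of "- z"] z mz by (metis DiffE insertI1 mult_pos_pos)+
    ultimately have "0 \<le> ?R z z \<or> 0 \<le> ?R (- z) z"
      by (cases "0 \<le> lform z z") (simp_all add: zero_le_divide_iff divide_le_0_iff less_imp_le)
    moreover have "?R z z \<le> (SUP x\<in>?X. ?R x z)" "?R (- z) z \<le> (SUP x\<in>?X. ?R x z)"
      using cSUP_upper[OF z bdd[OF z]] cSUP_upper[OF mz bdd[OF z]] by auto
    ultimately show ?thesis by linarith
  qed
  then have "bdd_below ((\<lambda>z. SUP x\<in>?X. ?R x z) ` ?X)" by (rule bdd_belowI2)
  then have "(INF z\<in>?X. SUP x\<in>?X. ?R x z) \<le> (SUP x\<in>?X. ?R x y)"
    by (rule cINF_lower) (use y in auto)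
  then show ?thesis using inf_sup by simp
qed

text \<open>
  By symmetry of the form, \<open>x\<close> can take the place of the second argument, over which the infimum runs.
  The supremum over the first argument is at most the norm of the representer by Cauchy-Schwarz.
\<close>

lemma representer_lower:
  assumes x: "x \<in> W \<times> Q"
  shows "\<beta> * energy_norm x \<le> energy_norm (representer x)"
proof (cases "x = 0")
  case True
  then show ?thesis using energy_norm_0 energy_norm_nonneg[OF representer(1)[OF x]] by simp
next
  case False
  have pos: "energy_norm x > 0" by (rule energy_norm_pos[OF x False])
  have "(SUP y\<in>W \<times> Q - {0}. lform y x / (energy_norm y * energy_norm x))
      \<le> energy_norm (representer x) / energy_norm x"
  proof (rule cSUP_least)
    show "W \<times> Q - {0} \<noteq> {}" using x False by blast
    fix y assume y: "y \<in> W \<times> Q - {0}"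
    then obtain r q where rq: "y = (r, q)" "r \<in> W" "q \<in> Q" by auto
    have ypos: "energy_norm y > 0" using energy_norm_pos y by blast
    have "lform y x = lform x (r, - (- q))" using lform_sym[OF x] y rq by simp
    also have "\<dots> = energy (representer x) (r, - q)"
      by (rule energy_representer[symmetric]) (use x rq Q in \<open>auto simp: subspace_neg\<close>)
    also have "\<dots> \<le> energy_norm (representer x) * energy_norm (r, - q)"
      by (rule energy_cauchy_schwarz) (use representer(1)[OF x] rq Q in \<open>auto simp: subspace_neg\<close>)
    also have "energy_norm (r, - q) = energy_norm y" using energy_norm_flip rq by simp
    finally show "lform y x / (energy_norm y * energy_norm x) \<le> energy_norm (representer x) / energy_norm x"
      using pos ypos by (simp add: field_simps)
  qed
  then have "\<beta> \<le> energy_norm (representer x) / energy_norm x"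
    using inf_sup_pointwise[OF x False] by simp
  then show ?thesis using pos by (simp add: pos_le_divide_eq)
qed

definition preconditioned :: "'v \<times> 'q \<Rightarrow> 'v \<times> 'q"
  where "preconditioned x = (Hw (fst (saddle x)), Hp (snd (saddle x)))"

lemma preconditioned_in:
  assumes "x \<in> W \<times> Q"
  shows "preconditioned x \<in> W \<times> Q"
  using saddle_in_dual[OF assms] Hw Hp unfolding spd_operator_def preconditioned_def by auto

lemma preconditioned_equivalence:
  assumes x: "x \<in> W \<times> Q"
  shows "min c1w c1p * energy_norm (preconditioned x) \<le> energy_norm (representer x)"
    and "energy_norm (representer x) \<le> max c2w c2p * energy_norm (preconditioned x)"
proof -
  obtain zw zp where z: "representer x = (zw, zp)" "zw \<in> W" "zp \<in> Q"
    using representer(1)[OF x] by auto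
  obtain u v where uv: "preconditioned x = (u, v)" "u \<in> W" "v \<in> Q"
    using preconditioned_in[OF x] by auto
  have u: "u = Hw (form_operator W a zw)" and v: "v = Hp (form_operator Q schur_form zp)"
    using representer(2,3)[OF x] z(1) uv(1) by (auto simp: preconditioned_def)
  have au: "0 \<le> a u u" and sv: "0 \<le> schur_form v v"
    using a_positive schur_positive uv linear_on_zero[OF form_linear_right[OF a uv(2)] W]
      linear_on_zero[OF form_linear_right[OF symmetric_schur_form uv(3)] Q]
    by (cases "u = 0"; cases "v = 0"; force simp: positive_form_def less_imp_le)+
  note w = preconditioner_equivalence[OF W a_positive A_bij Hw cpos(1,2) Hw_lower Hw_upper z(2),
      folded u]
  note p = preconditioner_equivalence[OF Q schur_positive schur_bij Hp cpos(3,4) Hp_lower Hp_upper z(3),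
      folded v]
  let ?c1 = "min c1w c1p" and ?c2 = "max c2w c2p"
  have c1: "0 \<le> ?c1" "?c1\<^sup>2 \<le> c1w\<^sup>2" "?c1\<^sup>2 \<le> c1p\<^sup>2" using cpos by (auto intro!: power_mono)
  have c2: "0 \<le> ?c2" "c2w\<^sup>2 \<le> ?c2\<^sup>2" "c2p\<^sup>2 \<le> ?c2\<^sup>2" using cpos by (auto intro!: power_mono)
  have "?c1\<^sup>2 * energy (u, v) (u, v) \<le> energy (zw, zp) (zw, zp)"
    using mult_right_mono[OF c1(2) au] mult_right_mono[OF c1(3) sv] w(1) p(1)
    by (simp add: energy_def distrib_left)
  then have "sqrt (?c1\<^sup>2 * energy (u, v) (u, v)) \<le> sqrt (energy (zw, zp) (zw, zp))" by simp
  then show "?c1 * energy_norm (preconditioned x) \<le> energy_norm (representer x)"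
    using c1(1) by (simp add: energy_norm_eq z(1) uv(1) real_sqrt_mult)
  have "energy (zw, zp) (zw, zp) \<le> ?c2\<^sup>2 * energy (u, v) (u, v)"
    using mult_right_mono[OF c2(2) au] mult_right_mono[OF c2(3) sv] w(2) p(2)
    by (simp add: energy_def distrib_left)
  then have "sqrt (energy (zw, zp) (zw, zp)) \<le> sqrt (?c2\<^sup>2 * energy (u, v) (u, v))" by simp
  then show "energy_norm (representer x) \<le> ?c2 * energy_norm (preconditioned x)"
    using c2(1) by (simp add: energy_norm_eq z(1) uv(1) real_sqrt_mult)
qed

lemma preconditioned_upper:
  assumes x: "x \<in> W \<times> Q"
  shows "energy_norm (preconditioned x) \<le> \<alpha> / min c1w c1p * energy_norm x"
proof -
  have "min c1w c1p * energy_norm (preconditioned x) \<le> \<alpha> * energy_norm x"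
    using preconditioned_equivalence(1)[OF x] representer_upper[OF x] by linarith
  then show ?thesis using cpos by (simp add: field_simps)
qed

lemma preconditioned_lower:
  assumes x: "x \<in> W \<times> Q"
  shows "energy_norm x \<le> max c2w c2p / \<beta> * energy_norm (preconditioned x)"
proof -
  have "\<beta> * energy_norm x \<le> max c2w c2p * energy_norm (preconditioned x)"
    using preconditioned_equivalence(2)[OF x] representer_lower[OF x] by linarith
  then show ?thesis using \<beta> by (simp add: field_simps)
qed

lemma linear_preconditioned: "linear_on (W \<times> Q) preconditioned"
proof -
  have addw: "fst (saddle (x + y)) = fst (saddle x) + fst (saddle y)"
    and addp: "snd (saddle (x + y)) = snd (saddle x) + snd (saddle y)"
    if xy: "x \<in> W \<times> Q" "y \<in> W \<times> Q" for x y :: "'v \<times> 'q"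
  proof -
    obtain w p w' p' where x: "x = (w, p)" "w \<in> W" "p \<in> Q" and y: "y = (w', p')" "w' \<in> W" "p' \<in> Q"
      using xy by auto
    show "fst (saddle (x + y)) = fst (saddle x) + fst (saddle y)"
      using linear_on_add[OF form_linear_left[OF a W] x(2) y(2)]
        linear_on_add[OF b_right x(3) y(3)]
      by (auto simp: saddle_def x(1) y(1) functional_def fun_eq_iff)
    show "snd (saddle (x + y)) = snd (saddle x) + snd (saddle y)"
      using linear_on_add[OF b_left x(2) y(2)]
      by (auto simp: saddle_def x(1) y(1) functional_def fun_eq_iff)
  qed
  have scalew: "fst (saddle (c *\<^sub>R x)) = c *\<^sub>R fst (saddle x)"
    and scalep: "snd (saddle (c *\<^sub>R x)) = c *\<^sub>R snd (saddle x)" if xW: "x \<in> W \<times> Q" for c and x :: "'v \<times> 'q"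
  proof -
    obtain w p where x: "x = (w, p)" "w \<in> W" "p \<in> Q" using xW by auto
    show "fst (saddle (c *\<^sub>R x)) = c *\<^sub>R fst (saddle x)"
      using linear_on_scale[OF form_linear_left[OF a W] x(2)] linear_on_scale[OF b_right x(3)]
      by (auto simp: saddle_def x(1) functional_def fun_eq_iff distrib_left)
    show "snd (saddle (c *\<^sub>R x)) = c *\<^sub>R snd (saddle x)"
      using linear_on_scale[OF b_left x(2)] by (auto simp: saddle_def x(1) functional_def fun_eq_iff)
  qed
  have H: "linear_on (dual W) Hw" "linear_on (dual Q) Hp" using Hw Hp by (auto simp: spd_operator_def)
  show ?thesis
    by (rule linear_onI)
      (simp_all add: preconditioned_def addw addp scalew scalep saddle_in_dual
        linear_on_add[OF H(1)] linear_on_add[OF H(2)] linear_on_scale[OF H(1)] linear_on_scale[OF H(2)])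
qed

lemma preconditioned_bij: "bij_betw preconditioned (W \<times> Q) (W \<times> Q)"
proof (rule injective_endomorphism_surjective[OF finite_dimensional_Times[OF finW finQ]
      linear_preconditioned])
  show "preconditioned ` (W \<times> Q) \<subseteq> W \<times> Q" using preconditioned_in by blast
  fix x assume x: "x \<in> W \<times> Q" "preconditioned x = 0"
  then have "energy_norm x \<le> 0" using preconditioned_lower[OF x(1)] energy_norm_0 by simp
  then show "x = 0" using energy_norm_pos[OF x(1)] by force
qed

text \<open>The bound below for the preconditioned operator is a bound above for its inverse.\<close>

lemma condition_number_preconditioned:
  "condition_number energy_norm (W \<times> Q) preconditioned
    \<le> (\<alpha> * max c2w c2p) / (\<beta> * min c1w c1p)"
proof -
  have op: "0 \<le> operator_norm energy_norm (W \<times> Q) T \<and> operator_norm energy_norm (W \<times> Q) T \<le> C"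
    if C: "C \<ge> 0" and T: "\<And>x. x \<in> W \<times> Q \<Longrightarrow> energy_norm (T x) \<le> C * energy_norm x" for T C
  proof -
    have bound: "energy_norm (T x) / energy_norm x \<le> C" if "x \<in> W \<times> Q" for x
      using T[OF that] energy_norm_nonneg[OF that] C
      by (cases "energy_norm x = 0") (auto simp: pos_divide_le_eq)
    have 0: "0 \<in> W \<times> Q" using subspace_0[OF subspace_WQ] .
    have "bdd_above ((\<lambda>x. energy_norm (T x) / energy_norm x) ` (W \<times> Q))"
      by (rule bdd_aboveI2[OF bound])
    from cSUP_upper[OF 0 this] have "0 \<le> operator_norm energy_norm (W \<times> Q) T"
      by (simp add: operator_norm_def energy_norm_0)
    moreover have "operator_norm energy_norm (W \<times> Q) T \<le> C"
      unfolding operator_norm_def by (rule cSUP_least) (use 0 bound in auto)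
    ultimately show ?thesis by simp
  qed
  have 1: "0 \<le> operator_norm energy_norm (W \<times> Q) preconditioned
      \<and> operator_norm energy_norm (W \<times> Q) preconditioned \<le> \<alpha> / min c1w c1p"
    by (rule op[OF _ preconditioned_upper]) (use cpos \<alpha> in \<open>auto simp: less_imp_le\<close>)
  have 2: "0 \<le> operator_norm energy_norm (W \<times> Q) (inv_into (W \<times> Q) preconditioned)
      \<and> operator_norm energy_norm (W \<times> Q) (inv_into (W \<times> Q) preconditioned) \<le> max c2w c2p / \<beta>"
  proof (rule op)
    show "0 \<le> max c2w c2p / \<beta>" using cpos \<beta> by (simp add: less_imp_le)
    fix y assume "y \<in> W \<times> Q"
    then have "y \<in> preconditioned ` (W \<times> Q)" using preconditioned_bij by (simp add: bij_betw_def)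
    then show "energy_norm (inv_into (W \<times> Q) preconditioned y) \<le> max c2w c2p / \<beta> * energy_norm y"
      using preconditioned_lower[OF inv_into_into] f_inv_into_f by (metis (no_types, lifting))
  qed
  have "condition_number energy_norm (W \<times> Q) preconditioned \<le> (\<alpha> / min c1w c1p) * (max c2w c2p / \<beta>)"
    unfolding condition_number_def by (rule mult_mono) (use 1 2 cpos \<alpha> in \<open>auto simp: less_imp_le\<close>)
  then show ?thesis by (simp add: mult.commute)
qed

end

end

section \<open>Tangent spaces and flat measures\<close>

lemma subspace_tangent: "subspace (tangent S)"
  by (simp add: tangent_def)

text \<open>
  The translate of the tangent space through a point of \<open>S\<close> is affine and contains \<open>S\<close>.
\<close>

lemma affine_hull_diff_tangent:
  assumes "x \<in> affine hull S" "y \<in> affine hull S"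
  shows "x - y \<in> tangent S"
proof -
  have "S \<noteq> {}" using assms by auto
  then obtain z where z: "z \<in> S" by blast
  have "S \<subseteq> (+) z ` tangent S"
  proof
    fix x assume "x \<in> S"
    then have "x - z \<in> tangent S" using z unfolding tangent_def by (intro span_base) blast
    then show "x \<in> (+) z ` tangent S" by (intro image_eqI[of _ _ "x - z"]) auto
  qed
  then have "affine hull S \<subseteq> (+) z ` tangent S"
    by (rule hull_minimal) (simp add: affine_translation[symmetric] subspace_imp_affine subspace_tangent)
  then obtain s t where "x = z + s" "y = z + t" "s \<in> tangent S" "t \<in> tangent S"
    using assms by blast
  then show ?thesis by (simp add: subspace_diff subspace_tangent)
qed

lemma affine_hull_add_tangent:
  assumes "z \<in> affine hull S" "t \<in> tangent S"
  shows "z + t \<in> affine hull S"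
  using assms(2) unfolding tangent_def
proof (induction rule: span_induct_alt)
  case base
  then show ?case using assms(1) by simp
next
  case (step c d t)
  then obtain x y where xy: "d = x - y" "x \<in> S" "y \<in> S" by blast
  have "(z + t) + c *\<^sub>R (x - y) \<in> affine hull S"
    by (rule mem_affine_3_minus) (use step xy in \<open>auto simp: hull_inc\<close>)
  then show ?case by (simp add: xy(1) add_ac)
qed

lemma tangent_mono_hull:
  assumes "S \<subseteq> affine hull T"
  shows "tangent S \<subseteq> tangent T"
proof -
  have "{x - y |x y. x \<in> S \<and> y \<in> S} \<subseteq> tangent T"
    using assms affine_hull_diff_tangent by blast
  then show ?thesis by (simp add: tangent_def[of S] span_minimal subspace_tangent)
qed

lemma tangent_cong: "affine hull S = affine hull T \<Longrightarrow> tangent S = tangent T"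
  using tangent_mono_hull[of S T] tangent_mono_hull[of T S] hull_subset[of S affine] hull_subset[of T affine]
  by auto

lemma tangent_eq_span:
  assumes "a \<in> affine hull S"
  shows "tangent S = span ((\<lambda>x. x - a) ` S)"
proof (rule antisym)
  have "{x - y |x y. x \<in> S \<and> y \<in> S} \<subseteq> span ((\<lambda>x. x - a) ` S)"
  proof clarify
    fix x y assume "x \<in> S" "y \<in> S"
    then have "(x - a) - (y - a) \<in> span ((\<lambda>x. x - a) ` S)"
      by (intro span_diff span_base) auto
    then show "x - y \<in> span ((\<lambda>x. x - a) ` S)" by simp
  qed
  then show "tangent S \<subseteq> span ((\<lambda>x. x - a) ` S)" by (simp add: tangent_def span_minimal)
  show "span ((\<lambda>x. x - a) ` S) \<subseteq> tangent S"
    by (rule span_minimal[OF _ subspace_tangent])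
      (use assms in \<open>auto intro: affine_hull_diff_tangent simp: hull_inc\<close>)
qed

lemma dim_tangent:
  assumes "S \<noteq> {}"
  shows "int (dim (tangent S)) = aff_dim S"
proof -
  obtain a where "a \<in> S" using assms by blast
  then have a: "a \<in> affine hull S" by (simp add: hull_inc)
  have "(\<lambda>x. x - a) ` S = (+) (- a) ` S" by auto
  then show ?thesis by (simp add: aff_dim_eq_dim[OF a] tangent_eq_span[OF a])
qed

lemma tangent_frame:
  shows "tangent_frame S \<subseteq> tangent S" "pairwise orthogonal (tangent_frame S)"
    "b \<in> tangent_frame S \<Longrightarrow> norm b = 1" "span (tangent_frame S) = tangent S"
    "finite (tangent_frame S)"
proof -
  let ?P = "\<lambda>B. B \<subseteq> tangent S \<and> pairwise orthogonal B \<and> (\<forall>b\<in>B. norm b = 1) \<and> span B = tangent S"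
  have "\<exists>B. ?P B" using orthonormal_basis_subspace[OF subspace_tangent[of S]] by metis
  then have P: "?P (tangent_frame S)" unfolding tangent_frame_def by (rule someI_ex)
  then show "tangent_frame S \<subseteq> tangent S" "pairwise orthogonal (tangent_frame S)"
    "b \<in> tangent_frame S \<Longrightarrow> norm b = 1" "span (tangent_frame S) = tangent S" by auto
  then show "finite (tangent_frame S)" by (simp add: pairwise_orthogonal_imp_finite)
qed

definition flat_chart :: "'a::euclidean_space set \<Rightarrow> ('a \<Rightarrow> real) \<Rightarrow> 'a"
  where "flat_chart S t = (SOME z. z \<in> affine hull S) + (\<Sum>b\<in>tangent_frame S. t b *\<^sub>R b)"

lemma flat_measure_eq:
  "flat_measure S = distr (\<Pi>\<^sub>M b\<in>tangent_frame S. (lborel :: real measure)) borel (flat_chart S)"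
  by (simp add: flat_measure_def flat_chart_def[abs_def])

lemma measurable_flat_chart:
  "flat_chart S \<in> borel_measurable (\<Pi>\<^sub>M b\<in>tangent_frame S. (lborel :: real measure))"
  unfolding flat_chart_def[abs_def] by measurable

lemma sets_flat_measure [simp, measurable_cong]: "sets (flat_measure S) = sets borel"
  by (simp add: flat_measure_eq)

lemma space_flat_measure [simp]: "space (flat_measure S) = UNIV"
  by (simp add: flat_measure_eq)

text \<open>The coordinates of a bounded set with respect to the orthonormal frame lie in a cube.\<close>

lemma emeasure_flat_bounded:
  assumes "bounded E"
  shows "emeasure (flat_measure S) E < \<infinity>"
proof (cases "E \<in> sets borel")
  case False
  then show ?thesis by (simp add: emeasure_notin_sets)
next
  case True
  let ?B = "tangent_frame S" and ?z = "SOME z. z \<in> affine hull S"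
  let ?M = "\<Pi>\<^sub>M b\<in>?B. (lborel :: real measure)"
  interpret product_sigma_finite "\<lambda>_::'a. lborel :: real measure" by standard
  obtain R where "\<forall>x\<in>E. dist ?z x \<le> R" using assms bounded_any_center by blast
  then have R: "\<And>x. x \<in> E \<Longrightarrow> norm (x - ?z) \<le> R" by (simp add: dist_norm norm_minus_commute)
  have "flat_chart S -` E \<inter> space ?M \<subseteq> (\<Pi>\<^sub>E b\<in>?B. {-R..R})"
  proof
    fix t assume t: "t \<in> flat_chart S -` E \<inter> space ?M"
    have "\<bar>t b\<bar> \<le> R" if b: "b \<in> ?B" for b
    proof -
      have "(flat_chart S t - ?z) \<bullet> b = (\<Sum>c\<in>?B. t c * (c \<bullet> b))"
        by (simp add: flat_chart_def inner_sum_left)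
      also have "\<dots> = (\<Sum>c\<in>?B. if c = b then t b else 0)"
        using tangent_frame(2)[of S] tangent_frame(3)[OF b] b
        by (intro sum.cong) (auto simp: pairwise_def orthogonal_def norm_eq_1)
      also have "\<dots> = t b" using b tangent_frame(5)[of S] by simp
      finally have "\<bar>t b\<bar> \<le> norm (flat_chart S t - ?z) * norm b"
        by (metis Cauchy_Schwarz_ineq2)
      also have "\<dots> \<le> R" using R[of "flat_chart S t"] t tangent_frame(3)[OF b] by simp
      finally show ?thesis .
    qed
    then show "t \<in> (\<Pi>\<^sub>E b\<in>?B. {-R..R})"
      using t by (auto simp: space_PiM PiE_iff abs_le_iff minus_le_iff)
  qed
  then have "emeasure (flat_measure S) E \<le> emeasure ?M (\<Pi>\<^sub>E b\<in>?B. {-R..R})"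
    unfolding flat_measure_eq
    by (subst emeasure_distr[OF measurable_flat_chart True], intro emeasure_mono)
      (auto intro!: sets_PiM_I_finite tangent_frame)
  also have "\<dots> = (\<Prod>b\<in>?B. emeasure lborel {-R..R})"
    by (rule emeasure_PiM) (auto intro: tangent_frame)
  also have "\<dots> < \<infinity>" by (simp add: emeasure_lborel_Icc_eq power_less_top_ennreal)
  finally show ?thesis .
qed

lemma openin_affine_hull_borel:
  fixes S :: "'a::euclidean_space set"
  assumes "openin (top_of_set (affine hull S)) E"
  shows "E \<in> sets borel"
proof -
  obtain U where "open U" "E = affine hull S \<inter> U" using assms unfolding openin_open by blast
  then show ?thesis using sets.Int[OF borel_closed[OF closed_affine_hull[of S]] borel_open[of U]] by simp
qed

text \<open>A relatively open set contains the image of a small coordinate box.\<close>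

lemma emeasure_flat_pos:
  assumes "openin (top_of_set (affine hull S)) E" "E \<noteq> {}"
  shows "emeasure (flat_measure S) E > 0"
proof -
  let ?B = "tangent_frame S" and ?z = "SOME z. z \<in> affine hull S"
  let ?M = "\<Pi>\<^sub>M b\<in>?B. (lborel :: real measure)"
  interpret product_sigma_finite "\<lambda>_::'a. lborel :: real measure" by standard
  obtain x where x: "x \<in> E" using assms(2) by blast
  then obtain e where e: "e > 0" "ball x e \<inter> affine hull S \<subseteq> E"
    using assms(1) unfolding openin_contains_ball by blast
  have xS: "x \<in> affine hull S" using x openin_imp_subset[OF assms(1)] by blast
  then have zS: "?z \<in> affine hull S" by (metis someI_ex)
  have E: "E \<in> sets borel" by (rule openin_affine_hull_borel[OF assms(1)])
  define s where "s b = (x - ?z) \<bullet> b" for b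
  have "x - ?z \<in> span ?B"
    using affine_hull_diff_tangent[OF xS zS] by (simp add: tangent_frame)
  then have xs: "x - ?z = (\<Sum>b\<in>?B. s b *\<^sub>R b)"
    unfolding s_def by (rule orthonormal_basis_expand[symmetric, rotated 2])
      (auto intro: tangent_frame)
  \<comment> \<open>
    A box of half-width \<open>\<delta>\<close> deviates from \<open>x\<close> by at most
    \<open>card B * \<delta> < e\<close>; the \<open>+ 1\<close> covers dimension zero.
  \<close>
  define \<delta> where "\<delta> = e / (real (card ?B) + 1)"
  have \<delta>: "\<delta> > 0" using e(1) by (simp add: \<delta>_def add_nonneg_pos)
  let ?box = "\<Pi>\<^sub>E b\<in>?B. {s b - \<delta><..<s b + \<delta>}"
  have sub: "?box \<subseteq> flat_chart S -` E \<inter> space ?M"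
  proof
    fix t assume t: "t \<in> ?box"
    have "flat_chart S t - x = (\<Sum>b\<in>?B. t b *\<^sub>R b) - (x - ?z)" by (simp add: flat_chart_def)
    also have "\<dots> = (\<Sum>b\<in>?B. (t b - s b) *\<^sub>R b)"
      unfolding xs by (simp add: scaleR_diff_left sum_subtractf)
    finally have "norm (flat_chart S t - x) \<le> (\<Sum>b\<in>?B. norm ((t b - s b) *\<^sub>R b))"
      by (metis norm_sum)
    also have "\<dots> \<le> (\<Sum>b\<in>?B. \<delta>)"
    proof (rule sum_mono)
      fix b assume b: "b \<in> ?B"
      then have "t b \<in> {s b - \<delta><..<s b + \<delta>}" using t by blast
      then show "norm ((t b - s b) *\<^sub>R b) \<le> \<delta>" using tangent_frame(3)[OF b] by auto
    qed
    also have "\<dots> < e" using e(1) by (simp add: \<delta>_def field_simps)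
    finally have "flat_chart S t \<in> ball x e" by (simp add: dist_norm norm_minus_commute)
    moreover have "flat_chart S t \<in> affine hull S"
      unfolding flat_chart_def
      by (rule affine_hull_add_tangent[OF zS])
        (use tangent_frame(1)[of S] in \<open>auto intro!: subspace_sum subspace_scale subspace_tangent\<close>)
    ultimately show "t \<in> flat_chart S -` E \<inter> space ?M"
      using e(2) t by (auto simp: space_PiM PiE_iff)
  qed
  have "emeasure ?M ?box = (\<Prod>b\<in>?B. emeasure lborel {s b - \<delta><..<s b + \<delta>})"
    by (rule emeasure_PiM) (auto intro: tangent_frame)
  also have "\<dots> = (\<Prod>b\<in>?B. ennreal (2 * \<delta>))" using \<delta> by (intro prod.cong) auto
  finally have "emeasure ?M ?box = ennreal (2 * \<delta>) ^ card ?B" by simp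
  then have "0 < emeasure ?M ?box" using \<delta> by (simp add: ennreal_power)
  also have "\<dots> \<le> emeasure ?M (flat_chart S -` E \<inter> space ?M)"
    by (rule emeasure_mono[OF sub measurable_sets[OF measurable_flat_chart E]])
  also have "\<dots> = emeasure (flat_measure S) E"
    unfolding flat_measure_eq by (rule emeasure_distr[OF measurable_flat_chart E, symmetric])
  finally show ?thesis .
qed

section \<open>Bounded measurable functions\<close>

text \<open>
  All integrands below are of this kind on bounded subdomains, where flat measures are finite; the class
  is closed under sums and products, so integrability never has to be checked by hand.
\<close>

definition bounded_measurable :: "'a::euclidean_space set \<Rightarrow> ('a \<Rightarrow> real) \<Rightarrow> bool"
  where "bounded_measurable S g \<longleftrightarrow> g \<in> borel_measurable borel \<and> (\<exists>C. \<forall>x\<in>S. \<bar>g x\<bar> \<le> C)"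

lemma bounded_measurable_const: "bounded_measurable S (\<lambda>_. c)"
  by (auto simp: bounded_measurable_def)

lemma bounded_measurable_add:
  assumes "bounded_measurable S g" "bounded_measurable S h"
  shows "bounded_measurable S (\<lambda>x. g x + h x)"
proof -
  obtain C D where "\<forall>x\<in>S. \<bar>g x\<bar> \<le> C" "\<forall>x\<in>S. \<bar>h x\<bar> \<le> D" using assms by (auto simp: bounded_measurable_def)
  then have "\<forall>x\<in>S. \<bar>g x + h x\<bar> \<le> C + D" by (meson abs_triangle_ineq add_mono order_trans)
  then show ?thesis using assms by (auto simp: bounded_measurable_def)
qed

lemma bounded_measurable_mult:
  assumes "bounded_measurable S g" "bounded_measurable S h"
  shows "bounded_measurable S (\<lambda>x. g x * h x)"
proof -
  obtain C D where CD: "\<And>x. x \<in> S \<Longrightarrow> \<bar>g x\<bar> \<le> C" "\<And>x. x \<in> S \<Longrightarrow> \<bar>h x\<bar> \<le> D"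
    using assms by (auto simp: bounded_measurable_def)
  have "\<bar>g x * h x\<bar> \<le> C * D" if "x \<in> S" for x
    unfolding abs_mult by (rule mult_mono) (use CD[OF that] in auto)
  then show ?thesis using assms by (auto simp: bounded_measurable_def)
qed

lemma bounded_measurable_scale: "bounded_measurable S g \<Longrightarrow> bounded_measurable S (\<lambda>x. c * g x)"
  by (rule bounded_measurable_mult[OF bounded_measurable_const])

lemma bounded_measurable_minus: "bounded_measurable S g \<Longrightarrow> bounded_measurable S (\<lambda>x. - g x)"
  using bounded_measurable_scale[of S g "-1"] by simp

lemma bounded_measurable_sum:
  "(\<And>i. i \<in> I \<Longrightarrow> bounded_measurable S (g i)) \<Longrightarrow> bounded_measurable S (\<lambda>x. \<Sum>i\<in>I. g i x)"
  by (induction I rule: infinite_finite_induct)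
    (auto intro: bounded_measurable_const bounded_measurable_add)

lemma bounded_measurable_indicator: "E \<in> sets borel \<Longrightarrow> bounded_measurable S (indicator E)"
  by (auto simp: bounded_measurable_def indicator_def intro!: exI[of _ 1])

lemma bounded_measurable_continuous:
  assumes "continuous_on UNIV g" "bounded S"
  shows "bounded_measurable S g"
proof -
  have "compact (closure S)" using assms(2) by (simp add: compact_closure)
  then have "compact (g ` closure S)"
    by (intro compact_continuous_image continuous_on_subset[OF assms(1)]) auto
  then have "bounded (g ` closure S)" by (rule compact_imp_bounded)
  then obtain C where "\<forall>y\<in>g ` closure S. norm y \<le> C" by (auto simp: bounded_iff)
  then have "\<forall>x\<in>S. \<bar>g x\<bar> \<le> C" using closure_subset[of S] by auto
  then show ?thesis using assms(1) by (auto simp: bounded_measurable_def borel_measurable_continuous_onI)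
qed

lemma bounded_measurable_integrable:
  assumes "bounded_measurable S g" "bounded S" "S \<in> sets borel"
  shows "set_integrable (flat_measure T) S g"
proof -
  obtain C where "\<forall>x\<in>S. \<bar>g x\<bar> \<le> C" using assms by (auto simp: bounded_measurable_def)
  moreover have "g \<in> borel_measurable (flat_measure T)"
    using assms(1) by (simp add: bounded_measurable_def cong: measurable_cong_sets)
  ultimately show ?thesis unfolding set_integrable_def
    by (intro integrableI_bounded_set_indicator[where B = C])
      (use assms emeasure_flat_bounded[OF assms(2), of T] in auto)
qed

lemma set_integral_flat_pos:
  fixes g :: "'a::euclidean_space \<Rightarrow> real"
  assumes g: "bounded_measurable S g" and S: "bounded S" "S \<in> sets borel"
    and nonneg: "\<And>x. x \<in> S \<Longrightarrow> 0 \<le> g x"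
    and E: "E \<subseteq> S" "openin (top_of_set (affine hull S)) E" "E \<noteq> {}"
    and \<delta>: "\<delta> > 0" "\<And>x. x \<in> E \<Longrightarrow> \<delta> \<le> g x"
  shows "(LINT x:S|flat_measure S. g x) > 0"
proof -
  let ?h = "\<lambda>x. \<delta> * indicator E x"
  have h: "bounded_measurable S ?h"
    by (intro bounded_measurable_scale bounded_measurable_indicator openin_affine_hull_borel[OF E(2)])
  have "?h x \<le> g x" if "x \<in> S" for x
    using nonneg[OF that] \<delta>(2)[of x] by (cases "x \<in> E") auto
  then have "(LINT x:S|flat_measure S. ?h x) \<le> (LINT x:S|flat_measure S. g x)"
    by (intro set_integral_mono bounded_measurable_integrable g h S)
  moreover have "(LINT x:S|flat_measure S. ?h x) = \<delta> * measure (flat_measure S) E"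
  proof -
    have "(LINT x:S|flat_measure S. ?h x) = (LINT x|flat_measure S. \<delta> * indicator E x)"
      unfolding set_lebesgue_integral_def using E(1)
      by (intro Bochner_Integration.integral_cong) (auto simp: indicator_def)
    then show ?thesis by simp
  qed
  moreover have "measure (flat_measure S) E > 0"
    using emeasure_flat_pos[OF E(2,3)]
      emeasure_flat_bounded[of E S] bounded_subset[OF S(1) E(1)]
    by (simp add: measure_def enn2real_positive_iff)
  ultimately show ?thesis using \<delta>(1) by (smt (verit) mult_pos_pos)
qed

text \<open>
  Definiteness of the \<open>L\<^sup>2\<close> product on piecewise constants: on the piece \<open>E i\<close> the sum takes the value \<open>c i\<close>.
\<close>

lemma indicator_sum_square_pos:
  fixes E :: "'i \<Rightarrow> 'a::euclidean_space set" and c :: "'i \<Rightarrow> real"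
  assumes I: "finite I" and S: "bounded S" "S \<in> sets borel"
    and E: "\<And>i. i \<in> I \<Longrightarrow> E i \<subseteq> S" "\<And>i. i \<in> I \<Longrightarrow> openin (top_of_set (affine hull S)) (E i)"
      "\<And>i. i \<in> I \<Longrightarrow> E i \<noteq> {}"
    and disj: "\<And>i j x. i \<in> I \<Longrightarrow> j \<in> I \<Longrightarrow> x \<in> E i \<Longrightarrow> x \<in> E j \<Longrightarrow> i = j"
    and i: "i \<in> I" "c i \<noteq> 0"
  shows "(LINT x:S|flat_measure S. (\<Sum>i\<in>I. indicator (E i) x * c i) * (\<Sum>i\<in>I. indicator (E i) x * c i)) > 0"
proof (rule set_integral_flat_pos[OF _ S _ E(1)[OF i(1)] E(2)[OF i(1)] E(3)[OF i(1)]])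
  let ?g = "\<lambda>x. \<Sum>i\<in>I. indicator (E i) x * c i"
  show "bounded_measurable S (\<lambda>x. ?g x * ?g x)"
    by (intro bounded_measurable_mult bounded_measurable_sum bounded_measurable_const
        bounded_measurable_indicator openin_affine_hull_borel[OF E(2)])
  show "0 < c i * c i" using i(2) by (simp add: power2_eq_square[symmetric])
  fix x assume x: "x \<in> E i"
  have "?g x = (\<Sum>j\<in>I. if j = i then c i else 0)"
  proof (rule sum.cong[OF refl])
    fix j assume "j \<in> I"
    then show "indicator (E j) x * c j = (if j = i then c i else 0)"
      using disj[of j i x] i(1) x by (cases "x \<in> E j") auto
  qed
  then show "c i * c i \<le> ?g x * ?g x" using I i(1) by simp
qed simp

section \<open>Facets of simplices and their normals\<close>

text \<open>A facet of a simplex together with its opposite vertex.\<close>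

definition simplex_facet :: "'a::euclidean_space set \<Rightarrow> 'a set \<Rightarrow> 'a \<Rightarrow> bool"
  where "simplex_facet T f u \<longleftrightarrow> (\<exists>C. \<not> affine_dependent C \<and> 2 \<le> card C \<and> u \<in> C \<and>
    T = convex hull C \<and> f = convex hull (C - {u}))"

lemma facet_of_simplex:
  assumes "int d simplex T" "f facet_of T"
  shows "\<exists>u. simplex_facet T f u"
proof -
  obtain C where C: "\<not> affine_dependent C" "T = convex hull C" using assms(1) by (auto simp: simplex_def)
  then show ?thesis
    using assms(2) facet_of_convex_hull_affine_independent_alt[OF C(1), of f]
    by (auto simp: simplex_facet_def)
qed

text \<open>
  An edge from the facet to the opposite vertex complements the tangent space of the facet.
\<close>

lemma tangent_split:
  assumes "simplex_facet T f u" "x \<in> affine hull f" "v \<in> tangent T"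
  shows "\<exists>\<tau>\<in>tangent f. \<exists>m. v = \<tau> + m *\<^sub>R (u - x)"
proof -
  obtain C where C: "u \<in> C" "T = convex hull C" "f = convex hull (C - {u})"
    using assms(1) by (auto simp: simplex_facet_def)
  have x: "x \<in> affine hull (C - {u})" using assms(2) C(3) by simp
  then have xC: "x \<in> affine hull C" using hull_mono[of "C - {u}" C] by blast
  have "tangent T = tangent C" by (rule tangent_cong) (simp add: C)
  also have "\<dots> = span ((\<lambda>y. y - x) ` C)" by (rule tangent_eq_span[OF xC])
  also have "(\<lambda>y. y - x) ` C = insert (u - x) ((\<lambda>y. y - x) ` (C - {u}))" using C(1) by blast
  finally have "v \<in> span (insert (u - x) ((\<lambda>y. y - x) ` (C - {u})))" using assms(3) by simp
  then obtain m where "v - m *\<^sub>R (u - x) \<in> span ((\<lambda>y. y - x) ` (C - {u}))"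
    by (auto simp: span_insert)
  also have "\<dots> = tangent (C - {u})" by (rule tangent_eq_span[OF x, symmetric])
  also have "\<dots> = tangent f" by (rule tangent_cong) (simp add: C)
  finally have "v - m *\<^sub>R (u - x) \<in> tangent f" .
  then show ?thesis by (intro bexI[of _ "v - m *\<^sub>R (u - x)"]) auto
qed

lemma simplex_facet_nonempty:
  assumes "simplex_facet T f u"
  shows "f \<noteq> {}" "u \<in> T" "f \<subseteq> T" "convex T" "convex f"
proof -
  obtain C where C: "2 \<le> card C" "u \<in> C" "T = convex hull C" "f = convex hull (C - {u})"
    using assms by (auto simp: simplex_facet_def)
  have "C \<noteq> {u}" using C(1) by auto
  then show "f \<noteq> {}" using C by auto
  show "u \<in> T" using C by (simp add: hull_inc)
  show "f \<subseteq> T" unfolding C by (rule hull_mono) auto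
  show "convex T" "convex f" using C by auto
qed

text \<open>A simplex is the cone over any of its facets.\<close>

lemma simplex_in_segments:
  assumes "simplex_facet T f u" "y \<in> T"
  shows "\<exists>x\<in>f. \<exists>s\<ge>0. s \<le> 1 \<and> y = x + s *\<^sub>R (u - x)"
proof -
  obtain C where C: "2 \<le> card C" "u \<in> C" "T = convex hull C" "f = convex hull (C - {u})"
    using assms by (auto simp: simplex_facet_def)
  have "C - {u} \<noteq> {}" using simplex_facet_nonempty(1)[OF assms(1)] C by auto
  then have "convex hull (insert u (C - {u})) =
      {x. \<exists>s\<ge>0. \<exists>t\<ge>0. \<exists>b. s + t = 1 \<and> b \<in> convex hull (C - {u}) \<and> x = s *\<^sub>R u + t *\<^sub>R b}"
    by (rule convex_hull_insert)
  moreover have "y \<in> convex hull (insert u (C - {u}))" using assms(2) C by (simp add: insert_absorb)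
  ultimately obtain s t b where st: "s \<ge> 0" "t \<ge> 0" "s + t = 1" "b \<in> f" "y = s *\<^sub>R u + t *\<^sub>R b"
    using C(4) by blast
  then have t: "t = 1 - s" by simp
  have "y = b + s *\<^sub>R (u - b)" unfolding st(5) t by (simp add: algebra_simps)
  then show ?thesis using st by (intro bexI[of _ b] exI[of _ s]) auto
qed

text \<open>
  The outer normal is the normalized component of the edges at the opposite vertex that is
  orthogonal to the facet, with the sign reversed.
\<close>

lemma outer_normal:
  assumes "simplex_facet T f u"
  shows outer_normal_orth: "v \<in> tangent f \<Longrightarrow> v \<bullet> outer_normal T f = 0"
    and outer_normal_opposite: "x \<in> affine hull f \<Longrightarrow> (u - x) \<bullet> outer_normal T f < 0"
proof -
  obtain C where C: "\<not> affine_dependent C" "2 \<le> card C" "u \<in> C" "T = convex hull C"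
      "f = convex hull (C - {u})"
    using assms by (auto simp: simplex_facet_def)
  note ne = simplex_facet_nonempty[OF assms]
  obtain x0 where x0: "x0 \<in> f" using ne by blast
  have fT: "tangent f \<subseteq> tangent T"
    by (rule tangent_mono_hull) (use ne(3) hull_subset[of T affine] in blast)
  have aff_f: "affine hull f = affine hull (C - {u})" using C by simp
  have x0a: "x0 \<in> affine hull f" using x0 by (simp add: hull_inc)
  have notin: "u - x0 \<notin> tangent f"
  proof
    assume "u - x0 \<in> tangent f"
    then have "x0 + (u - x0) \<in> affine hull f" by (rule affine_hull_add_tangent[OF x0a])
    then show False using C(1,3) aff_f by (auto simp: affine_dependent_def)
  qed
  obtain y z where yz: "y \<in> span (tangent f)" "\<And>w. w \<in> span (tangent f) \<Longrightarrow> orthogonal z w"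
      "u - x0 = y + z"
    using orthogonal_subspace_decomp_exists[of "tangent f" "u - x0"] by blast
  have sf: "span (tangent f) = tangent f" by (simp add: span_eq_iff subspace_tangent)
  have orth: "w \<bullet> z = 0" if "w \<in> tangent f" for w
    using yz(2)[of w] that unfolding sf by (simp add: orthogonal_def inner_commute)
  have yf: "y \<in> tangent f" using yz(1) sf by simp
  have z0: "z \<noteq> 0" using notin yz(3) yf by auto
  define \<nu> where "\<nu> = - (1 / norm z) *\<^sub>R z"
  have wT: "u - x0 \<in> tangent T"
    by (rule affine_hull_diff_tangent) (use ne x0 in \<open>auto simp: hull_inc subset_iff\<close>)
  have "z = (u - x0) - y" using yz(3) by simp
  then have "z \<in> tangent T" using wT yf fT by (auto simp: subspace_diff subspace_tangent)
  then have \<nu>T: "\<nu> \<in> tangent T" by (simp add: \<nu>_def subspace_neg subspace_scale subspace_tangent)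
  have \<nu>1: "norm \<nu> = 1" using z0 by (simp add: \<nu>_def)
  have \<nu>f: "w \<bullet> \<nu> = 0" if "w \<in> tangent f" for w using orth[OF that] by (simp add: \<nu>_def)
  have \<nu>u: "(u - x) \<bullet> \<nu> < 0" if x: "x \<in> affine hull f" for x
  proof -
    have "x0 - x \<in> tangent f" by (rule affine_hull_diff_tangent[OF x0a x])
    then have "(u - x0) \<bullet> \<nu> + (x0 - x) \<bullet> \<nu> = (u - x0) \<bullet> \<nu>" using \<nu>f by simp
    then have "(u - x) \<bullet> \<nu> = (u - x0) \<bullet> \<nu>" by (simp add: inner_diff_left)
    also have "\<dots> = z \<bullet> \<nu>" unfolding yz(3) using \<nu>f[OF yf] by (simp add: inner_add_left)
    also have "\<dots> = - norm z" using z0 by (simp add: \<nu>_def power2_norm_eq_inner[symmetric] power2_eq_square)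
    finally show ?thesis using z0 by simp
  qed
  let ?P = "\<lambda>\<nu>. \<nu> \<in> tangent T \<and> norm \<nu> = 1 \<and> (\<forall>x\<in>f. \<forall>y\<in>T. (y - x) \<bullet> \<nu> \<le> 0)"
  have "outer_normal T f = \<nu>"
    unfolding outer_normal_def
  proof (rule the_equality)
    have "(y - x) \<bullet> \<nu> \<le> 0" if x: "x \<in> f" and y: "y \<in> T" for x y
    proof -
      obtain x' s where s: "x' \<in> f" "s \<ge> 0" "y = x' + s *\<^sub>R (u - x')"
        using simplex_in_segments[OF assms y] by blast
      have "x' - x \<in> tangent f" by (rule affine_hull_diff_tangent) (use x s in \<open>auto simp: hull_inc\<close>)
      then have "(x' - x) \<bullet> \<nu> = 0" by (rule \<nu>f)
      then have "(y - x) \<bullet> \<nu> = s * ((u - x') \<bullet> \<nu>)"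
        unfolding s(3) by (simp add: inner_add_left inner_diff_left)
      moreover have "(u - x') \<bullet> \<nu> \<le> 0" using \<nu>u[of x'] s(1) by (simp add: hull_inc)
      ultimately show ?thesis using s(2) by (simp add: mult_nonneg_nonpos)
    qed
    then show "?P \<nu>" using \<nu>T \<nu>1 by blast
    fix \<nu>' assume P: "?P \<nu>'"
    have diff: "(y - x) \<bullet> \<nu>' = 0" if "x \<in> f" "y \<in> f" for x y
    proof -
      have "(y - x) \<bullet> \<nu>' \<le> 0" "(x - y) \<bullet> \<nu>' \<le> 0" using P that ne(3) by blast+
      then show ?thesis by (simp add: inner_diff_left)
    qed
    have f': "w \<bullet> \<nu>' = 0" if "w \<in> tangent f" for w
      using that unfolding tangent_def
    proof (induction rule: span_induct_alt)
      case (step c v w)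
      then show ?case using diff by (auto simp: inner_add_left)
    qed simp
    \<comment> \<open>
      Both normals are orthogonal to the facet, so \<open>\<nu>' = k \<nu>\<close> with the factor
      read off at the edge \<open>u - x0\<close>.
    \<close>
    define k where "k = ((u - x0) \<bullet> \<nu>') / ((u - x0) \<bullet> \<nu>)"
    have wu: "(u - x0) \<bullet> \<nu> < 0" by (rule \<nu>u[OF x0a])
    have "(u - x0) \<bullet> \<nu>' \<le> 0" using P x0 ne(2) by blast
    then have k0: "k \<ge> 0" using wu by (simp add: k_def zero_le_divide_iff)
    let ?e = "\<nu>' - k *\<^sub>R \<nu>"
    have "?e \<in> tangent T" using P \<nu>T by (simp add: subspace_diff subspace_scale subspace_tangent)
    then obtain \<tau> m where \<tau>: "\<tau> \<in> tangent f" "?e = \<tau> + m *\<^sub>R (u - x0)"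
      using tangent_split[OF assms x0a] by blast
    have "(u - x0) \<bullet> ?e = 0" using wu by (simp add: inner_diff_right k_def)
    moreover have "\<tau> \<bullet> ?e = 0" using f'[OF \<tau>(1)] \<nu>f[OF \<tau>(1)] by (simp add: inner_diff_right)
    ultimately have "(\<tau> + m *\<^sub>R (u - x0)) \<bullet> ?e = 0" by (simp add: inner_add_left)
    then have "?e \<bullet> ?e = 0" unfolding \<tau>(2) .
    then have e: "\<nu>' = k *\<^sub>R \<nu>" by simp
    then have "k = 1" using P \<nu>1 k0 by simp
    then show "\<nu>' = \<nu>" using e by simp
  qed
  then show "v \<in> tangent f \<Longrightarrow> v \<bullet> outer_normal T f = 0"
    "x \<in> affine hull f \<Longrightarrow> (u - x) \<bullet> outer_normal T f < 0"
    using \<nu>f \<nu>u by auto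
qed

section \<open>Raviart-Thomas fields on a simplex\<close>

text \<open>
  The definition lets the base point vary; fixing it turns the fields into a two-parameter family
  \<open>(a, c)\<close> that is visibly a vector space.
\<close>

lemma rt0_iff:
  assumes z: "z \<in> T"
  shows "v \<in> rt0 T \<longleftrightarrow> (\<exists>a\<in>tangent T. \<exists>c. v = (\<lambda>x. a + c *\<^sub>R (x - z)))"
proof
  assume "v \<in> rt0 T"
  then obtain a c y where v: "a \<in> tangent T" "y \<in> T" "v = (\<lambda>x. a + c *\<^sub>R (x - y))"
    by (auto simp: rt0_def)
  have "z - y \<in> tangent T" using v(2) z by (simp add: affine_hull_diff_tangent hull_inc)
  then have "a + c *\<^sub>R (z - y) \<in> tangent T" using v(1) by (simp add: subspace_add subspace_scale subspace_tangent)
  moreover have "v = (\<lambda>x. (a + c *\<^sub>R (z - y)) + c *\<^sub>R (x - z))"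
    unfolding v(3) by (simp add: fun_eq_iff algebra_simps)
  ultimately show "\<exists>a\<in>tangent T. \<exists>c. v = (\<lambda>x. a + c *\<^sub>R (x - z))" by blast
qed (use z in \<open>auto simp: rt0_def\<close>)

lemma subspace_rt0:
  assumes "T \<noteq> {}"
  shows "subspace (rt0 T)"
proof -
  obtain z where z: "z \<in> T" using assms by blast
  show ?thesis
    unfolding subspace_def rt0_iff[OF z]
  proof (intro conjI ballI allI)
    show "\<exists>a\<in>tangent T. \<exists>c. 0 = (\<lambda>x. a + c *\<^sub>R (x - z))"
      by (rule bexI[of _ 0], rule exI[of _ 0]) (auto simp: fun_eq_iff subspace_0 subspace_tangent)
  next
    fix v w assume "v \<in> rt0 T" "w \<in> rt0 T"
    then obtain a c a' c' where "a \<in> tangent T" "a' \<in> tangent T" "v = (\<lambda>x. a + c *\<^sub>R (x - z))"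
      "w = (\<lambda>x. a' + c' *\<^sub>R (x - z))" unfolding rt0_iff[OF z] by blast
    then show "\<exists>a\<in>tangent T. \<exists>c. v + w = (\<lambda>x. a + c *\<^sub>R (x - z))"
      by (intro bexI[of _ "a + a'"] exI[of _ "c + c'"])
        (simp_all add: fun_eq_iff scaleR_add_left subspace_add subspace_tangent)
  next
    fix s v assume "v \<in> rt0 T"
    then obtain a c where "a \<in> tangent T" "v = (\<lambda>x. a + c *\<^sub>R (x - z))" unfolding rt0_iff[OF z] by blast
    then show "\<exists>a\<in>tangent T. \<exists>c. s *\<^sub>R v = (\<lambda>x. a + c *\<^sub>R (x - z))"
      by (intro bexI[of _ "s *\<^sub>R a"] exI[of _ "s * c"])
        (simp_all add: fun_eq_iff scaleR_add_right subspace_scale subspace_tangent)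
  qed
qed

lemma rt0_tangent:
  assumes "v \<in> rt0 T" "x \<in> affine hull T"
  shows "v x \<in> tangent T"
proof -
  obtain a c z where v: "a \<in> tangent T" "z \<in> T" "v = (\<lambda>x. a + c *\<^sub>R (x - z))"
    using assms(1) by (auto simp: rt0_def)
  have "x - z \<in> tangent T" by (rule affine_hull_diff_tangent) (use assms v in \<open>auto simp: hull_inc\<close>)
  then show ?thesis unfolding v(3) using v(1) by (simp add: subspace_add subspace_scale subspace_tangent)
qed

lemma continuous_rt0: "v \<in> rt0 T \<Longrightarrow> continuous_on UNIV v"
  by (auto simp: rt0_def intro!: continuous_intros)

lemma flux_eq:
  assumes f: "simplex_facet T f u" and v: "v \<in> rt0 T" and x: "x \<in> f"
  shows "flux T f v = v x \<bullet> outer_normal T f"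
  unfolding flux_def
proof (rule the_equality)
  obtain a c z where a: "v = (\<lambda>x. a + c *\<^sub>R (x - z))" using v by (auto simp: rt0_def)
  show "\<forall>y\<in>f. v y \<bullet> outer_normal T f = v x \<bullet> outer_normal T f"
  proof
    fix y assume "y \<in> f"
    then have "y - x \<in> tangent f" using x by (simp add: affine_hull_diff_tangent hull_inc)
    then have "c *\<^sub>R (y - x) \<bullet> outer_normal T f = 0" using outer_normal_orth[OF f] by simp
    then show "v y \<bullet> outer_normal T f = v x \<bullet> outer_normal T f"
      unfolding a by (simp add: inner_add_left inner_diff_left algebra_simps)
  qed
  then show "c = v x \<bullet> outer_normal T f" if "\<forall>x\<in>f. v x \<bullet> outer_normal T f = c" for c
    using that x by auto
qed

lemma linear_flux:
  assumes "simplex_facet T f u"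
  shows "linear_on (rt0 T) (flux T f)"
proof -
  obtain x where x: "x \<in> f" using simplex_facet_nonempty(1)[OF assms] by blast
  have "T \<noteq> {}" using simplex_facet_nonempty(2)[OF assms] by blast
  note sub = subspace_rt0[OF this]
  show ?thesis
    by (rule linear_onI)
      (simp_all add: flux_eq[OF assms _ x] subspace_add[OF sub] subspace_scale[OF sub] inner_add_left)
qed

text \<open>
  Unisolvence. At a vertex, all facets but the opposite one prescribe normal components, and these
  determine the value there.
\<close>

lemma rt0_eq_0:
  assumes T: "int d simplex T" "d \<ge> 1" and v: "v \<in> rt0 T"
    and zero: "\<And>f. f facet_of T \<Longrightarrow> flux T f v = 0"
  shows "v = 0"
proof -
  obtain C where C: "\<not> affine_dependent C" "int (card C) = int d + 1" "T = convex hull C"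
    using T(1) by (auto simp: simplex_def)
  have card: "2 \<le> card C" using C(2) T(2) by simp
  then have fin: "finite C" using card.infinite by fastforce
  have facet: "simplex_facet T (convex hull (C - {u})) u" "convex hull (C - {u}) facet_of T"
    if "u \<in> C" for u
    using that C card facet_of_convex_hull_affine_independent_alt[OF C(1)]
    by (auto simp: simplex_facet_def)
  have vertex: "v x = 0" if x: "x \<in> C" for x
  proof -
    have xT: "x \<in> affine hull C" using x by (simp add: hull_inc)
    have "v x \<in> tangent T"
      by (rule rt0_tangent[OF v]) (use x C in \<open>simp add: hull_inc\<close>)
    also have "tangent T = tangent C" by (rule tangent_cong) (simp add: C)
    also have "\<dots> = span ((\<lambda>y. y - x) ` C)" by (rule tangent_eq_span[OF xT])
    also have "\<dots> = span ((\<lambda>y. y - x) ` (C - {x}))"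
    proof -
      have "(\<lambda>y. y - x) ` C = insert 0 ((\<lambda>y. y - x) ` (C - {x}))" using x by force
      then show ?thesis by (simp add: span_insert_0)
    qed
    finally have "v x \<in> range (\<lambda>t. \<Sum>y\<in>(\<lambda>y. y - x) ` (C - {x}). t y *\<^sub>R y)"
      using fin by (simp add: span_finite)
    then obtain t0 where t0: "v x = (\<Sum>y\<in>(\<lambda>y. y - x) ` (C - {x}). t0 y *\<^sub>R y)" by blast
    define t where "t y = t0 (y - x)" for y
    have t: "v x = (\<Sum>y\<in>C - {x}. t y *\<^sub>R (y - x))"
      unfolding t0 t_def by (rule sum.reindex_cong[of "\<lambda>y. y - x"]) (auto simp: inj_on_def)
    have "t u = 0" if u: "u \<in> C - {x}" for u
    proof -
      let ?f = "convex hull (C - {u})"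
      let ?n = "outer_normal T ?f"
      note fu = facet[of u]
      have xf: "x \<in> ?f" using x u by (intro hull_inc) auto
      have "0 = v x \<bullet> ?n" using flux_eq[OF fu(1) v xf] zero[OF fu(2)] u by simp
      also have "\<dots> = (\<Sum>y\<in>C - {x}. t y * ((y - x) \<bullet> ?n))" unfolding t by (simp add: inner_sum_left)
      also have "\<dots> = (\<Sum>y\<in>C - {x}. if y = u then t u * ((u - x) \<bullet> ?n) else 0)"
      proof (rule sum.cong[OF refl])
        fix y assume y: "y \<in> C - {x}"
        have "(y - x) \<bullet> ?n = 0" if "y \<noteq> u"
        proof (rule outer_normal_orth[OF fu(1)])
          show "u \<in> C" using u by simp
          show "y - x \<in> tangent ?f"
            by (rule affine_hull_diff_tangent)
              (use y that xf in \<open>auto intro!: hull_inc simp del: affine_hull_convex_hull\<close>)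
        qed
        then show "t y * ((y - x) \<bullet> ?n) = (if y = u then t u * ((u - x) \<bullet> ?n) else 0)" by simp
      qed
      also have "\<dots> = t u * ((u - x) \<bullet> ?n)" using u fin by simp
      finally have "t u * ((u - x) \<bullet> ?n) = 0" by simp
      moreover have "(u - x) \<bullet> ?n < 0"
        by (rule outer_normal_opposite[OF fu(1) hull_inc[OF xf]]) (use u in simp)
      ultimately show "t u = 0" by simp
    qed
    then show "v x = 0" unfolding t by simp
  qed
  obtain x where x: "x \<in> C" using card by fastforce
  have "C \<noteq> {x}" using card by auto
  then obtain y where y: "y \<in> C" "y \<noteq> x" using x by blast
  have xT: "x \<in> T" using x C by (simp add: hull_inc)
  obtain a c where a: "v = (\<lambda>y. a + c *\<^sub>R (y - x))" using v unfolding rt0_iff[OF xT] by blast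
  have "a = 0" using vertex[OF x] a by simp
  moreover have "c = 0" using vertex[OF y(1)] a \<open>a = 0\<close> y(2) by simp
  ultimately show "v = 0" unfolding a by (simp add: fun_eq_iff)
qed

lemma linear_on_sum:
  assumes "linear_on V f" "subspace V" "finite I" "\<And>i. i \<in> I \<Longrightarrow> x i \<in> V"
  shows "f (\<Sum>i\<in>I. x i) = (\<Sum>i\<in>I. f (x i))"
  using assms(3,4)
  by (induction I rule: finite_induct)
    (simp_all add: linear_on_zero[OF assms(1,2)] linear_on_add[OF assms(1)] subspace_sum[OF assms(2)])

text \<open>The field \<open>x - u\<close> is tangential to all facets that contain the vertex \<open>u\<close>.\<close>

lemma rt0_exists:
  assumes T: "int d simplex T" "d \<ge> 1"
  shows "\<exists>v\<in>rt0 T. \<forall>f. f facet_of T \<longrightarrow> flux T f v = g f"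
proof -
  obtain C where C: "\<not> affine_dependent C" "int (card C) = int d + 1" "T = convex hull C"
    using T(1) by (auto simp: simplex_def)
  have card: "2 \<le> card C" using C(2) T(2) by simp
  then have fin: "finite C" using card.infinite by fastforce
  let ?f = "\<lambda>u. convex hull (C - {u})"
  have facet: "simplex_facet T (?f u) u" if "u \<in> C" for u
    using that C card by (auto simp: simplex_facet_def)
  have uT: "u \<in> T" if "u \<in> C" for u using that C by (simp add: hull_inc)
  have sub: "subspace (rt0 T)" by (rule subspace_rt0) (use card C in auto)
  define \<phi> where "\<phi> u = (\<lambda>x. x - u)" for u :: 'a
  have \<phi>: "\<phi> u \<in> rt0 T" if "u \<in> C" for u
    unfolding rt0_iff[OF uT[OF that]] \<phi>_def
    by (intro bexI[of _ 0] exI[of _ 1]) (auto simp: subspace_0 subspace_tangent)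
  have nz: "flux T (?f u) (\<phi> u) \<noteq> 0" if u: "u \<in> C" for u
  proof -
    obtain x where x: "x \<in> ?f u" using simplex_facet_nonempty(1)[OF facet[OF u]] by blast
    have "(u - x) \<bullet> outer_normal T (?f u) < 0"
      by (rule outer_normal_opposite[OF facet[OF u] hull_inc[OF x]])
    then show ?thesis unfolding flux_eq[OF facet[OF u] \<phi>[OF u] x] by (simp add: \<phi>_def inner_diff_left)
  qed
  have z: "flux T (?f w) (\<phi> u) = 0" if u: "u \<in> C" and w: "w \<in> C" and "u \<noteq> w" for u w
  proof -
    have "u \<in> ?f w" using that by (intro hull_inc) auto
    then show ?thesis using flux_eq[OF facet[OF w] \<phi>[OF u], of u] by (simp add: \<phi>_def)
  qed
  define v where "v = (\<Sum>u\<in>C. (g (?f u) / flux T (?f u) (\<phi> u)) *\<^sub>R \<phi> u)"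
  have v: "v \<in> rt0 T" unfolding v_def by (intro subspace_sum subspace_scale sub \<phi>)
  have "flux T (?f w) v = g (?f w)" if w: "w \<in> C" for w
  proof -
    note lin = linear_flux[OF facet[OF w]]
    have "flux T (?f w) v = (\<Sum>u\<in>C. flux T (?f w) ((g (?f u) / flux T (?f u) (\<phi> u)) *\<^sub>R \<phi> u))"
      unfolding v_def by (intro linear_on_sum[OF lin sub fin] subspace_scale[OF sub] \<phi>)
    also have "\<dots> = (\<Sum>u\<in>C. if u = w then g (?f w) else 0)"
      by (intro sum.cong refl) (use nz z w in \<open>auto simp: linear_on_scale[OF lin \<phi>]\<close>)
    also have "\<dots> = g (?f w)" using fin w by simp
    finally show ?thesis .
  qed
  then show ?thesis
    using v C(3) facet_of_convex_hull_affine_independent_alt[OF C(1)] by (intro bexI[of _ v]) auto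
qed

lemma rt0_eqI:
  assumes T: "int d simplex T" "d \<ge> 1" and v: "v \<in> rt0 T" "w \<in> rt0 T"
    and eq: "\<And>f. f facet_of T \<Longrightarrow> flux T f v = flux T f w"
  shows "v = w"
proof -
  have ne: "T \<noteq> {}" using v by (auto simp: rt0_def)
  have "v - w = 0"
  proof (rule rt0_eq_0[OF T subspace_diff[OF subspace_rt0[OF ne] v]])
    fix f assume f: "f facet_of T"
    obtain u where "simplex_facet T f u" using facet_of_simplex[OF T(1) f] by blast
    then show "flux T f (v - w) = 0"
      using linear_on_diff[OF linear_flux subspace_rt0[OF ne] v] eq[OF f] by simp
  qed
  then show ?thesis by simp
qed

lemma rt0_basis:
  assumes T: "int d simplex T" "d \<ge> 1"
  shows "rt0_basis T f \<in> rt0 T" and "g facet_of T \<Longrightarrow> flux T g (rt0_basis T f) = (if g = f then 1 else 0)"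
proof -
  have "\<exists>!\<phi>. \<phi> \<in> rt0 T \<and> (\<forall>g. g facet_of T \<longrightarrow> flux T g \<phi> = (if g = f then 1 else 0))"
  proof (rule ex_ex1I)
    show "\<exists>\<phi>. \<phi> \<in> rt0 T \<and> (\<forall>g. g facet_of T \<longrightarrow> flux T g \<phi> = (if g = f then 1 else 0))"
      using rt0_exists[OF T, of "\<lambda>g. if g = f then 1 else 0"] by blast
  qed (rule rt0_eqI[OF T]; simp)
  then have "rt0_basis T f \<in> rt0 T \<and> (\<forall>g. g facet_of T \<longrightarrow> flux T g (rt0_basis T f) = (if g = f then 1 else 0))"
    unfolding rt0_basis_def by (rule theI')
  then show "rt0_basis T f \<in> rt0 T" "g facet_of T \<Longrightarrow> flux T g (rt0_basis T f) = (if g = f then 1 else 0)"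
    by auto
qed

lemma flat_div_rt0: "flat_div T (\<lambda>x. a + c *\<^sub>R (x - z)) x = c * real (card (tangent_frame T))"
proof -
  have "((\<lambda>x. a + c *\<^sub>R (x - z)) has_derivative (\<lambda>h. c *\<^sub>R h)) (at x)"
    by (auto intro!: derivative_eq_intros)
  then have "frechet_derivative (\<lambda>x. a + c *\<^sub>R (x - z)) (at x) = (\<lambda>h. c *\<^sub>R h)"
    by (rule frechet_derivative_at[symmetric])
  then have "flat_div T (\<lambda>x. a + c *\<^sub>R (x - z)) x = (\<Sum>b\<in>tangent_frame T. c * (b \<bullet> b))"
    by (simp add: flat_div_def)
  also have "\<dots> = (\<Sum>b\<in>tangent_frame T. c)"
    by (intro sum.cong refl) (use tangent_frame(3)[of _ T] in \<open>auto simp: norm_eq_1\<close>)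
  finally show ?thesis by simp
qed

lemma flat_div_const: "v \<in> rt0 T \<Longrightarrow> flat_div T v x = flat_div T v y"
  by (auto simp: rt0_def flat_div_rt0)

lemma linear_flat_div:
  assumes "T \<noteq> {}"
  shows "linear_on (rt0 T) (\<lambda>v. flat_div T v x)"
proof (rule linear_onI)
  obtain z where z: "z \<in> T" using assms by blast
  fix v w assume "v \<in> rt0 T" "w \<in> rt0 T"
  then obtain a c a' c' where vw: "v = (\<lambda>x. a + c *\<^sub>R (x - z))" "w = (\<lambda>x. a' + c' *\<^sub>R (x - z))"
    unfolding rt0_iff[OF z] by blast
  have "v + w = (\<lambda>x. (a + a') + (c + c') *\<^sub>R (x - z))" unfolding vw by (simp add: fun_eq_iff algebra_simps)
  then have "flat_div T (v + w) x = (c + c') * real (card (tangent_frame T))" by (simp only: flat_div_rt0)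
  then show "flat_div T (v + w) x = flat_div T v x + flat_div T w x"
    unfolding vw flat_div_rt0 by (simp add: algebra_simps)
next
  obtain z where z: "z \<in> T" using assms by blast
  fix s v assume "v \<in> rt0 T"
  then obtain a c where v: "v = (\<lambda>x. a + c *\<^sub>R (x - z))" unfolding rt0_iff[OF z] by blast
  have "s *\<^sub>R v = (\<lambda>x. s *\<^sub>R a + (s * c) *\<^sub>R (x - z))" unfolding v by (simp add: fun_eq_iff algebra_simps)
  then have "flat_div T (s *\<^sub>R v) x = s * c * real (card (tangent_frame T))" by (simp only: flat_div_rt0)
  then show "flat_div T (s *\<^sub>R v) x = s *\<^sub>R flat_div T v x"
    unfolding v flat_div_rt0 by simp
qed

section \<open>Triangulations of flat sets\<close>

lemma triangulates_simplex: "triangulates \<sigma> d S \<T> \<Longrightarrow> T \<in> \<T> \<Longrightarrow> int d simplex T"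
  by (simp add: triangulates_def)

lemma triangulates_finite: "triangulates \<sigma> d S \<T> \<Longrightarrow> finite \<T>"
  by (simp add: triangulates_def triangulation_def)

text \<open>
  This applies to mesh elements inside a subdomain and to facets on an interface: their relative
  interiors are relatively open there and hence have positive measure.
\<close>

lemma convex_piece:
  assumes "convex T" "aff_dim T = aff_dim S" "T \<noteq> {}" "rel_interior T \<subseteq> S"
  shows "affine hull T = affine hull S" and "openin (top_of_set (affine hull S)) (rel_interior T)"
    and "rel_interior T \<noteq> {}"
proof -
  have "affine hull T = affine hull (rel_interior T)"
    by (rule rel_interior_same_affine_hull[OF assms(1), symmetric])
  also have "\<dots> \<subseteq> affine hull S" by (rule hull_mono[OF assms(4)])
  finally show eq: "affine hull T = affine hull S"
    using affine_dim_equal[of "affine hull T" "affine hull S"] assms(2,3) by simp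
  show "openin (top_of_set (affine hull S)) (rel_interior T)"
    using openin_rel_interior[of T] eq by simp
  show "rel_interior T \<noteq> {}" using assms by (simp add: rel_interior_eq_empty)
qed

lemma triangulates_element:
  assumes "triangulates \<sigma> d S \<T>" "aff_dim S = int d" "T \<in> \<T>"
  shows "affine hull T = affine hull S" and "tangent T = tangent S" and "convex T" and "compact T"
    and "T \<noteq> {}" and "rel_interior T \<noteq> {}" and "rel_interior T \<subseteq> S"
    and "openin (top_of_set (affine hull S)) (rel_interior T)"
proof -
  have T: "int d simplex T" "rel_interior T \<subseteq> S" using assms by (auto simp: triangulates_def)
  show c: "convex T" "compact T" using convex_simplex[OF T(1)] compact_simplex[OF T(1)] .
  have aff: "aff_dim T = int d" by (rule aff_dim_simplex[OF T(1)])
  then show ne: "T \<noteq> {}" by auto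
  show "rel_interior T \<subseteq> S" by (rule T)
  have dims: "aff_dim T = aff_dim S" using aff assms(2) by simp
  note p = convex_piece[OF c(1) dims ne T(2)]
  show "affine hull T = affine hull S" "openin (top_of_set (affine hull S)) (rel_interior T)"
    "rel_interior T \<noteq> {}" by (rule p)+
  then show "tangent T = tangent S" by (intro tangent_cong)
qed

lemma triangulates_disjoint:
  assumes "triangulates \<sigma> d S \<T>" "T \<in> \<T>" "T' \<in> \<T>" "x \<in> rel_interior T" "x \<in> rel_interior T'"
  shows "T = T'"
proof -
  have face: "T \<inter> T' face_of T" "T \<inter> T' face_of T'"
    using assms(1-3) by (auto simp: triangulates_def triangulation_def) (metis Int_commute)
  have x: "x \<in> T \<inter> T'" using assms(4,5) rel_interior_subset by blast
  have "T \<subseteq> T \<inter> T'" by (rule subset_of_face_of[OF face(1)]) (use x assms(4) in auto)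
  moreover have "T' \<subseteq> T \<inter> T'" by (rule subset_of_face_of[OF face(2)]) (use x assms(5) in auto)
  ultimately show ?thesis by blast
qed

text \<open>
  Two elements that share a facet lie on opposite sides of it, since otherwise they overlap next to
  the facet.
\<close>

lemma facets_with_same_normal:
  assumes tri: "triangulates \<sigma> d S \<T>" "aff_dim S = int d" and T: "T \<in> \<T>" "T' \<in> \<T>"
    and f: "f facet_of T" "f' facet_of T'" and \<nu>: "outer_normal T f = outer_normal T' f'"
    and x: "x \<in> rel_interior f" "x \<in> rel_interior f'"
  shows "T = T' \<and> f = f'"
proof -
  let ?F = "T \<inter> T'"
  note el = triangulates_element[OF tri]
  have face: "?F face_of T" "?F face_of T'"
    using tri(1) T by (auto simp: triangulates_def triangulation_def) (metis Int_commute)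
  have ff: "f face_of T" "f' face_of T'" using f by (auto simp: facet_of_def)
  have fT: "f \<subseteq> T" "f' \<subseteq> T'" using ff face_of_imp_subset by auto
  have xf: "x \<in> f" "x \<in> f'" using x rel_interior_subset by auto
  have xF: "x \<in> ?F" using xf fT by blast
  have fF: "f \<subseteq> ?F" "f' \<subseteq> ?F"
    using subset_of_face_of[OF face(1) fT(1)] subset_of_face_of[OF face(2) fT(2)] x xF by auto
  have proper: "?F = g" if g: "g facet_of U" "g \<subseteq> ?F" "?F face_of U" "?F \<noteq> U" "convex U" for g U
  proof (rule ccontr)
    assume "?F \<noteq> g"
    have "g face_of ?F"
      using g by (meson face_of_imp_subset face_of_subset facet_of_def)
    moreover have "convex ?F" by (rule face_of_imp_convex[OF g(3)])
    ultimately have "aff_dim g < aff_dim ?F" using \<open>?F \<noteq> g\<close> face_of_aff_dim_lt by metis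
    moreover have "aff_dim ?F < aff_dim U" by (rule face_of_aff_dim_lt[OF g(5,3,4)])
    ultimately show False using g(1) by (simp add: facet_of_def)
  qed
  have "T = T'"
  proof (rule ccontr)
    assume n: "T \<noteq> T'"
    have dims: "aff_dim T = int d" "aff_dim T' = int d"
      using T tri(1) by (auto intro: aff_dim_simplex triangulates_simplex)
    have nT: "?F \<noteq> T"
    proof
      assume "?F = T"
      then have "T face_of T'" using face(2) by simp
      then show False using face_of_aff_dim_lt[OF el(3)[OF T(2)]] n dims by fastforce
    qed
    have nT': "?F \<noteq> T'"
    proof
      assume "?F = T'"
      then have "T' face_of T" using face(1) by simp
      then show False using face_of_aff_dim_lt[OF el(3)[OF T(1)]] n dims by fastforce
    qed
    have Ff: "?F = f" by (rule proper[OF f(1) fF(1) face(1) nT el(3)[OF T(1)]])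
    have Ff': "?F = f'" by (rule proper[OF f(2) fF(2) face(2) nT' el(3)[OF T(2)]])
    obtain u where u: "simplex_facet T f u"
      using facet_of_simplex[OF triangulates_simplex[OF tri(1) T(1)] f(1)] by blast
    obtain u' where u': "simplex_facet T' f u'"
      using facet_of_simplex[OF triangulates_simplex[OF tri(1) T(2)] f(2)] Ff Ff' by auto
    let ?n = "outer_normal T f"
    have n': "outer_normal T' f = ?n" using \<nu> Ff Ff' by simp
    have xa: "x \<in> affine hull f" using xf by (simp add: hull_inc)
    have neg: "(u - x) \<bullet> ?n < 0" "(u' - x) \<bullet> ?n < 0"
      using outer_normal_opposite[OF u xa] outer_normal_opposite[OF u' xa] n' by auto
    have "u - x \<in> tangent T"
      by (rule affine_hull_diff_tangent) (use simplex_facet_nonempty[OF u] xF in \<open>auto simp: hull_inc\<close>)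
    then have "u - x \<in> tangent T'" using el(2)[OF T(1)] el(2)[OF T(2)] by simp
    then obtain \<tau> k where \<tau>: "\<tau> \<in> tangent f" "u - x = \<tau> + k *\<^sub>R (u' - x)"
      using tangent_split[OF u' xa] by blast
    have "(u - x) \<bullet> ?n = k * ((u' - x) \<bullet> ?n)"
      unfolding \<tau>(2) using outer_normal_orth[OF u \<tau>(1)] by (simp add: inner_add_left)
    then have k: "k > 0" using neg by (smt (verit) mult_nonpos_nonpos)
    obtain e where e: "e > 0" "ball x e \<inter> affine hull f \<subseteq> f"
      using x(1) by (auto simp: mem_rel_interior_ball)
    define r where "r = e / (norm \<tau> + 1)"
    have n1: "norm \<tau> + 1 > 0" by (simp add: add_nonneg_pos)
    have r: "r > 0" "r * norm \<tau> < e"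
      using e(1) n1 by (simp_all add: r_def pos_divide_less_eq)
    \<comment> \<open>
      The step \<open>s\<close> from \<open>x\<close> towards \<open>u\<close> is so small that \<open>s / (1 - s * k) \<le> r\<close>. The point \<open>p\<close> below then
      lies in the facet, and \<open>x + s (u - x)\<close> lies on the segment from \<open>p\<close> to \<open>u'\<close>, hence in \<open>T'\<close>.
    \<close>
    define s where "s = min 1 r / (1 + 2 * k * (1 + r))"
    have den: "1 + 2 * k * (1 + r) > 1" using k r(1) by simp
    have s: "s > 0" "s \<le> 1" "s * k < 1" "s \<le> r * (1 - s * k)"
    proof -
      have m: "min 1 r > 0" using r(1) by simp
      show "s > 0" unfolding s_def using m den by simp
      show "s \<le> 1" unfolding s_def using m den by (simp add: field_simps)
      have kr: "2 * k * (1 + r) \<ge> 2 * k" using k r(1) by simp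
      have "s * (1 + 2 * k * (1 + r)) = min 1 r" unfolding s_def using den by simp
      then have A: "s + s * (2 * k) + s * (2 * k * r) = min 1 r" by (simp add: algebra_simps)
      have B: "s * (2 * k) > 0" "s * (2 * k * r) > 0" using \<open>s > 0\<close> k r(1) by simp_all
      have "s * (2 * k) < 1" using A B \<open>s > 0\<close> by (smt (verit) min.cobounded1)
      then show "s * k < 1" using B(1) by simp
      have "s + s * (2 * k * r) \<le> r" using A B by (smt (verit) min.cobounded2)
      then show "s \<le> r * (1 - s * k)" using B(2) by (simp add: algebra_simps)
    qed
    define q where "q = s / (1 - s * k)"
    have q: "0 \<le> q" "q \<le> r" "(1 - s * k) * q = s" using s by (auto simp: q_def pos_divide_le_eq)
    let ?p = "x + q *\<^sub>R \<tau>"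
    have "?p \<in> f"
    proof (rule subsetD[OF e(2)], rule IntI)
      have "norm (q *\<^sub>R \<tau>) \<le> r * norm \<tau>" using q by (simp add: mult_right_mono)
      then show "?p \<in> ball x e" using r(2) by (simp add: dist_norm)
      show "?p \<in> affine hull f"
        by (rule affine_hull_add_tangent[OF xa]) (simp add: subspace_scale subspace_tangent \<tau>(1))
    qed
    then have "?p \<in> T'" using simplex_facet_nonempty(3)[OF u'] by blast
    then have "(1 - s * k) *\<^sub>R ?p + (s * k) *\<^sub>R u' \<in> T'"
      by (intro convexD[OF el(3)[OF T(2)]] simplex_facet_nonempty(2)[OF u']) (use s k in auto)
    also have "(1 - s * k) *\<^sub>R ?p = (1 - s * k) *\<^sub>R x + s *\<^sub>R \<tau>"
      by (simp add: scaleR_add_right q(3))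
    also have "(1 - s * k) *\<^sub>R x + s *\<^sub>R \<tau> + (s * k) *\<^sub>R u' = x + s *\<^sub>R (\<tau> + k *\<^sub>R (u' - x))"
      by (simp add: algebra_simps)
    also have "\<dots> = x + s *\<^sub>R (u - x)" by (simp add: \<tau>(2))
    finally have y': "x + s *\<^sub>R (u - x) \<in> T'" .
    have "(1 - s) *\<^sub>R x + s *\<^sub>R u \<in> T"
      by (intro convexD[OF el(3)[OF T(1)]] simplex_facet_nonempty(2)[OF u]) (use s xF in auto)
    then have "x + s *\<^sub>R (u - x) \<in> T" by (simp add: algebra_simps)
    then have "x + s *\<^sub>R (u - x) \<in> f" using y' Ff by blast
    then have "(x + s *\<^sub>R (u - x)) - x \<in> tangent f"
      by (intro affine_hull_diff_tangent xa) (simp add: hull_inc)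
    then have "s * ((u - x) \<bullet> ?n) = 0" using outer_normal_orth[OF u] by fastforce
    then show False using s(1) neg(1) by simp
  qed
  moreover have "f = f'"
    by (rule face_of_eq[OF ff(1)]) (use ff(2) x calculation in auto)
  ultimately show ?thesis by simp
qed

section \<open>Discrete spaces and the discrete extension\<close>

text \<open>One mesh with one choice of the physical parameters.\<close>

locale discretization =
  fixes G :: "'a::euclidean_space geometry" and \<sigma> :: real and M :: "'a mesh" and P :: "'a params"
  assumes geometry: "fractured_medium G" and mesh: "admissible_mesh G \<sigma> M"
    and parameters: "physical_parameters G P"
begin

lemma medium_subdomains:
  "\<forall>d\<le>DIM('a). finite (Idx G d) \<and>
    (\<forall>i\<in>Idx G d. Sub G d i \<subseteq> Dom G \<and> connected (Sub G d i) \<and> aff_dim (Sub G d i) = int d \<and>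
      openin (top_of_set (affine hull (Sub G d i))) (Sub G d i))"
  using geometry unfolding fractured_medium_def by (elim conjE)

lemma medium_bounded: "bounded (Dom G)"
  using geometry unfolding fractured_medium_def by (elim conjE)

lemma medium_disjoint:
  "\<forall>d\<le>DIM('a). \<forall>d'\<le>DIM('a). \<forall>i\<in>Idx G d. \<forall>i'\<in>Idx G d'.
    (d, i) \<noteq> (d', i') \<longrightarrow> Sub G d i \<inter> Sub G d' i' = {}"
  using geometry unfolding fractured_medium_def by (elim conjE)

lemma medium_boundary: "BdD G \<union> BdN G = closure (Omega G) - Omega G"
  using geometry unfolding fractured_medium_def by (elim conjE)

lemma finite_Idx: "d \<le> DIM('a) \<Longrightarrow> finite (Idx G d)"
  using medium_subdomains by simp

lemma Sub_flat:
  assumes "d \<le> DIM('a)" "i \<in> Idx G d"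
  shows Sub_aff_dim: "aff_dim (Sub G d i) = int d"
    and Sub_openin: "openin (top_of_set (affine hull (Sub G d i))) (Sub G d i)"
    and Sub_bounded: "bounded (Sub G d i)"
    and Sub_borel: "Sub G d i \<in> sets borel"
    and Sub_nonempty: "Sub G d i \<noteq> {}"
    and Sub_in_Omega: "Sub G d i \<subseteq> Omega G"
proof -
  note * = medium_subdomains and bd = medium_bounded
  show dim: "aff_dim (Sub G d i) = int d"
    and op: "openin (top_of_set (affine hull (Sub G d i))) (Sub G d i)"
    using * assms by auto
  show "bounded (Sub G d i)" using * assms bounded_subset[OF bd] by auto
  show "Sub G d i \<in> sets borel" by (rule openin_affine_hull_borel[OF op])
  show "Sub G d i \<noteq> {}" using dim by auto
  show "Sub G d i \<subseteq> Omega G" using assms by (auto simp: Omega_def)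
qed

lemma Sub_disjoint:
  assumes "d \<le> DIM('a)" "d' \<le> DIM('a)" "i \<in> Idx G d" "i' \<in> Idx G d'" "(d, i) \<noteq> (d', i')"
  shows "Sub G d i \<inter> Sub G d' i' = {}"
  using medium_disjoint assms by simp

lemma BdN_disjoint: "BdN G \<inter> Omega G = {}"
  using medium_boundary by blast

text \<open>
  A subdomain has codimension one in an adjacent one of the next dimension, so there are only two unit
  normals. That its tangent space is contained in that of the neighbour is seen by pushing points off
  the subdomain along the normal.
\<close>

lemma finite_interfaces:
  assumes d: "d < DIM('a)" and i: "i \<in> Idx G d"
  shows "finite (interfaces G d i)"
proof -
  let ?N = "\<lambda>k. {\<nu>. (k, \<nu>) \<in> interfaces G d i}"
  have fin: "finite (?N k)" for k
  proof (cases "?N k = {}")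
    case False
    then obtain n where n: "(k, n) \<in> interfaces G d i" by blast
    let ?S = "Sub G d i" and ?K = "Sub G (Suc d) k"
    have k: "k \<in> Idx G (Suc d)" and nK: "n \<in> tangent ?K" and n1: "norm n = 1"
      and orth: "\<And>y. y \<in> tangent ?S \<Longrightarrow> n \<bullet> y = 0" and appr: "\<And>x. x \<in> ?S \<Longrightarrow> approaches ?K n x"
      using n by (auto simp: interfaces_def)
    have "x - y \<in> tangent ?K" if xy: "x \<in> ?S" "y \<in> ?S" for x y
    proof -
      obtain e where e: "e > 0" "\<forall>t. 0 < t \<and> t < e \<longrightarrow> x - t *\<^sub>R n \<in> ?K"
        using appr[OF xy(1)] unfolding approaches_def by blast
      obtain e' where e': "e' > 0" "\<forall>t. 0 < t \<and> t < e' \<longrightarrow> y - t *\<^sub>R n \<in> ?K"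
        using appr[OF xy(2)] unfolding approaches_def by blast
      define t where "t = min e e' / 2"
      have "x - t *\<^sub>R n \<in> ?K" "y - t *\<^sub>R n \<in> ?K" using e e' by (auto simp: t_def)
      then have "(x - t *\<^sub>R n) - (y - t *\<^sub>R n) \<in> tangent ?K"
        by (intro affine_hull_diff_tangent hull_inc)
      then show ?thesis by simp
    qed
    then have SK: "tangent ?S \<subseteq> tangent ?K"
      unfolding tangent_def[of ?S] by (intro span_minimal subspace_tangent) blast
    have nS: "n \<notin> tangent ?S" using orth[of n] n1 by auto
    have sS: "span (tangent ?S) = tangent ?S" by (simp add: span_eq_iff subspace_tangent)
    have dS: "dim (tangent ?S) = d"
      using dim_tangent[OF Sub_nonempty] Sub_aff_dim d i by (metis less_imp_le of_nat_eq_iff)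
    have dK: "dim (tangent ?K) = Suc d"
      using dim_tangent[OF Sub_nonempty] Sub_aff_dim d k by (metis Suc_leI of_nat_eq_iff)
    have "span (insert n (tangent ?S)) = tangent ?K"
    proof (rule subspace_dim_equal)
      show "span (insert n (tangent ?S)) \<subseteq> tangent ?K"
        by (rule span_minimal[OF _ subspace_tangent]) (use SK nK in blast)
      show "dim (tangent ?K) \<le> dim (span (insert n (tangent ?S)))"
        unfolding dim_span dim_insert sS using nS dS dK by simp
    qed (auto simp: subspace_tangent)
    then have split: "\<exists>m. v - m *\<^sub>R n \<in> tangent ?S" if "v \<in> tangent ?K" for v
      using that unfolding span_insert sS by blast
    have "?N k \<subseteq> {n, - n}"
    proof
      fix v assume "v \<in> ?N k"
      then have v: "v \<in> tangent ?K" "norm v = 1" "\<And>y. y \<in> tangent ?S \<Longrightarrow> v \<bullet> y = 0"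
        by (auto simp: interfaces_def)
      obtain m where m: "v - m *\<^sub>R n \<in> tangent ?S" using split[OF v(1)] by blast
      have "(v - m *\<^sub>R n) \<bullet> (v - m *\<^sub>R n) = 0"
        using v(3)[OF m] orth[OF m] by (simp add: inner_diff_left)
      then have "v = m *\<^sub>R n" by simp
      moreover then have "\<bar>m\<bar> = 1" using v(2) n1 by simp
      ultimately show "v \<in> {n, - n}" by (auto simp: abs_if split: if_splits)
    qed
    then show ?thesis by (rule finite_subset) simp
  next
    case True
    then show ?thesis by (simp only: finite.emptyI)
  qed
  have "interfaces G d i \<subseteq> (\<Union>k\<in>Idx G (Suc d). Pair k ` ?N k)"
    by (auto simp: interfaces_def)
  moreover have "finite (\<Union>k\<in>Idx G (Suc d). Pair k ` ?N k)"
    using finite_Idx[of "Suc d"] d fin by simp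
  ultimately show ?thesis by (rule finite_subset)
qed

lemma triangulates_MO: "d \<le> DIM('a) \<Longrightarrow> i \<in> Idx G d \<Longrightarrow> triangulates \<sigma> d (Sub G d i) (MO M d i)"
  using mesh by (simp add: admissible_mesh_def)

lemma triangulates_MG:
  "d < DIM('a) \<Longrightarrow> i \<in> Idx G d \<Longrightarrow> j \<in> interfaces G d i \<Longrightarrow> triangulates \<sigma> d (Sub G d i) (MG M d i j)"
  using mesh by (simp add: admissible_mesh_def)

lemma element_simplex:
  assumes "d \<le> DIM('a)" "T \<in> mesh_elements G M d"
  shows "int d simplex T"
  using assms triangulates_simplex[OF triangulates_MO] by (auto simp: mesh_elements_def)

lemma element_nonempty: "d \<le> DIM('a) \<Longrightarrow> T \<in> mesh_elements G M d \<Longrightarrow> T \<noteq> {}"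
  using element_simplex[of d T] by fastforce

lemma finite_elements: "d \<le> DIM('a) \<Longrightarrow> finite (mesh_elements G M d)"
  unfolding mesh_elements_def
  by (auto intro!: finite_Idx intro: triangulates_finite[OF triangulates_MO])

lemma element_facet:
  assumes "d \<le> DIM('a)" "T \<in> mesh_elements G M d" "f facet_of T"
  shows "\<exists>u. simplex_facet T f u"
  using facet_of_simplex[OF element_simplex] assms by blast

lemma finite_facets:
  assumes "d \<le> DIM('a)" "T \<in> mesh_elements G M d"
  shows "finite {f. f facet_of T}"
  using element_simplex[OF assms] by (intro finite_polytope_facets simplex_imp_polytope)

lemma subspace_direct_sum:
  assumes "\<And>d. d \<in> D \<Longrightarrow> subspace (V d)"
  shows "subspace (direct_sum D V)"
  using assms unfolding direct_sum_def subspace_def by simp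

lemma Vh_rt0: "v \<in> Vh G M d \<Longrightarrow> T \<in> mesh_elements G M d \<Longrightarrow> v T \<in> rt0 T"
  by (simp add: Vh_def)

lemma flux_add:
  assumes "d \<le> DIM('a)" "T \<in> mesh_elements G M d" "f facet_of T" "v \<in> rt0 T" "w \<in> rt0 T"
  shows "flux T f (v + w) = flux T f v + flux T f w"
  using element_facet[OF assms(1-3)] linear_on_add[OF linear_flux assms(4,5)] by blast

lemma flux_scale:
  assumes "d \<le> DIM('a)" "T \<in> mesh_elements G M d" "f facet_of T" "v \<in> rt0 T"
  shows "flux T f (c *\<^sub>R v) = c * flux T f v"
  using element_facet[OF assms(1-3)] linear_on_scale[OF linear_flux assms(4)] by fastforce

lemma flux_0:
  assumes "d \<le> DIM('a)" "T \<in> mesh_elements G M d" "f facet_of T"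
  shows "flux T f 0 = 0"
  using flux_scale[OF assms, of 0 0] subspace_0[OF subspace_rt0[OF element_nonempty[OF assms(1,2)]]] by simp

text \<open>
  Raviart-Thomas fields without any coupling between elements. All further conditions on discrete fluxes
  are equations between facet fluxes.
\<close>

definition rt_fields :: "nat \<Rightarrow> ('a set \<Rightarrow> 'a \<Rightarrow> 'a) set"
  where "rt_fields d = {v. (\<forall>T. T \<notin> mesh_elements G M d \<longrightarrow> v T = 0) \<and> (\<forall>T\<in>mesh_elements G M d. v T \<in> rt0 T)}"

lemma subspace_rt_fields: "d \<le> DIM('a) \<Longrightarrow> subspace (rt_fields d)"
  using subspace_rt0[OF element_nonempty] by (simp add: subspace_def rt_fields_def)

lemma linear_rt_flux:
  assumes "d \<le> DIM('a)" "T \<in> mesh_elements G M d" "f facet_of T"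
  shows "linear_on (rt_fields d) (\<lambda>v. flux T f (v T))"
  using assms(2) by (intro linear_onI) (simp_all add: flux_add[OF assms] flux_scale[OF assms] rt_fields_def)

lemma subspace_Vh:
  assumes d: "d \<le> DIM('a)"
  shows "subspace (Vh G M d)"
proof -
  define I where "I = {(T, T', f). \<exists>i\<in>Idx G d. T \<in> MO M d i \<and> T' \<in> MO M d i \<and> T \<noteq> T' \<and>
      f facet_of T \<and> f facet_of T' \<and> rel_interior f \<subseteq> Sub G d i}"
  define J where "J = {(T, f). T \<in> mesh_elements G M d \<and> f facet_of T \<and> rel_interior f \<subseteq> BdN G}"
  define \<phi> where "\<phi> = (\<lambda>(T, T', f) (v :: 'a set \<Rightarrow> 'a \<Rightarrow> 'a). flux T f (v T) + flux T' f (v T'))"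
  define \<psi> where "\<psi> = (\<lambda>(T, f) (v :: 'a set \<Rightarrow> 'a \<Rightarrow> 'a). flux T f (v T))"
  have plus: "linear_on V (\<lambda>v. g v + h v)" if "linear_on V g" "linear_on V h"
    for V and g h :: "('a set \<Rightarrow> 'a \<Rightarrow> 'a) \<Rightarrow> real"
    using that by (simp add: linear_on_def distrib_left)
  have "linear_on (rt_fields d) \<xi>" if "\<xi> \<in> \<phi> ` I \<union> \<psi> ` J" for \<xi>
    using that linear_rt_flux[OF d] by (auto simp: \<phi>_def \<psi>_def I_def J_def mesh_elements_def intro!: plus)
  from subspace_common_kernel[OF subspace_rt_fields[OF d] this]
  have "subspace {v \<in> rt_fields d. \<forall>\<xi>\<in>\<phi> ` I \<union> \<psi> ` J. \<xi> v = 0}" .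
  also have "{v \<in> rt_fields d. \<forall>\<xi>\<in>\<phi> ` I \<union> \<psi> ` J. \<xi> v = 0} = Vh G M d"
  proof -
    have "(\<forall>\<xi>\<in>\<phi> ` I \<union> \<psi> ` J. \<xi> v = 0) \<longleftrightarrow>
      (\<forall>T T' f. (T, T', f) \<in> I \<longrightarrow> flux T f (v T) + flux T' f (v T') = 0) \<and>
      (\<forall>T f. (T, f) \<in> J \<longrightarrow> flux T f (v T) = 0)" for v
      by (auto simp: \<phi>_def \<psi>_def ball_Un split_paired_Ball_Sigma)
    moreover have "(\<forall>T T' f. (T, T', f) \<in> I \<longrightarrow> P T T' f) \<longleftrightarrow> (\<forall>i\<in>Idx G d. \<forall>T\<in>MO M d i. \<forall>T'\<in>MO M d i. \<forall>f.
        T \<noteq> T' \<and> f facet_of T \<and> f facet_of T' \<and> rel_interior f \<subseteq> Sub G d i \<longrightarrow> P T T' f)" for P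
      unfolding I_def by blast
    moreover have "(\<forall>T f. (T, f) \<in> J \<longrightarrow> P T f) \<longleftrightarrow>
        (\<forall>T\<in>mesh_elements G M d. \<forall>f. f facet_of T \<and> rel_interior f \<subseteq> BdN G \<longrightarrow> P T f)" for P
      unfolding J_def by blast
    ultimately show ?thesis unfolding Vh_def rt_fields_def by (simp only: mem_Collect_eq conj_assoc)
  qed
  finally show ?thesis .
qed

lemma linear_Vh_flux:
  assumes "d \<le> DIM('a)" "T \<in> mesh_elements G M d" "f facet_of T"
  shows "linear_on (Vh G M d) (\<lambda>v. flux T f (v T))"
  by (rule linear_on_subset[OF linear_rt_flux[OF assms]]) (auto simp: Vh_def rt_fields_def)

lemma Vh_eqI:
  assumes d: "1 \<le> d" "d \<le> DIM('a)" and v: "v \<in> Vh G M d" "w \<in> Vh G M d"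
    and eq: "\<And>T f. T \<in> mesh_elements G M d \<Longrightarrow> f facet_of T \<Longrightarrow> flux T f (v T) = flux T f (w T)"
  shows "v = w"
proof
  fix T
  show "v T = w T"
  proof (cases "T \<in> mesh_elements G M d")
    case True
    show ?thesis
      by (rule rt0_eqI[OF element_simplex[OF d(2) True] d(1) Vh_rt0[OF v(1) True] Vh_rt0[OF v(2) True]])
        (rule eq[OF True])
  qed (use v in \<open>simp add: Vh_def\<close>)
qed

text \<open>The facet fluxes are finitely many functionals that separate the fields.\<close>

lemma finite_dimensional_Vh:
  assumes d: "1 \<le> d" "d \<le> DIM('a)"
  shows "finite_dimensional (Vh G M d)"
proof (rule finite_dimensional_separated)
  let ?I = "SIGMA T:mesh_elements G M d. {f. f facet_of T}"
  let ?\<Phi> = "(\<lambda>(T, f) v. flux T f (v T)) ` ?I"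
  show "finite ?\<Phi>" by (intro finite_imageI finite_SigmaI finite_elements[OF d(2)] finite_facets[OF d(2)])
  show "subspace (Vh G M d)" by (rule subspace_Vh[OF d(2)])
  show "linear_on (Vh G M d) \<phi>" if "\<phi> \<in> ?\<Phi>" for \<phi>
    using that linear_Vh_flux[OF d(2)] by auto
  fix v assume v: "v \<in> Vh G M d" and z: "\<And>\<phi>. \<phi> \<in> ?\<Phi> \<Longrightarrow> \<phi> v = 0"
  show "v = 0"
  proof (rule Vh_eqI[OF d v subspace_0[OF subspace_Vh[OF d(2)]]])
    fix T f assume *: "T \<in> mesh_elements G M d" "f facet_of T"
    then have "(\<lambda>v. flux T f (v T)) \<in> ?\<Phi>" by (intro image_eqI[of _ _ "(T, f)"]) auto
    from z[OF this] show "flux T f (v T) = flux T f (0 T)" using flux_0[OF d(2) *] by simp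
  qed
qed

lemma iface_facetsD:
  assumes "d < DIM('a)" "(T, f) \<in> iface_facets G M d i j"
  shows "i \<in> Idx G d" "j \<in> interfaces G d i" "fst j \<in> Idx G (Suc d)" "T \<in> MO M (Suc d) (fst j)"
    "T \<in> mesh_elements G M (Suc d)" "f facet_of T" "rel_interior f \<subseteq> Sub G d i"
    "outer_normal T f = snd j" "openin (top_of_set (affine hull (Sub G d i))) (rel_interior f)"
    "rel_interior f \<noteq> {}"
proof -
  show 1: "i \<in> Idx G d" "j \<in> interfaces G d i" "T \<in> MO M (Suc d) (fst j)" "f facet_of T"
    "rel_interior f \<subseteq> Sub G d i" "outer_normal T f = snd j"
    using assms(2) by (auto simp: iface_facets_def)
  show k: "fst j \<in> Idx G (Suc d)" using 1(2) by (auto simp: interfaces_def)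
  show T: "T \<in> mesh_elements G M (Suc d)" using k 1(3) by (auto simp: mesh_elements_def)
  have "int (Suc d) simplex T" by (rule element_simplex[OF _ T]) (use assms(1) in simp)
  then have T': "aff_dim T = int (Suc d)" "convex T" by (auto intro: aff_dim_simplex convex_simplex)
  have f: "f \<noteq> {}" "convex f" "aff_dim f = int d" using 1(4) T' by (auto simp: facet_of_def face_of_imp_convex)
  have "aff_dim f = aff_dim (Sub G d i)" using f(3) Sub_aff_dim[of d i] assms(1) 1(1) by simp
  from convex_piece[OF f(2) this f(1) 1(5)]
  show "openin (top_of_set (affine hull (Sub G d i))) (rel_interior f)" "rel_interior f \<noteq> {}" by auto
qed

lemma finite_iface_facets:
  assumes d: "d < DIM('a)"
  shows "finite (iface_facets G M d i j)"
proof (rule finite_subset)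
  show "iface_facets G M d i j \<subseteq> (SIGMA T:mesh_elements G M (Suc d). {f. f facet_of T})"
  proof
    fix p assume "p \<in> iface_facets G M d i j"
    then have "(fst p, snd p) \<in> iface_facets G M d i j" by simp
    from iface_facetsD(5,6)[OF d this]
    show "p \<in> (SIGMA T:mesh_elements G M (Suc d). {f. f facet_of T})" by (cases p) simp
  qed
  show "finite (SIGMA T:mesh_elements G M (Suc d). {f. f facet_of T})"
    using d by (intro finite_SigmaI finite_elements finite_facets) auto
qed

text \<open>
  The interface fixes the outer normal, so two of its facets cannot come from opposite sides.
\<close>

lemma iface_facets_disjoint:
  assumes d: "d < DIM('a)" and T: "(T, f) \<in> iface_facets G M d i j" "(T', f') \<in> iface_facets G M d i j"
    and x: "x \<in> rel_interior f" "x \<in> rel_interior f'"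
  shows "(T, f) = (T', f')"
proof -
  note D = iface_facetsD[OF d T(1)] and D' = iface_facetsD[OF d T(2)]
  have "T = T' \<and> f = f'"
    by (rule facets_with_same_normal[OF triangulates_MO[of "Suc d" "fst j"] Sub_aff_dim D(4) D'(4) D(6) D'(6) _ x])
      (use d D D' in auto)
  then show ?thesis by simp
qed

text \<open>
  The class of functions on interfaces on which the inner product is bilinear; it contains mortars and
  normal traces.
\<close>

definition interface_function :: "nat \<Rightarrow> (nat \<Rightarrow> nat \<times> 'a \<Rightarrow> 'a \<Rightarrow> real) \<Rightarrow> bool"
  where "interface_function d \<xi> \<longleftrightarrow>
    (\<forall>i\<in>Idx G d. \<forall>j\<in>interfaces G d i. bounded_measurable (Sub G d i) (\<xi> i j))"

lemma bounded_measurable_piecewise: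
  assumes "triangulates \<sigma> d S \<T>" "aff_dim S = int d"
  shows "bounded_measurable S' (piecewise \<T> (\<lambda>T _. c T))"
  unfolding piecewise_def[abs_def] real_scaleR_def
  by (intro bounded_measurable_sum bounded_measurable_mult bounded_measurable_indicator
      bounded_measurable_const openin_affine_hull_borel[OF triangulates_element(8)[OF assms]])

lemma interface_function_mortar:
  assumes "d < DIM('a)"
  shows "interface_function d (mortar M d \<mu>)"
  unfolding interface_function_def mortar_def
  using assms by (auto intro!: bounded_measurable_piecewise[OF triangulates_MG] Sub_aff_dim)

lemma interface_function_normal_trace:
  assumes d: "d < DIM('a)"
  shows "interface_function d (normal_trace G M d v)"
  unfolding interface_function_def normal_trace_def[abs_def] case_prod_beta
proof (intro ballI bounded_measurable_sum bounded_measurable_mult bounded_measurable_indicator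
    bounded_measurable_const)
  fix i j p assume "p \<in> iface_facets G M d i j"
  then have "(fst p, snd p) \<in> iface_facets G M d i j" by simp
  from openin_affine_hull_borel[OF iface_facetsD(9)[OF d this]]
  show "rel_interior (snd p) \<in> sets borel" .
qed

lemma interface_integrable:
  assumes "d < DIM('a)" "interface_function d \<xi>" "interface_function d \<eta>" "i \<in> Idx G d" "j \<in> interfaces G d i"
  shows "set_integrable (flat_measure (Sub G d i)) (Sub G d i) (\<lambda>x. \<xi> i j x * \<eta> i j x)"
  using assms
  by (intro bounded_measurable_integrable bounded_measurable_mult Sub_bounded Sub_borel)
    (auto simp: interface_function_def)

lemma ip_Gamma_commute: "ip_Gamma G d \<xi> \<eta> = ip_Gamma G d \<eta> \<xi>"
  by (simp add: ip_Gamma_def mult.commute)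

lemma ip_Gamma_add_right:
  assumes d: "d < DIM('a)" and f: "interface_function d \<xi>" "interface_function d \<eta>" "interface_function d \<zeta>"
  shows "ip_Gamma G d \<xi> (\<eta> + \<zeta>) = ip_Gamma G d \<xi> \<eta> + ip_Gamma G d \<xi> \<zeta>"
  unfolding ip_Gamma_def sum.distrib[symmetric]
proof (intro sum.cong refl)
  fix i j assume "i \<in> Idx G d" "j \<in> interfaces G d i"
  note int = interface_integrable[OF d _ _ this]
  show "(LINT x:Sub G d i|flat_measure (Sub G d i). \<xi> i j x * (\<eta> + \<zeta>) i j x) =
      (LINT x:Sub G d i|flat_measure (Sub G d i). \<xi> i j x * \<eta> i j x) +
      (LINT x:Sub G d i|flat_measure (Sub G d i). \<xi> i j x * \<zeta> i j x)"
    using set_integral_add(2)[OF int[OF f(1,2)] int[OF f(1,3)]] by (simp add: distrib_left)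
qed

lemma ip_Gamma_scale_right: "ip_Gamma G d \<xi> (c *\<^sub>R \<eta>) = c * ip_Gamma G d \<xi> \<eta>"
proof -
  have "(LINT x:Sub G d i|flat_measure (Sub G d i). \<xi> i j x * (c *\<^sub>R \<eta>) i j x) =
      c * (LINT x:Sub G d i|flat_measure (Sub G d i). \<xi> i j x * \<eta> i j x)" for i j
    by (simp add: mult.left_commute)
  then show ?thesis by (simp add: ip_Gamma_def sum_distrib_left)
qed

lemma ip_Gamma_diff_left:
  assumes d: "d < DIM('a)" and f: "interface_function d \<xi>" "interface_function d \<eta>" "interface_function d \<zeta>"
  shows "ip_Gamma G d (\<xi> - \<eta>) \<zeta> = ip_Gamma G d \<xi> \<zeta> - ip_Gamma G d \<eta> \<zeta>"
proof -
  have m: "interface_function d (- \<eta>)"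
    using f(2) by (auto simp: interface_function_def fun_Compl_def intro: bounded_measurable_minus)
  have "ip_Gamma G d \<zeta> (- \<eta>) = - ip_Gamma G d \<zeta> \<eta>"
    using ip_Gamma_scale_right[of d \<zeta> "-1" \<eta>] by simp
  then show ?thesis
    using ip_Gamma_add_right[OF d f(3,1) m] by (simp add: ip_Gamma_commute[of d \<zeta>])
qed

lemma ip_Gamma_nonneg: "0 \<le> ip_Gamma G d \<xi> \<xi>"
  unfolding ip_Gamma_def set_lebesgue_integral_def
  by (intro sum_nonneg integral_nonneg_AE) auto

lemma ip_Gamma_self_zero:
  assumes d: "d < DIM('a)" and z: "ip_Gamma G d \<xi> \<xi> = 0" and ij: "i \<in> Idx G d" "j \<in> interfaces G d i"
  shows "(LINT x:Sub G d i|flat_measure (Sub G d i). \<xi> i j x * \<xi> i j x) = 0"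
proof -
  have pos: "0 \<le> (LINT x:Sub G d i|flat_measure (Sub G d i). \<xi> i j x * \<xi> i j x)" for i j
    unfolding set_lebesgue_integral_def by (intro integral_nonneg_AE) auto
  have "(\<Sum>j\<in>interfaces G d i. LINT x:Sub G d i|flat_measure (Sub G d i). \<xi> i j x * \<xi> i j x) = 0"
    using z ij(1) finite_Idx[of d] d unfolding ip_Gamma_def
    by (subst (asm) sum_nonneg_eq_0_iff) (auto intro: sum_nonneg pos)
  then show ?thesis
    using ij finite_interfaces[OF d ij(1)] by (subst (asm) sum_nonneg_eq_0_iff) (auto intro: pos)
qed

lemma linear_mortar: "linear_on UNIV (mortar M d)"
  by (rule linear_onI)
    (simp_all add: mortar_def[abs_def] piecewise_def[abs_def] fun_eq_iff algebra_simps
      sum.distrib sum_distrib_left)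

lemma linear_normal_trace:
  assumes d: "d < DIM('a)"
  shows "linear_on (Vh G M (Suc d)) (normal_trace G M d)"
proof -
  have *: "T \<in> mesh_elements G M (Suc d)" "f facet_of T" if "(T, f) \<in> iface_facets G M d i j" for T f i j
    using iface_facetsD(5,6)[OF d that] by auto
  have d': "Suc d \<le> DIM('a)" using d by simp
  note l = linear_Vh_flux[OF d']
  show ?thesis
  proof (rule linear_onI)
    fix v w assume vw: "v \<in> Vh G M (Suc d)" "w \<in> Vh G M (Suc d)"
    have "flux T f ((v + w) T) = flux T f (v T) + flux T f (w T)" if "(T, f) \<in> iface_facets G M d i j" for T f i j
      using linear_on_add[OF l[OF *[OF that]] vw] by simp
    then show "normal_trace G M d (v + w) = normal_trace G M d v + normal_trace G M d w"
      unfolding fun_eq_iff normal_trace_def plus_fun_apply sum.distrib[symmetric]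
      by (intro allI sum.cong refl) (auto simp: distrib_left)
  next
    fix c v assume v: "v \<in> Vh G M (Suc d)"
    have "flux T f ((c *\<^sub>R v) T) = c * flux T f (v T)" if "(T, f) \<in> iface_facets G M d i j" for T f i j
      using linear_on_scale[OF l[OF *[OF that]] v] by simp
    then show "normal_trace G M d (c *\<^sub>R v) = c *\<^sub>R normal_trace G M d v"
      unfolding fun_eq_iff normal_trace_def scaleR_fun_apply scaleR_sum_right
      by (intro allI sum.cong refl) auto
  qed
qed

text \<open>The normal trace is piecewise constant on disjoint facets of positive measure.\<close>

lemma flux_zero_if_trace_zero:
  assumes d: "d < DIM('a)" and z: "ip_Gamma G d (normal_trace G M d v) (normal_trace G M d v) = 0"
    and Tf: "(T, f) \<in> iface_facets G M d i j"
  shows "flux T f (v T) = 0"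
proof (rule ccontr)
  assume n: "flux T f (v T) \<noteq> 0"
  note D = iface_facetsD[OF d]
  have i: "i \<in> Idx G d" "j \<in> interfaces G d i" using D[OF Tf] by auto
  let ?S = "Sub G d i" and ?I = "iface_facets G M d i j"
  let ?E = "\<lambda>p. rel_interior (snd p)" and ?c = "\<lambda>p. flux (fst p) (snd p) (v (fst p))"
  have "(LINT x:?S|flat_measure ?S. (\<Sum>p\<in>?I. indicator (?E p) x * ?c p) * (\<Sum>p\<in>?I. indicator (?E p) x * ?c p)) > 0"
  proof (rule indicator_sum_square_pos[where i = "(T, f)"])
    show "finite ?I" by (rule finite_iface_facets[OF d])
    show "bounded ?S" "?S \<in> sets borel" using Sub_bounded Sub_borel i d by auto
    fix p assume p: "p \<in> ?I"
    then have p': "(fst p, snd p) \<in> ?I" by simp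
    show "?E p \<subseteq> ?S" "openin (top_of_set (affine hull ?S)) (?E p)" "?E p \<noteq> {}" using D[OF p'] by auto
    show "p = q" if "q \<in> ?I" "x \<in> ?E p" "x \<in> ?E q" for q x
      using iface_facets_disjoint[OF d p', of "fst q" "snd q"] that by simp
  qed (use Tf n in auto)
  then show False
    using ip_Gamma_self_zero[OF d z i] by (simp add: normal_trace_def case_prod_beta)
qed

lemma normal_trace_cong:
  assumes "d < DIM('a)" "\<And>T f i j. (T, f) \<in> iface_facets G M d i j \<Longrightarrow> flux T f (v T) = flux T f (w T)"
  shows "normal_trace G M d v = normal_trace G M d w"
  unfolding fun_eq_iff normal_trace_def using assms(2) by (intro allI sum.cong refl) auto

context
  fixes d assumes d: "d < DIM('a)"
begin

abbreviation "traces \<equiv> normal_trace G M d ` Vh G M (Suc d)"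

lemma Suc_d: "1 \<le> Suc d" "Suc d \<le> DIM('a)"
  using d by auto

lemma traces: "subspace traces" "finite_dimensional traces"
  using finite_dimensional_image[OF finite_dimensional_Vh[OF Suc_d] linear_normal_trace[OF d] subspace_Vh[OF Suc_d(2)]]
  by auto

lemma interface_function_traces: "\<xi> \<in> traces \<Longrightarrow> interface_function d \<xi>"
  using interface_function_normal_trace[OF d] by blast

lemma traces_zero:
  assumes "\<xi> \<in> traces" "ip_Gamma G d \<xi> \<xi> = 0"
  shows "\<xi> = 0"
proof -
  obtain v where v: "v \<in> Vh G M (Suc d)" "\<xi> = normal_trace G M d v" using assms(1) by blast
  have "normal_trace G M d v = normal_trace G M d 0"
  proof (rule normal_trace_cong[OF d])
    fix T f i j assume Tf: "(T, f) \<in> iface_facets G M d i j"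
    then have "flux T f (v T) = 0" using flux_zero_if_trace_zero[OF d _ Tf] assms(2) v(2) by simp
    moreover have "flux T f (0 T) = 0" using flux_0[OF Suc_d(2)] iface_facetsD(5,6)[OF d Tf] by simp
    ultimately show "flux T f (v T) = flux T f (0 T)" by simp
  qed
  also have "\<dots> = 0" using linear_on_zero[OF linear_normal_trace[OF d] subspace_Vh[OF Suc_d(2)]] .
  finally show ?thesis using v(2) by simp
qed

lemma positive_traces: "positive_form traces (ip_Gamma G d)"
  unfolding positive_form_def symmetric_form_def
proof (intro conjI ballI impI linear_onI)
  show "ip_Gamma G d \<xi> \<eta> = ip_Gamma G d \<eta> \<xi>" for \<xi> \<eta> by (rule ip_Gamma_commute)
  show "ip_Gamma G d \<xi> (\<eta> + \<zeta>) = ip_Gamma G d \<xi> \<eta> + ip_Gamma G d \<xi> \<zeta>"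
    if "\<xi> \<in> traces" "\<eta> \<in> traces" "\<zeta> \<in> traces" for \<xi> \<eta> \<zeta>
    by (intro ip_Gamma_add_right d interface_function_traces that)
  show "ip_Gamma G d \<xi> (c *\<^sub>R \<eta>) = c *\<^sub>R ip_Gamma G d \<xi> \<eta>" for \<xi> \<eta> c by (simp add: ip_Gamma_scale_right)
  show "0 < ip_Gamma G d \<xi> \<xi>" if "\<xi> \<in> traces" "\<xi> \<noteq> 0" for \<xi>
    using traces_zero[OF that(1)] ip_Gamma_nonneg[of d \<xi>] that(2) by force
qed

text \<open>
  Normal traces form a finite-dimensional inner product space, so Riesz representation provides the
  projection. Uniqueness holds for the functions themselves and not only almost everywhere, because a
  trace of norm zero has vanishing fluxes.
\<close>

lemma proj_trace:
  shows proj_trace_in: "proj_trace G M d \<mu> \<in> traces"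
    and proj_trace_orth: "\<eta> \<in> traces \<Longrightarrow> ip_Gamma G d (proj_trace G M d \<mu>) \<eta> = ip_Gamma G d (mortar M d \<mu>) \<eta>"
    and proj_trace_unique: "\<xi> \<in> traces \<Longrightarrow>
      (\<And>\<eta>. \<eta> \<in> traces \<Longrightarrow> ip_Gamma G d \<xi> \<eta> = ip_Gamma G d (mortar M d \<mu>) \<eta>) \<Longrightarrow> \<xi> = proj_trace G M d \<mu>"
proof -
  note m = interface_function_mortar[OF d]
  have eq: "(\<forall>v\<in>Vh G M (Suc d). ip_Gamma G d (\<xi> - mortar M d \<mu>) (normal_trace G M d v) = 0) \<longleftrightarrow>
      (\<forall>\<eta>\<in>traces. ip_Gamma G d \<xi> \<eta> = ip_Gamma G d (mortar M d \<mu>) \<eta>)" if "\<xi> \<in> traces" for \<xi>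
    using ip_Gamma_diff_left[OF d interface_function_traces[OF that] m interface_function_normal_trace[OF d]]
    by auto
  let ?P = "\<lambda>\<xi>. \<xi> \<in> traces \<and> (\<forall>\<eta>\<in>traces. ip_Gamma G d \<xi> \<eta> = ip_Gamma G d (mortar M d \<mu>) \<eta>)"
  have "linear_on traces (ip_Gamma G d (mortar M d \<mu>))"
    by (rule linear_onI)
      (auto simp: ip_Gamma_scale_right ip_Gamma_add_right[OF d m interface_function_traces interface_function_traces])
  from riesz_finite_dimensional[OF positive_traces traces(2) this] have ex: "\<exists>\<xi>. ?P \<xi>" by blast
  have uniq: "\<xi> = \<xi>'" if P: "?P \<xi>" "?P \<xi>'" for \<xi> \<xi>'
  proof -
    have d0: "\<xi> - \<xi>' \<in> traces" using P traces(1) by (simp add: subspace_diff)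
    have "ip_Gamma G d (\<xi> - \<xi>') (\<xi> - \<xi>') = ip_Gamma G d \<xi> (\<xi> - \<xi>') - ip_Gamma G d \<xi>' (\<xi> - \<xi>')"
      using P d0 by (intro ip_Gamma_diff_left d interface_function_traces) auto
    also have "ip_Gamma G d \<xi> (\<xi> - \<xi>') = ip_Gamma G d (mortar M d \<mu>) (\<xi> - \<xi>')"
      by (rule bspec[OF conjunct2[OF P(1)] d0])
    also have "ip_Gamma G d \<xi>' (\<xi> - \<xi>') = ip_Gamma G d (mortar M d \<mu>) (\<xi> - \<xi>')"
      by (rule bspec[OF conjunct2[OF P(2)] d0])
    finally have "ip_Gamma G d (\<xi> - \<xi>') (\<xi> - \<xi>') = 0" unfolding diff_self .
    from traces_zero[OF d0 this] show ?thesis by (rule iffD1[OF right_minus_eq])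
  qed
  \<comment> \<open>The definition tests with fields, \<open>?P\<close> with their traces.\<close>
  have "proj_trace G M d \<mu> = (THE \<xi>. ?P \<xi>)"
    unfolding proj_trace_def using eq by (intro arg_cong[where f = The]) (auto simp: fun_eq_iff)
  moreover have "?P (THE \<xi>. ?P \<xi>)" by (rule theI'[OF ex_ex1I[OF ex uniq]])
  ultimately have P: "?P (proj_trace G M d \<mu>)" by simp
  then show "proj_trace G M d \<mu> \<in> traces"
    "\<eta> \<in> traces \<Longrightarrow> ip_Gamma G d (proj_trace G M d \<mu>) \<eta> = ip_Gamma G d (mortar M d \<mu>) \<eta>" by auto
  show "\<xi> = proj_trace G M d \<mu>" if "\<xi> \<in> traces"
    "\<And>\<eta>. \<eta> \<in> traces \<Longrightarrow> ip_Gamma G d \<xi> \<eta> = ip_Gamma G d (mortar M d \<mu>) \<eta>"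
    using uniq[OF _ P] that by blast
qed

lemma linear_proj_trace: "linear_on UNIV (proj_trace G M d)"
proof (rule linear_onI)
  note m = interface_function_mortar[OF d]
  fix \<mu> \<mu>' :: "nat \<Rightarrow> nat \<times> 'a \<Rightarrow> 'a set \<Rightarrow> real"
  show "proj_trace G M d (\<mu> + \<mu>') = proj_trace G M d \<mu> + proj_trace G M d \<mu>'"
  proof (rule proj_trace_unique[symmetric])
    show "proj_trace G M d \<mu> + proj_trace G M d \<mu>' \<in> traces"
      by (intro subspace_add traces proj_trace_in)
    fix \<eta> assume \<eta>: "\<eta> \<in> traces"
    note add = ip_Gamma_add_right[OF d interface_function_traces[OF \<eta>], unfolded ip_Gamma_commute[of d \<eta>]]
    show "ip_Gamma G d (proj_trace G M d \<mu> + proj_trace G M d \<mu>') \<eta> = ip_Gamma G d (mortar M d (\<mu> + \<mu>')) \<eta>"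
      using linear_on_add[OF linear_mortar, of \<mu> \<mu>' d]
      by (simp add: add m interface_function_traces proj_trace_in proj_trace_orth[OF \<eta>])
  qed
next
  fix c and \<mu> :: "nat \<Rightarrow> nat \<times> 'a \<Rightarrow> 'a set \<Rightarrow> real"
  show "proj_trace G M d (c *\<^sub>R \<mu>) = c *\<^sub>R proj_trace G M d \<mu>"
  proof (rule proj_trace_unique[symmetric])
    show "c *\<^sub>R proj_trace G M d \<mu> \<in> traces" by (intro subspace_scale traces proj_trace_in)
    fix \<eta> assume \<eta>: "\<eta> \<in> traces"
    note scale = ip_Gamma_scale_right[of d \<eta>, unfolded ip_Gamma_commute[of d \<eta>]]
    show "ip_Gamma G d (c *\<^sub>R proj_trace G M d \<mu>) \<eta> = ip_Gamma G d (mortar M d (c *\<^sub>R \<mu>)) \<eta>"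
      using linear_on_scale[OF linear_mortar, of \<mu> d c] by (simp add: scale proj_trace_orth[OF \<eta>])
  qed
qed

lemma on_Gamma_facet:
  assumes "on_Gamma G M d T f"
  shows "T \<in> mesh_elements G M (Suc d)" "f facet_of T" "\<exists>i\<in>Idx G d. rel_interior f \<subseteq> Sub G d i"
    "rel_interior f \<noteq> {}"
proof -
  obtain i j where ij: "(T, f) \<in> iface_facets G M d i j" using assms unfolding on_Gamma_def by blast
  note D = iface_facetsD[OF d ij]
  show "T \<in> mesh_elements G M (Suc d)" "f facet_of T" "rel_interior f \<noteq> {}" by (rule D)+
  show "\<exists>i\<in>Idx G d. rel_interior f \<subseteq> Sub G d i" using D(1,7) by blast
qed

text \<open>
  A facet on an interface is neither interior to its subdomain nor on the Neumann boundary. Fluxes on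
  interfaces can therefore be prescribed freely within the space.
\<close>

lemma rel_interior_facet_disjoint:
  assumes "on_Gamma G M d T f"
  shows "k \<in> Idx G (Suc d) \<Longrightarrow> \<not> rel_interior f \<subseteq> Sub G (Suc d) k" and "\<not> rel_interior f \<subseteq> BdN G"
proof -
  obtain i where i: "i \<in> Idx G d" "rel_interior f \<subseteq> Sub G d i" and ne: "rel_interior f \<noteq> {}"
    using on_Gamma_facet(3,4)[OF assms] by blast
  show "\<not> rel_interior f \<subseteq> Sub G (Suc d) k" if "k \<in> Idx G (Suc d)"
    using Sub_disjoint[of d "Suc d" i k] i that d ne by auto
  show "\<not> rel_interior f \<subseteq> BdN G" 
  proof
    assume "rel_interior f \<subseteq> BdN G"
    moreover have "rel_interior f \<subseteq> Omega G" using i(2) Sub_in_Omega[OF less_imp_le[OF d] i(1)] by simp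
    ultimately show False using BdN_disjoint ne by blast
  qed
qed

text \<open>
  The extension takes the fluxes on interfaces from any field with the projected trace and sets the
  others to zero; unisolvence turns these numbers into a field.
\<close>

lemma Rh_dim:
  shows Rh_dim_in: "Rh_dim G M d \<mu> \<in> Vh G M (Suc d)"
    and Rh_dim_trace: "normal_trace G M d (Rh_dim G M d \<mu>) = proj_trace G M d \<mu>"
    and Rh_dim_off: "T \<in> mesh_elements G M (Suc d) \<Longrightarrow> f facet_of T \<Longrightarrow> \<not> on_Gamma G M d T f \<Longrightarrow>
      flux T f (Rh_dim G M d \<mu> T) = 0"
    and Rh_dim_unique: "v \<in> Vh G M (Suc d) \<Longrightarrow> normal_trace G M d v = proj_trace G M d \<mu> \<Longrightarrow>
      (\<And>T f. T \<in> mesh_elements G M (Suc d) \<Longrightarrow> f facet_of T \<Longrightarrow> \<not> on_Gamma G M d T f \<Longrightarrow>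
        flux T f (v T) = 0) \<Longrightarrow> v = Rh_dim G M d \<mu>"
proof -
  let ?V = "Vh G M (Suc d)" and ?E = "mesh_elements G M (Suc d)"
  let ?P = "\<lambda>v. v \<in> ?V \<and> normal_trace G M d v = proj_trace G M d \<mu> \<and>
    (\<forall>T\<in>?E. \<forall>f. f facet_of T \<and> \<not> on_Gamma G M d T f \<longrightarrow> flux T f (v T) = 0)"
  have uniq: "v = w" if P: "?P v" "?P w" for v w
  proof (rule Vh_eqI[OF Suc_d])
    show "v \<in> ?V" "w \<in> ?V" using P by auto
    fix T f assume T: "T \<in> ?E" "f facet_of T"
    show "flux T f (v T) = flux T f (w T)"
    proof (cases "on_Gamma G M d T f")
      case True
      then obtain i j where ij: "(T, f) \<in> iface_facets G M d i j" unfolding on_Gamma_def by blast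
      have vw: "v - w \<in> ?V" using P by (simp add: subspace_diff subspace_Vh[OF Suc_d(2)])
      have "normal_trace G M d (v - w) = normal_trace G M d v - normal_trace G M d w"
        by (rule linear_on_diff[OF linear_normal_trace[OF d] subspace_Vh[OF Suc_d(2)]]) (use P in auto)
      then have "normal_trace G M d (v - w) = 0" using P by simp
      then have "ip_Gamma G d (normal_trace G M d (v - w)) (normal_trace G M d (v - w)) = 0"
        by (simp only:) (simp add: ip_Gamma_def)
      then have "flux T f ((v - w) T) = 0" by (rule flux_zero_if_trace_zero[OF d _ ij])
      then show ?thesis
        using linear_on_diff[OF linear_Vh_flux[OF Suc_d(2) T] subspace_Vh[OF Suc_d(2)], of v w] P by simp
    qed (use P T in simp)
  qed
  obtain v0 where v0: "v0 \<in> ?V" "proj_trace G M d \<mu> = normal_trace G M d v0"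
    using proj_trace_in[of \<mu>] by blast
  define g where "g T f = (if on_Gamma G M d T f then flux T f (v0 T) else 0)" for T f
  have "\<exists>v\<in>rt0 T. \<forall>f. f facet_of T \<longrightarrow> flux T f v = g T f" if "T \<in> ?E" for T
    by (rule rt0_exists[OF element_simplex[OF Suc_d(2) that] Suc_d(1)])
  then obtain v1 where v1: "\<And>T. T \<in> ?E \<Longrightarrow> v1 T \<in> rt0 T"
    "\<And>T f. T \<in> ?E \<Longrightarrow> f facet_of T \<Longrightarrow> flux T f (v1 T) = g T f" by metis
  define v where "v T = (if T \<in> ?E then v1 T else 0)" for T
  have el: "T \<in> ?E" if "i \<in> Idx G (Suc d)" "T \<in> MO M (Suc d) i" for i T
    using that by (auto simp: mesh_elements_def)
  have fl: "flux T f (v T) = g T f" if "T \<in> ?E" "f facet_of T" for T f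
    using v1 that by (simp add: v_def)
  have "v \<in> ?V"
    unfolding Vh_def mem_Collect_eq
  proof (intro conjI allI ballI impI)
    show "v T = 0" if "T \<notin> ?E" for T using that by (simp add: v_def)
    show "v T \<in> rt0 T" if "T \<in> ?E" for T using that v1 by (simp add: v_def)
    fix i T T' f assume "i \<in> Idx G (Suc d)" "T \<in> MO M (Suc d) i" "T' \<in> MO M (Suc d) i"
      "T \<noteq> T' \<and> f facet_of T \<and> f facet_of T' \<and> rel_interior f \<subseteq> Sub G (Suc d) i"
    moreover then have "\<not> on_Gamma G M d T f" "\<not> on_Gamma G M d T' f"
      using rel_interior_facet_disjoint(1)[of _ f i] by blast+
    ultimately show "flux T f (v T) + flux T' f (v T') = 0" by (simp add: fl el g_def)
  next
    fix T f assume "T \<in> ?E" "f facet_of T \<and> rel_interior f \<subseteq> BdN G"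
    moreover then have "\<not> on_Gamma G M d T f" using rel_interior_facet_disjoint(2)[of _ f] by blast
    ultimately show "flux T f (v T) = 0" by (simp add: fl g_def)
  qed
  moreover have "normal_trace G M d v = proj_trace G M d \<mu>"
    unfolding v0(2)
  proof (rule normal_trace_cong[OF d])
    fix T f i j assume Tf: "(T, f) \<in> iface_facets G M d i j"
    then have "on_Gamma G M d T f" unfolding on_Gamma_def by blast
    then show "flux T f (v T) = flux T f (v0 T)" using on_Gamma_facet by (simp add: fl g_def)
  qed
  ultimately have ex: "\<exists>v. ?P v" by (intro exI[of _ v]) (simp add: fl g_def)
  have "?P (Rh_dim G M d \<mu>)"
    unfolding Rh_dim_def by (rule theI'[OF ex_ex1I[OF ex uniq]])
  then show "Rh_dim G M d \<mu> \<in> ?V" "normal_trace G M d (Rh_dim G M d \<mu>) = proj_trace G M d \<mu>"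
    "T \<in> ?E \<Longrightarrow> f facet_of T \<Longrightarrow> \<not> on_Gamma G M d T f \<Longrightarrow> flux T f (Rh_dim G M d \<mu> T) = 0"
    "v \<in> ?V \<Longrightarrow> normal_trace G M d v = proj_trace G M d \<mu> \<Longrightarrow>
      (\<And>T f. T \<in> ?E \<Longrightarrow> f facet_of T \<Longrightarrow> \<not> on_Gamma G M d T f \<Longrightarrow> flux T f (v T) = 0) \<Longrightarrow>
      v = Rh_dim G M d \<mu>" for T f v
    using uniq by auto
qed

lemma linear_Rh_dim: "linear_on UNIV (Rh_dim G M d)"
proof (rule linear_onI)
  note V = subspace_Vh[OF Suc_d(2)]
  note lt = linear_normal_trace[OF d] and lf = linear_Vh_flux[OF Suc_d(2)]
  fix \<mu> \<mu>' :: "nat \<Rightarrow> nat \<times> 'a \<Rightarrow> 'a set \<Rightarrow> real"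
  show "Rh_dim G M d (\<mu> + \<mu>') = Rh_dim G M d \<mu> + Rh_dim G M d \<mu>'"
  proof (rule Rh_dim_unique[symmetric])
    show "Rh_dim G M d \<mu> + Rh_dim G M d \<mu>' \<in> Vh G M (Suc d)" by (intro subspace_add V Rh_dim_in)
    show "normal_trace G M d (Rh_dim G M d \<mu> + Rh_dim G M d \<mu>') = proj_trace G M d (\<mu> + \<mu>')"
      by (simp add: linear_on_add[OF lt] linear_on_add[OF linear_proj_trace] Rh_dim_in Rh_dim_trace)
    fix T f assume T: "T \<in> mesh_elements G M (Suc d)" "f facet_of T" "\<not> on_Gamma G M d T f"
    show "flux T f ((Rh_dim G M d \<mu> + Rh_dim G M d \<mu>') T) = 0"
      using linear_on_add[OF lf[OF T(1,2)] Rh_dim_in Rh_dim_in] Rh_dim_off[OF T] by simp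
  qed
next
  note V = subspace_Vh[OF Suc_d(2)]
  note lt = linear_normal_trace[OF d] and lf = linear_Vh_flux[OF Suc_d(2)]
  fix c and \<mu> :: "nat \<Rightarrow> nat \<times> 'a \<Rightarrow> 'a set \<Rightarrow> real"
  show "Rh_dim G M d (c *\<^sub>R \<mu>) = c *\<^sub>R Rh_dim G M d \<mu>"
  proof (rule Rh_dim_unique[symmetric])
    show "c *\<^sub>R Rh_dim G M d \<mu> \<in> Vh G M (Suc d)" by (intro subspace_scale V Rh_dim_in)
    show "normal_trace G M d (c *\<^sub>R Rh_dim G M d \<mu>) = proj_trace G M d (c *\<^sub>R \<mu>)"
      by (simp add: linear_on_scale[OF lt] linear_on_scale[OF linear_proj_trace] Rh_dim_in Rh_dim_trace)
    fix T f assume T: "T \<in> mesh_elements G M (Suc d)" "f facet_of T" "\<not> on_Gamma G M d T f"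
    show "flux T f ((c *\<^sub>R Rh_dim G M d \<mu>) T) = 0"
      using linear_on_scale[OF lf[OF T(1,2)] Rh_dim_in, of c] Rh_dim_off[OF T] by simp
  qed
qed

end

end

section \<open>The forms of the mixed-dimensional problem\<close>

lemma piecewise_add: "piecewise \<T> (\<lambda>T. g T + h T) x = piecewise \<T> g x + piecewise \<T> h x"
  by (simp add: piecewise_def scaleR_add_right sum.distrib)

lemma piecewise_scale: "piecewise \<T> (\<lambda>T. c *\<^sub>R g T) x = c *\<^sub>R piecewise \<T> g x"
  by (simp add: piecewise_def scaleR_sum_right mult.commute)

lemma piecewise_cong: "(\<And>T. T \<in> \<T> \<Longrightarrow> g T x = h T x) \<Longrightarrow> piecewise \<T> g x = piecewise \<T> h x"
  by (simp add: piecewise_def)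

lemma symmetric_form_sum:
  assumes "\<And>i. i \<in> I \<Longrightarrow> symmetric_form V (g i)"
  shows "symmetric_form V (\<lambda>x y. \<Sum>i\<in>I. g i x y)"
  using assms unfolding symmetric_form_def linear_on_def
  by (simp add: sum.distrib sum_distrib_left cong: sum.cong)

lemma linear_on_sum_fun:
  assumes "\<And>i. i \<in> I \<Longrightarrow> linear_on V (g i :: _ \<Rightarrow> real)"
  shows "linear_on V (\<lambda>x. \<Sum>i\<in>I. g i x)"
  using assms unfolding linear_on_def by (simp add: sum.distrib sum_distrib_left cong: sum.cong)

text \<open>
  The inverse is only meaningful on \<open>S\<close>. A linear map on the whole space that agrees with it there makes
  continuity and linearity available.
\<close>

lemma spd_tensor_inverse:
  fixes K :: "'a::euclidean_space \<Rightarrow> 'a"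
  assumes K: "spd_tensor S K" and S: "subspace S"
  shows "\<exists>L. linear L \<and> (\<forall>x\<in>S. inv_into S K x = L x \<and> L x \<in> S) \<and>
    (\<forall>x\<in>S. \<forall>y\<in>S. L x \<bullet> y = L y \<bullet> x) \<and> (\<forall>x\<in>S. x \<noteq> 0 \<longrightarrow> L x \<bullet> x > 0)"
proof -
  have lin: "linear K" and KS: "K ` S \<subseteq> S" and sym: "\<And>x y. x \<in> S \<Longrightarrow> y \<in> S \<Longrightarrow> K x \<bullet> y = x \<bullet> K y"
    and pos: "\<And>x. x \<in> S \<Longrightarrow> x \<noteq> 0 \<Longrightarrow> K x \<bullet> x > 0"
    using K by (auto simp: spd_tensor_def)
  have inj: "inj_on K S"
    unfolding linear_injective_on_subspace_0[OF lin S]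
    using pos by force
  have surj: "K ` S = S"
  proof (rule subspace_dim_equal)
    show "subspace (K ` S)" by (rule linear_subspace_image[OF lin S])
    have "span S = S" using S by (simp add: span_eq_iff)
    then have "dim (K ` S) = dim S" by (intro dim_image_eq[OF lin]) (simp only: inj)
    then show "dim S \<le> dim (K ` S)" by simp
  qed (use KS S in auto)
  obtain L where L: "L ` UNIV \<subseteq> S" "linear L" "\<And>v. v \<in> S \<Longrightarrow> L (K v) = v"
    using linear_exists_left_inverse_on[OF lin S inj] by blast
  have pre: "\<exists>v\<in>S. x = K v" if "x \<in> S" for x using surj that by blast
  have "inv_into S K x = L x" if "x \<in> S" for x
    using pre[OF that] L(3) inv_into_f_f[OF inj] by auto
  moreover have "L x \<bullet> y = L y \<bullet> x" if "x \<in> S" "y \<in> S" for x y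
    using pre[OF that(1)] pre[OF that(2)] L(3) sym by (auto simp: inner_commute)
  moreover have "L x \<bullet> x > 0" if x: "x \<in> S" "x \<noteq> 0" for x
  proof -
    obtain v where v: "v \<in> S" "x = K v" using pre[OF x(1)] by blast
    then have "v \<noteq> 0" using x(2) linear_0[OF lin] by auto
    then show ?thesis using pos[OF v(1)] L(3)[OF v(1)] v(2) by (simp add: inner_commute)
  qed
  ultimately show ?thesis using L(1,2) by blast
qed

context discretization
begin

text \<open>
  The fluxes of all dimensions, including nonzero normal components on interfaces. The extended fluxes
  \<open>u + R\<^sub>h \<mu>\<close>, to which the permeability forms are applied, live here.
\<close>

definition total_fluxes :: "'a fluxes set"
  where "total_fluxes = direct_sum {1..DIM('a)} (Vh G M)"

lemma subspace_total_fluxes: "subspace total_fluxes"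
  unfolding total_fluxes_def by (intro subspace_direct_sum subspace_Vh) auto

lemma total_fluxes_eq_0:
  assumes u: "u \<in> total_fluxes"
    and z: "\<And>d T f. 1 \<le> d \<Longrightarrow> d \<le> DIM('a) \<Longrightarrow> T \<in> mesh_elements G M d \<Longrightarrow> f facet_of T \<Longrightarrow> flux T f (u d T) = 0"
  shows "u = 0"
proof
  fix d
  show "u d = 0 d"
  proof (cases "d \<in> {1..DIM('a)}")
    case True
    then have d: "1 \<le> d" "d \<le> DIM('a)" by auto
    have "u d = 0"
    proof (rule Vh_eqI[OF d])
      show "u d \<in> Vh G M d" "0 \<in> Vh G M d"
        using u True subspace_0[OF subspace_Vh[OF d(2)]] by (auto simp: total_fluxes_def direct_sum_def)
      show "flux T f (u d T) = flux T f (0 T)" if "T \<in> mesh_elements G M d" "f facet_of T" for T f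
        using z[OF d that] flux_0[OF d(2) that] by simp
    qed
    then show ?thesis by simp
  next
    case False
    then show ?thesis using u by (auto simp: total_fluxes_def direct_sum_def)
  qed
qed

lemma total_fluxes_rt0:
  assumes "u \<in> total_fluxes" "d \<le> DIM('a)" "T \<in> mesh_elements G M d"
  shows "u d T \<in> rt0 T"
proof (cases "d = 0")
  case True
  then have "u d = 0" using assms(1) by (simp add: total_fluxes_def direct_sum_def)
  then show ?thesis using subspace_0[OF subspace_rt0[OF element_nonempty[OF assms(2,3)]]] by simp
next
  case False
  then have "u d \<in> Vh G M d" using assms(1,2) by (simp add: total_fluxes_def direct_sum_def)
  then show ?thesis by (rule Vh_rt0[OF _ assms(3)])
qed

lemma V0h_subset: "V0h_dim G M d \<subseteq> Vh G M d"
  by (auto simp: V0h_dim_def)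

lemma subspace_V0h:
  assumes d: "1 \<le> d" "d \<le> DIM('a)"
  shows "subspace (V0h_dim G M d)"
proof -
  have d': "d - 1 < DIM('a)" "Suc (d - 1) = d" using d by auto
  let ?\<Phi> = "{\<lambda>v. flux T f (v T) | T f. on_Gamma G M (d - 1) T f}"
  have "linear_on (Vh G M d) \<phi>" if "\<phi> \<in> ?\<Phi>" for \<phi>
    using that linear_Vh_flux[OF d(2)] on_Gamma_facet(1,2)[OF d'(1)] d'(2) by auto
  from subspace_common_kernel[OF subspace_Vh[OF d(2)] this]
  have "subspace {v \<in> Vh G M d. \<forall>\<phi>\<in>?\<Phi>. \<phi> v = 0}" .
  also have "{v \<in> Vh G M d. \<forall>\<phi>\<in>?\<Phi>. \<phi> v = 0} = V0h_dim G M d"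
    unfolding V0h_dim_def by (rule Collect_cong) auto
  finally show ?thesis .
qed

abbreviation "mortars \<equiv> direct_sum {..<DIM('a)} (Lh G M)"

lemma subspace_mortars: "subspace mortars"
  by (intro subspace_direct_sum) (auto simp: subspace_def Lh_def)

lemma subspace_Wh: "subspace (Wh G M)"
  unfolding Wh_def by (intro subspace_Times subspace_direct_sum subspace_V0h subspace_mortars) auto

lemma subspace_Qh: "subspace (Qh G M)"
  unfolding Qh_def by (intro subspace_direct_sum) (auto simp: subspace_def Qh_dim_def)

lemma Wh_fluxes: "(u, \<mu>) \<in> Wh G M \<Longrightarrow> u \<in> total_fluxes"
  using V0h_subset by (auto simp: Wh_def total_fluxes_def direct_sum_def)

lemma finite_dimensional_Qh: "finite_dimensional (Qh G M)"
proof (rule finite_dimensional_separated)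
  let ?I = "SIGMA d:{..DIM('a)}. mesh_elements G M d"
  let ?\<Phi> = "(\<lambda>(d, T) q. q d T) ` ?I"
  show "finite ?\<Phi>" by (intro finite_imageI finite_SigmaI finite_elements) auto
  show "linear_on (Qh G M) \<phi>" if "\<phi> \<in> ?\<Phi>" for \<phi> using that by (auto intro!: linear_onI)
  fix q :: "'a pressures" assume q: "q \<in> Qh G M" and z: "\<And>\<phi>. \<phi> \<in> ?\<Phi> \<Longrightarrow> \<phi> q = 0"
  have "q d T = 0" for d T
  proof (cases "(d, T) \<in> ?I")
    case True
    then have "(\<lambda>q. q d T) \<in> ?\<Phi>" by (intro image_eqI[of _ _ "(d, T)"]) auto
    from z[OF this] show ?thesis .
  next
    case False
    then show ?thesis using q by (cases "d \<le> DIM('a)") (auto simp: Qh_def direct_sum_def Qh_dim_def)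
  qed
  then show "q = 0" by (simp add: fun_eq_iff)
qed (rule subspace_Qh)

lemma mortars_off_interfaces:
  assumes "\<mu> \<in> mortars" "\<not> (d < DIM('a) \<and> i \<in> Idx G d \<and> j \<in> interfaces G d i \<and> S \<in> MG M d i j)"
  shows "\<mu> d i j S = 0"
proof (cases "d < DIM('a)")
  case True
  then have "\<mu> d \<in> Lh G M d" using assms(1) by (simp add: direct_sum_def)
  then show ?thesis using assms(2) True unfolding Lh_def mem_Collect_eq by blast
next
  case False
  then show ?thesis using assms(1) by (simp add: direct_sum_def)
qed

lemma finite_dimensional_mortars: "finite_dimensional mortars"
proof (rule finite_dimensional_separated)
  let ?I = "SIGMA d:{..<DIM('a)}. SIGMA i:Idx G d. SIGMA j:interfaces G d i. MG M d i j"
  let ?\<Phi> = "(\<lambda>(d, i, j, S) \<mu>. \<mu> d i j S) ` ?I"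
  show "finite ?\<Phi>"
    by (intro finite_imageI finite_SigmaI finite_Idx finite_interfaces triangulates_finite[OF triangulates_MG]) auto
  show "linear_on mortars \<phi>" if "\<phi> \<in> ?\<Phi>" for \<phi> using that by (auto intro!: linear_onI)
  fix \<mu> :: "'a mortars" assume \<mu>: "\<mu> \<in> mortars" and z: "\<And>\<phi>. \<phi> \<in> ?\<Phi> \<Longrightarrow> \<phi> \<mu> = 0"
  have "\<mu> d i j S = 0" for d i j S
  proof (cases "(d, i, j, S) \<in> ?I")
    case True
    then have "(\<lambda>\<mu>. \<mu> d i j S) \<in> ?\<Phi>" by (intro image_eqI[of _ _ "(d, i, j, S)"]) auto
    from z[OF this] show ?thesis .
  next
    case False
    then show ?thesis by (intro mortars_off_interfaces[OF \<mu>]) auto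
  qed
  then show "\<mu> = 0" by (simp add: fun_eq_iff)
qed (rule subspace_mortars)

lemma finite_dimensional_V0h: "finite_dimensional (direct_sum {1..DIM('a)} (V0h_dim G M))"
proof (rule finite_dimensional_separated)
  let ?V = "direct_sum {1..DIM('a)} (V0h_dim G M)"
  let ?I = "SIGMA d:{1..DIM('a)}. SIGMA T:mesh_elements G M d. {f. f facet_of T}"
  let ?\<Phi> = "(\<lambda>(d, T, f) u. flux T f (u d T)) ` ?I"
  have sub: "?V \<subseteq> total_fluxes" using V0h_subset by (auto simp: total_fluxes_def direct_sum_def)
  show "finite ?\<Phi>" by (intro finite_imageI finite_SigmaI finite_elements finite_facets) auto
  show "linear_on ?V \<phi>" if "\<phi> \<in> ?\<Phi>" for \<phi>
  proof -
    obtain d T f where \<phi>: "\<phi> = (\<lambda>u. flux T f (u d T))" and d: "d \<in> {1..DIM('a)}" "d \<le> DIM('a)"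
      "T \<in> mesh_elements G M d" "f facet_of T"
      using \<open>\<phi> \<in> ?\<Phi>\<close> by auto
    have "u d \<in> Vh G M d" if "u \<in> ?V" for u
      using that d(1) by (auto simp: direct_sum_def intro: subsetD[OF V0h_subset])
    then show ?thesis
      unfolding \<phi> using linear_on_add[OF linear_Vh_flux[OF d(2-4)]] linear_on_scale[OF linear_Vh_flux[OF d(2-4)]]
      by (intro linear_onI) (simp_all only: plus_fun_apply scaleR_fun_apply)
  qed
  fix u assume u: "u \<in> ?V" and z: "\<And>\<phi>. \<phi> \<in> ?\<Phi> \<Longrightarrow> \<phi> u = 0"
  show "u = 0"
  proof (rule total_fluxes_eq_0)
    show "u \<in> total_fluxes" using u sub by blast
    fix d T f assume "1 \<le> d" "d \<le> DIM('a)" "T \<in> mesh_elements G M d" "f facet_of T"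
    then have "(\<lambda>u. flux T f (u d T)) \<in> ?\<Phi>" by (intro image_eqI[of _ _ "(d, T, f)"]) auto
    from z[OF this] show "flux T f (u d T) = 0" .
  qed
next
  show "subspace (direct_sum {1..DIM('a)} (V0h_dim G M))"
    by (intro subspace_direct_sum subspace_V0h) auto
qed

lemma finite_dimensional_Wh: "finite_dimensional (Wh G M)"
  unfolding Wh_def by (rule finite_dimensional_Times[OF finite_dimensional_V0h finite_dimensional_mortars])

lemma Rh_total: "Rh G M \<mu> \<in> total_fluxes"
proof -
  have "Rh_dim G M (d - 1) (\<mu> (d - 1)) \<in> Vh G M d" if "d \<in> {1..DIM('a)}" for d
  proof -
    have "d - 1 < DIM('a)" "Suc (d - 1) = d" using that by auto
    then show ?thesis using Rh_dim_in[of "d - 1" "\<mu> (d - 1)"] by simp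
  qed
  then show ?thesis by (simp add: Rh_def total_fluxes_def direct_sum_def)
qed

lemma linear_Rh: "linear_on UNIV (Rh G M)"
proof (rule linear_onI)
  have d: "d - 1 < DIM('a)" if "d \<in> {1..DIM('a)}" for d using that by auto
  fix \<mu> \<mu>' :: "'a mortars"
  show "Rh G M (\<mu> + \<mu>') = Rh G M \<mu> + Rh G M \<mu>'"
    using linear_on_add[OF linear_Rh_dim[OF d]] by (auto simp: Rh_def fun_eq_iff)
next
  have d: "d - 1 < DIM('a)" if "d \<in> {1..DIM('a)}" for d using that by auto
  fix c and \<mu> :: "'a mortars"
  show "Rh G M (c *\<^sub>R \<mu>) = c *\<^sub>R Rh G M \<mu>"
    using linear_on_scale[OF linear_Rh_dim[OF d]] by (auto simp: Rh_def fun_eq_iff)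
qed

lemma extended_flux:
  assumes "(u, \<mu>) \<in> Wh G M"
  shows "u + Rh G M \<mu> \<in> total_fluxes"
  using subspace_add[OF subspace_total_fluxes Wh_fluxes[OF assms] Rh_total] .

lemma extended_flux_add: "u + u' + Rh G M (\<mu> + \<mu>') = (u + Rh G M \<mu>) + (u' + Rh G M \<mu>')"
  using linear_on_add[OF linear_Rh, of \<mu> \<mu>'] by (simp add: add_ac)

lemma extended_flux_scale: "c *\<^sub>R u + Rh G M (c *\<^sub>R \<mu>) = c *\<^sub>R (u + Rh G M \<mu>)"
  using linear_on_scale[OF linear_Rh, of \<mu> c] by (simp add: scaleR_add_right)

lemma Kinv_linear:
  assumes "d \<le> DIM('a)" "i \<in> Idx G d"
  obtains L where "linear L" "\<And>x. x \<in> tangent (Sub G d i) \<Longrightarrow> Kinv G P d i x = L x"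
    "\<And>x y. x \<in> tangent (Sub G d i) \<Longrightarrow> y \<in> tangent (Sub G d i) \<Longrightarrow> L x \<bullet> y = L y \<bullet> x"
    "\<And>x. x \<in> tangent (Sub G d i) \<Longrightarrow> x \<noteq> 0 \<Longrightarrow> L x \<bullet> x > 0"
proof -
  have "spd_tensor (tangent (Sub G d i)) (Perm P d i)"
    using parameters assms by (simp add: physical_parameters_def)
  from spd_tensor_inverse[OF this subspace_tangent] show thesis
    unfolding Kinv_def[symmetric] using that by blast
qed

lemma bounded_measurable_scaleR_piecewise:
  fixes u v :: "'a set \<Rightarrow> 'a \<Rightarrow> 'a" and L :: "'a \<Rightarrow> 'a"
  assumes tri: "triangulates \<sigma> d S \<T>" "aff_dim S = int d" and S: "bounded S" and L: "linear L"
    and u: "\<And>T. T \<in> \<T> \<Longrightarrow> continuous_on UNIV (u T)" and v: "\<And>T. T \<in> \<T> \<Longrightarrow> continuous_on UNIV (v T)"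
  shows "bounded_measurable S (\<lambda>x. L (piecewise \<T> u x) \<bullet> piecewise \<T> v x)"
proof -
  have "L (piecewise \<T> u x) \<bullet> piecewise \<T> v x = (\<Sum>T\<in>\<T>. \<Sum>T'\<in>\<T>.
      indicator (rel_interior T) x * (indicator (rel_interior T') x * (L (u T x) \<bullet> v T' x)))" for x
    unfolding piecewise_def linear_sum[OF L] linear_scale[OF L] inner_sum_left
    by (simp add: inner_sum_right sum_distrib_left mult.left_commute)
  moreover have "continuous_on UNIV (\<lambda>x. L (u T x) \<bullet> v T' x)" if "T \<in> \<T>" "T' \<in> \<T>" for T T'
    using linear_continuous_on_compose[OF u[OF that(1)] L] v[OF that(2)]
    by (intro continuous_on_inner) auto
  ultimately show ?thesis
    using openin_affine_hull_borel[OF triangulates_element(8)[OF tri]] S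
    by (simp only:, intro bounded_measurable_sum bounded_measurable_mult)
      (auto intro: bounded_measurable_indicator bounded_measurable_continuous)
qed

lemma piecewise_tangent:
  assumes tri: "triangulates \<sigma> d S \<T>" "aff_dim S = int d" and u: "\<And>T. T \<in> \<T> \<Longrightarrow> u T \<in> rt0 T"
  shows "piecewise \<T> u x \<in> tangent S"
  unfolding piecewise_def
proof (rule subspace_sum[OF subspace_tangent])
  fix T assume T: "T \<in> \<T>"
  show "indicator (rel_interior T) x *\<^sub>R u T x \<in> tangent S"
  proof (cases "x \<in> rel_interior T")
    case True
    then have "x \<in> T" using rel_interior_subset[of T] by blast
    then have "x \<in> affine hull T" by (rule hull_inc)
    then have "u T x \<in> tangent T" by (rule rt0_tangent[OF u[OF T]])
    then show ?thesis using triangulates_element(2)[OF tri T] True by simp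
  qed (simp add: subspace_0 subspace_tangent)
qed

text \<open>
  Bilinearity needs the integrals to be finite and the inverse permeability to act linearly, which it
  does on the tangent spaces where the fluxes take their values.
\<close>

lemma symmetric_K_form: "symmetric_form total_fluxes (K_form G M P)"
proof -
  have "symmetric_form total_fluxes (\<lambda>u v. LINT x:Sub G d i|flat_measure (Sub G d i).
      Kinv G P d i (piecewise (MO M d i) (u d) x) \<bullet> piecewise (MO M d i) (v d) x)"
    if d: "d \<le> DIM('a)" and i: "i \<in> Idx G d" for d i
  proof -
    let ?S = "Sub G d i" and ?T = "MO M d i"
    note tri = triangulates_MO[OF d i] Sub_aff_dim[OF d i]
    have el: "T \<in> mesh_elements G M d" if "T \<in> ?T" for T using that i by (auto simp: mesh_elements_def)
    have rt: "u d T \<in> rt0 T" if "u \<in> total_fluxes" "T \<in> ?T" for u T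
      by (rule total_fluxes_rt0[OF that(1) d el[OF that(2)]])
    obtain L where L: "linear L" "\<And>x. x \<in> tangent ?S \<Longrightarrow> Kinv G P d i x = L x"
      "\<And>x y. x \<in> tangent ?S \<Longrightarrow> y \<in> tangent ?S \<Longrightarrow> L x \<bullet> y = L y \<bullet> x"
      using Kinv_linear[OF d i] by metis
    have tan: "piecewise ?T (u d) x \<in> tangent ?S" if "u \<in> total_fluxes" for u x
      by (rule piecewise_tangent[OF tri rt[OF that]])
    have int: "set_integrable (flat_measure ?S) ?S (\<lambda>x. L (piecewise ?T (u d) x) \<bullet> piecewise ?T (v d) x)"
      if "u \<in> total_fluxes" "v \<in> total_fluxes" for u v
      using rt[OF that(1)] rt[OF that(2)]
      by (intro bounded_measurable_integrable Sub_bounded Sub_borel d i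
          bounded_measurable_scaleR_piecewise[OF tri] L(1)) (auto intro: continuous_rt0)
    have K: "Kinv G P d i (piecewise ?T (u d) x) = L (piecewise ?T (u d) x)" if "u \<in> total_fluxes" for u x
      by (rule L(2)[OF tan[OF that]])
    show ?thesis
      unfolding symmetric_form_def
    proof (intro conjI ballI linear_onI)
      fix u v assume u: "u \<in> total_fluxes" and v: "v \<in> total_fluxes"
      show "(LINT x:?S|flat_measure ?S. Kinv G P d i (piecewise ?T (u d) x) \<bullet> piecewise ?T (v d) x) =
          (LINT x:?S|flat_measure ?S. Kinv G P d i (piecewise ?T (v d) x) \<bullet> piecewise ?T (u d) x)"
        unfolding K[OF u] K[OF v] using L(3)[OF tan[OF u] tan[OF v]] by simp
      show "(LINT x:?S|flat_measure ?S. Kinv G P d i (piecewise ?T (u d) x) \<bullet> piecewise ?T ((v + w) d) x) =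
          (LINT x:?S|flat_measure ?S. Kinv G P d i (piecewise ?T (u d) x) \<bullet> piecewise ?T (v d) x) +
          (LINT x:?S|flat_measure ?S. Kinv G P d i (piecewise ?T (u d) x) \<bullet> piecewise ?T (w d) x)"
        if w: "w \<in> total_fluxes" for w
        unfolding K[OF u] set_integral_add(2)[OF int[OF u v] int[OF u w], symmetric]
        by (simp add: plus_fun_def[of "v d"] piecewise_add inner_add_right)
      show "(LINT x:?S|flat_measure ?S. Kinv G P d i (piecewise ?T (u d) x) \<bullet> piecewise ?T ((c *\<^sub>R v) d) x) =
          c *\<^sub>R (LINT x:?S|flat_measure ?S. Kinv G P d i (piecewise ?T (u d) x) \<bullet> piecewise ?T (v d) x)" for c
        unfolding real_scaleR_def set_integral_mult_right[symmetric]
        by (simp add: scaleR_fun_def[of c "v d"] piecewise_scale)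
    qed
  qed
  then show ?thesis
    unfolding K_form_def[abs_def] by (intro symmetric_form_sum) auto
qed

lemma symmetric_K_form_diag: "symmetric_form total_fluxes (K_form_diag G M P)"
proof -
  have *: "symmetric_form total_fluxes (\<lambda>u v. flux T f (u d T) * flux T f (v d T) * c)"
    if d: "d \<le> DIM('a)" and T: "T \<in> mesh_elements G M d" "f facet_of T" for d T f c
    unfolding symmetric_form_def
  proof (intro conjI ballI linear_onI)
    fix u v assume u: "u \<in> total_fluxes" and v: "v \<in> total_fluxes"
    show "flux T f (u d T) * flux T f (v d T) * c = flux T f (v d T) * flux T f (u d T) * c" by simp
    show "flux T f (u d T) * flux T f ((v + w) d T) * c =
        flux T f (u d T) * flux T f (v d T) * c + flux T f (u d T) * flux T f (w d T) * c"
      if w: "w \<in> total_fluxes" for w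
      using flux_add[OF d T total_fluxes_rt0[OF v d T(1)] total_fluxes_rt0[OF w d T(1)]]
      by (simp add: algebra_simps)
    show "flux T f (u d T) * flux T f ((s *\<^sub>R v) d T) * c = s *\<^sub>R (flux T f (u d T) * flux T f (v d T) * c)" for s
      using flux_scale[OF d T total_fluxes_rt0[OF v d T(1)]] by simp
  qed
  have "symmetric_form total_fluxes (\<lambda>u v. flux T f (u d T) * flux T f (v d T) * c)"
    if "d \<in> {..DIM('a)}" "i \<in> Idx G d" "T \<in> MO M d i" "f \<in> {f. f facet_of T}" for d i T f c
    by (rule *) (use that in \<open>auto simp: mesh_elements_def\<close>)
  then show ?thesis
    unfolding K_form_diag_def[abs_def] by (intro symmetric_form_sum)
qed

text \<open>
  The integrand is continuous and nonnegative on \<open>T\<close>, and positive on the facet \<open>f\<close>, where the basis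
  function has normal component one. By continuity it stays positive on an open part of the element.
\<close>

lemma rt0_basis_energy_pos:
  assumes d: "1 \<le> d" "d \<le> DIM('a)" and i: "i \<in> Idx G d" and T: "T \<in> MO M d i" and f: "f facet_of T"
  shows "(LINT x:T|flat_measure T. Kinv G P d i (rt0_basis T f x) \<bullet> rt0_basis T f x) > 0"
proof -
  let ?\<phi> = "rt0_basis T f"
  note tri = triangulates_MO[OF d(2) i] Sub_aff_dim[OF d(2) i]
  note el = triangulates_element[OF tri T]
  have simp: "int d simplex T" by (rule triangulates_simplex[OF tri(1) T])
  obtain L where L: "linear L" "\<And>x. x \<in> tangent (Sub G d i) \<Longrightarrow> Kinv G P d i x = L x"
    "\<And>x. x \<in> tangent (Sub G d i) \<Longrightarrow> x \<noteq> 0 \<Longrightarrow> L x \<bullet> x > 0"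
    using Kinv_linear[OF d(2) i] by metis
  define g where "g x = L (?\<phi> x) \<bullet> ?\<phi> x" for x
  have \<phi>: "?\<phi> \<in> rt0 T" and fl: "flux T f ?\<phi> = 1" using rt0_basis[OF simp d(1), of f] f by auto
  have tan: "?\<phi> x \<in> tangent (Sub G d i)" if "x \<in> T" for x
    using rt0_tangent[OF \<phi>, of x] that el(2) by (simp add: hull_inc)
  have cont: "continuous_on UNIV g"
    unfolding g_def[abs_def]
    by (intro continuous_on_inner continuous_rt0[OF \<phi>] linear_continuous_on_compose[OF continuous_rt0[OF \<phi>] L(1)])
  have bT: "bounded T" "T \<in> sets borel"
    using el(4) compact_imp_bounded borel_compact by auto
  have nonneg: "0 \<le> g x" if "x \<in> T" for x
    using L(3)[OF tan[OF that]] linear_0[OF L(1)] by (cases "?\<phi> x = 0") (auto simp: g_def)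
  obtain u where u: "simplex_facet T f u" using facet_of_simplex[OF simp f] by blast
  obtain x where x: "x \<in> f" using simplex_facet_nonempty(1)[OF u] by blast
  then have xT: "x \<in> T" using simplex_facet_nonempty(3)[OF u] by blast
  have "?\<phi> x \<noteq> 0" using flux_eq[OF u \<phi> x] fl by auto
  then have gx: "g x > 0" using L(3)[OF tan[OF xT]] by (simp add: g_def)
  let ?U = "{y. g x / 2 < g y}" and ?E = "rel_interior T \<inter> {y. g x / 2 < g y}"
  have U: "open ?U" by (rule open_Collect_less) (auto intro: cont)
  have "x \<in> ?U \<inter> closure (rel_interior T)"
    using xT gx convex_closure_rel_interior[OF el(3)] closure_subset[of T] by auto
  then have "?U \<inter> rel_interior T \<noteq> {}" using open_Int_closure_eq_empty[OF U] by blast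
  then have ne: "?E \<noteq> {}" unfolding Int_commute[of ?U] .
  have op: "openin (top_of_set (affine hull T)) ?E"
    using openin_rel_interior[of T] U by (rule openin_Int_open)
  have "(LINT x:T|flat_measure T. g x) > 0"
    by (rule set_integral_flat_pos[OF bounded_measurable_continuous[OF cont bT(1)] bT nonneg _ op ne, of "g x / 2"])
      (use gx rel_interior_subset in auto)
  also have "(LINT x:T|flat_measure T. g x) = (LINT x:T|flat_measure T. Kinv G P d i (?\<phi> x) \<bullet> ?\<phi> x)"
    unfolding set_lebesgue_integral_def
    by (intro Bochner_Integration.integral_cong refl) (use L(2)[OF tan] in \<open>auto simp: g_def indicator_def\<close>)
  finally show ?thesis .
qed

lemma no_facet_of_point: "int 0 simplex T \<Longrightarrow> \<not> f facet_of T"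
  using aff_dim_simplex[of 0 T] aff_dim_empty[of f] by (auto simp: facet_of_def)

text \<open>
  The diagonal form is a sum of squares of facet fluxes with positive weights, and a field whose facet
  fluxes all vanish is zero.
\<close>

lemma K_form_diag_nonneg: "0 \<le> K_form_diag G M P u u"
  and K_form_diag_zero: "u \<in> total_fluxes \<Longrightarrow> K_form_diag G M P u u = 0 \<Longrightarrow> u = 0"
proof -
  let ?k = "\<lambda>d i T f. flux T f (u d T) * flux T f (u d T) *
      (LINT x:T|flat_measure T. Kinv G P d i (rt0_basis T f x) \<bullet> rt0_basis T f x)"
  have d1: "1 \<le> d" if "d \<le> DIM('a)" "i \<in> Idx G d" "T \<in> MO M d i" "f facet_of T" for d i T f
    using no_facet_of_point[of T f] triangulates_simplex[OF triangulates_MO[OF that(1,2)] that(3)] that(4)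
    by (cases d) auto
  have k: "0 \<le> ?k d i T f" if "d \<le> DIM('a)" "i \<in> Idx G d" "T \<in> MO M d i" "f facet_of T" for d i T f
    using rt0_basis_energy_pos[OF d1[OF that] that] by (intro mult_nonneg_nonneg zero_le_square) simp
  have kT: "0 \<le> (\<Sum>f | f facet_of T. ?k d i T f)" if "d \<le> DIM('a)" "i \<in> Idx G d" "T \<in> MO M d i" for d i T
    by (rule sum_nonneg) (rule k[OF that], simp)
  have ki: "0 \<le> (\<Sum>T\<in>MO M d i. \<Sum>f | f facet_of T. ?k d i T f)" if "d \<le> DIM('a)" "i \<in> Idx G d" for d i
    by (rule sum_nonneg) (rule kT[OF that])
  have kd: "0 \<le> (\<Sum>i\<in>Idx G d. \<Sum>T\<in>MO M d i. \<Sum>f | f facet_of T. ?k d i T f)" if "d \<in> {..DIM('a)}" for d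
    by (rule sum_nonneg) (rule ki, use that in auto)
  show "0 \<le> K_form_diag G M P u u" unfolding K_form_diag_def by (rule sum_nonneg) (rule kd)
  assume u: "u \<in> total_fluxes" and z: "K_form_diag G M P u u = 0"
  show "u = 0"
  proof (rule total_fluxes_eq_0[OF u])
    fix d T f assume d: "1 \<le> d" "d \<le> DIM('a)" and T: "T \<in> mesh_elements G M d" and f: "f facet_of T"
    obtain i where i: "i \<in> Idx G d" "T \<in> MO M d i" using T by (auto simp: mesh_elements_def)
    have "(\<Sum>i\<in>Idx G d. \<Sum>T\<in>MO M d i. \<Sum>f | f facet_of T. ?k d i T f) = 0"
      by (rule sum_nonneg_0[OF finite_atMost kd z[unfolded K_form_diag_def]]) (use d in auto)
    from sum_nonneg_0[OF finite_Idx[OF d(2)] ki[OF d(2)] this i(1)]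
    have "(\<Sum>T\<in>MO M d i. \<Sum>f | f facet_of T. ?k d i T f) = 0" .
    from sum_nonneg_0[OF triangulates_finite[OF triangulates_MO[OF d(2) i(1)]] kT[OF d(2) i(1)] this i(2)]
    have "(\<Sum>f | f facet_of T. ?k d i T f) = 0" .
    from sum_nonneg_0[OF finite_facets[OF d(2) T] _ this, of f] have "?k d i T f = 0"
      using k[OF d(2) i] f by simp
    then show "flux T f (u d T) = 0" using rt0_basis_energy_pos[OF d i f] by auto
  qed
qed

lemma symmetric_Gamma_form: "symmetric_form UNIV (Gamma_form G M P)"
proof -
  have "symmetric_form UNIV (\<lambda>\<theta> \<mu>. ip_Gamma G d
      (\<lambda>i j x. Gam P d i j * inverse (PermN P d i j) * mortar M d (\<theta> d) i j x) (mortar M d (\<mu> d)))"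
    if d: "d < DIM('a)" for d
    unfolding symmetric_form_def
  proof (intro conjI ballI linear_onI)
    let ?c = "\<lambda>\<theta> i j x. Gam P d i j * inverse (PermN P d i j) * mortar M d (\<theta> d) i j x"
    note m = interface_function_mortar[OF d]
    have c: "interface_function d (?c \<theta>)" for \<theta>
      using m unfolding interface_function_def by (auto intro: bounded_measurable_scale)
    fix \<theta> \<mu> :: "'a mortars"
    show "ip_Gamma G d (?c \<theta>) (mortar M d (\<mu> d)) = ip_Gamma G d (?c \<mu>) (mortar M d (\<theta> d))"
      by (simp add: ip_Gamma_def mult_ac)
    show "ip_Gamma G d (?c \<theta>) (mortar M d ((\<mu> + \<mu>') d)) =
        ip_Gamma G d (?c \<theta>) (mortar M d (\<mu> d)) + ip_Gamma G d (?c \<theta>) (mortar M d (\<mu>' d))" for \<mu>'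
      using ip_Gamma_add_right[OF d c m m] linear_on_add[OF linear_mortar] by simp
    show "ip_Gamma G d (?c \<theta>) (mortar M d ((s *\<^sub>R \<mu>) d)) = s *\<^sub>R ip_Gamma G d (?c \<theta>) (mortar M d (\<mu> d))" for s
      using ip_Gamma_scale_right[of d "?c \<theta>" s] linear_on_scale[OF linear_mortar] by simp
  qed
  then show ?thesis unfolding Gamma_form_def[abs_def] by (intro symmetric_form_sum) auto
qed

text \<open>
  Each interface contributes a positively weighted \<open>L\<^sup>2\<close> norm of its mortar.
\<close>

lemma Gamma_form_nonneg: "0 \<le> Gamma_form G M P \<mu> \<mu>"
  and Gamma_form_zero: "\<mu> \<in> mortars \<Longrightarrow> Gamma_form G M P \<mu> \<mu> = 0 \<Longrightarrow> \<mu> = 0"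
proof -
  let ?w = "\<lambda>d i j. Gam P d i j * inverse (PermN P d i j)"
  let ?m = "\<lambda>d i j. LINT x:Sub G d i|flat_measure (Sub G d i). mortar M d (\<mu> d) i j x * mortar M d (\<mu> d) i j x"
  have eq: "Gamma_form G M P \<mu> \<mu> = (\<Sum>d<DIM('a). \<Sum>i\<in>Idx G d. \<Sum>j\<in>interfaces G d i. ?w d i j * ?m d i j)"
    by (simp add: Gamma_form_def ip_Gamma_def mult.assoc)
  have w: "0 < ?w d i j" if "d < DIM('a)" "i \<in> Idx G d" "j \<in> interfaces G d i" for d i j
  proof -
    have "PermN P d i j > 0 \<and> Gam P d i j > 0" using parameters that unfolding physical_parameters_def by blast
    then show ?thesis by simp
  qed
  have m: "0 \<le> ?m d i j" for d i j
    unfolding set_lebesgue_integral_def by (intro integral_nonneg_AE) auto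
  have wm: "0 \<le> ?w d i j * ?m d i j" if "d < DIM('a)" "i \<in> Idx G d" "j \<in> interfaces G d i" for d i j
    using w[OF that] m[of d i j] by simp
  have wi: "0 \<le> (\<Sum>j\<in>interfaces G d i. ?w d i j * ?m d i j)" if "d < DIM('a)" "i \<in> Idx G d" for d i
    by (rule sum_nonneg) (rule wm[OF that])
  have wd: "0 \<le> (\<Sum>i\<in>Idx G d. \<Sum>j\<in>interfaces G d i. ?w d i j * ?m d i j)" if "d \<in> {..<DIM('a)}" for d
    by (rule sum_nonneg) (rule wi, use that in auto)
  show "0 \<le> Gamma_form G M P \<mu> \<mu>" unfolding eq by (rule sum_nonneg) (rule wd)
  assume \<mu>: "\<mu> \<in> mortars" and z: "Gamma_form G M P \<mu> \<mu> = 0"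
  have z3: "?m d i j = 0" if d: "d < DIM('a)" and i: "i \<in> Idx G d" and j: "j \<in> interfaces G d i" for d i j
  proof -
    have "(\<Sum>i\<in>Idx G d. \<Sum>j\<in>interfaces G d i. ?w d i j * ?m d i j) = 0"
      by (rule sum_nonneg_0[OF finite_lessThan wd z[unfolded eq]]) (use d in auto)
    from sum_nonneg_0[OF finite_Idx[OF less_imp_le[OF d]] wi[OF d] this i]
    have "(\<Sum>j\<in>interfaces G d i. ?w d i j * ?m d i j) = 0" .
    from sum_nonneg_0[OF finite_interfaces[OF d i] wm[OF d i] this j]
    show ?thesis using w[OF d i j] by (metis less_irrefl mult_eq_0_iff)
  qed
  have "\<mu> d i j S = 0" for d i j S
  proof (cases "d < DIM('a) \<and> i \<in> Idx G d \<and> j \<in> interfaces G d i \<and> S \<in> MG M d i j")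
    case False
    then show ?thesis by (rule mortars_off_interfaces[OF \<mu>])
  next
    case True
    then have d: "d < DIM('a)" "d \<le> DIM('a)" "i \<in> Idx G d" "j \<in> interfaces G d i" "S \<in> MG M d i j" by auto
    note tri = triangulates_MG[OF d(1,3,4)] Sub_aff_dim[OF d(2,3)]
    note el = triangulates_element[OF tri]
    show ?thesis
    proof (rule ccontr)
      assume n: "\<mu> d i j S \<noteq> 0"
      have "(LINT x:Sub G d i|flat_measure (Sub G d i).
          (\<Sum>S\<in>MG M d i j. indicator (rel_interior S) x * \<mu> d i j S) *
          (\<Sum>S\<in>MG M d i j. indicator (rel_interior S) x * \<mu> d i j S)) > 0"
        by (rule indicator_sum_square_pos[OF triangulates_finite[OF tri(1)] Sub_bounded[OF d(2,3)] Sub_borel[OF d(2,3)],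
              where E = rel_interior and c = "\<lambda>S. \<mu> d i j S" and i = S])
          (use el(6,7,8) triangulates_disjoint[OF tri(1)] d(5) n in auto)
      then show False using z3[OF d(1,3,4)] by (simp add: mortar_def piecewise_def)
    qed
  qed
  then show "\<mu> = 0" by (simp add: fun_eq_iff)
qed

text \<open>
  Both \<open>a\<close> and \<open>a\<^sup>D\<close> have this shape. Linearity of the discrete extension transports bilinearity from the
  extended fluxes to the pairs of fluxes and mortars.
\<close>

lemma symmetric_form_extended:
  assumes "symmetric_form total_fluxes k"
  shows "symmetric_form (Wh G M) (\<lambda>(u, \<theta>) (v, \<mu>). k (u + Rh G M \<theta>) (v + Rh G M \<mu>) + Gamma_form G M P \<theta> \<mu>)"
proof -
  let ?e = "\<lambda>w. fst w + Rh G M (snd w)"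
  have e: "?e w \<in> total_fluxes" if "w \<in> Wh G M" for w
    using extended_flux[of "fst w" "snd w"] that by simp
  note k = form_linear_right[OF assms e] and g = form_linear_right[OF symmetric_Gamma_form UNIV_I]
  have "symmetric_form (Wh G M) (\<lambda>w r. k (?e w) (?e r) + Gamma_form G M P (snd w) (snd r))"
    unfolding symmetric_form_def linear_on_def
    by (simp add: form_sym[OF assms e e] form_sym[OF symmetric_Gamma_form] extended_flux_add
        extended_flux_scale linear_on_add[OF k e e] linear_on_scale[OF k e] linear_on_add[OF g]
        linear_on_scale[OF g] distrib_left)
  then show ?thesis by (simp add: case_prod_beta')
qed

lemma symmetric_a_form: "symmetric_form (Wh G M) (a_form G M P)"
  unfolding a_form_def by (rule symmetric_form_extended[OF symmetric_K_form])

text \<open>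
  If the form vanishes, the interface part forces the mortar to vanish, hence also its extension, and
  the diagonal part then forces the flux to vanish.
\<close>

lemma positive_aD_form: "positive_form (Wh G M) (aD_form G M P)"
proof -
  have "symmetric_form (Wh G M) (aD_form G M P)"
    unfolding aD_form_def by (rule symmetric_form_extended[OF symmetric_K_form_diag])
  moreover have "aD_form G M P w w > 0" if w: "w \<in> Wh G M" "w \<noteq> 0" for w
  proof (rule ccontr)
    assume n: "\<not> aD_form G M P w w > 0"
    obtain u \<theta> where wu: "w = (u, \<theta>)" by (cases w)
    have "K_form_diag G M P (u + Rh G M \<theta>) (u + Rh G M \<theta>) + Gamma_form G M P \<theta> \<theta> \<le> 0"
      using n by (simp add: wu aD_form_def)
    then have K: "K_form_diag G M P (u + Rh G M \<theta>) (u + Rh G M \<theta>) = 0" and \<theta>: "Gamma_form G M P \<theta> \<theta> = 0"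
      using K_form_diag_nonneg[of "u + Rh G M \<theta>"] Gamma_form_nonneg[of \<theta>] by linarith+
    have "\<theta> \<in> mortars" using w(1) by (simp add: wu Wh_def)
    then have t0: "\<theta> = 0" using \<theta> by (rule Gamma_form_zero)
    have "u + Rh G M \<theta> = 0" using K_form_diag_zero[OF extended_flux K] w(1) wu by simp
    moreover have "Rh G M \<theta> = 0" unfolding t0 by (rule linear_on_zero[OF linear_Rh subspace_UNIV])
    ultimately have "u = 0" by simp
    then show False using w(2) t0 by (simp add: wu zero_prod_def)
  qed
  ultimately show ?thesis by (simp add: positive_form_def)
qed

lemma mixed_div:
  assumes d: "d \<le> DIM('a)" and i: "i \<in> Idx G d"
  shows bounded_measurable_mixed_div: "u \<in> total_fluxes \<Longrightarrow> bounded_measurable (Sub G d i) (mixed_div G M (u, \<mu>) d i)"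
    and mixed_div_add: "u \<in> total_fluxes \<Longrightarrow> v \<in> total_fluxes \<Longrightarrow>
      mixed_div G M (u + v, \<mu> + \<mu>') d i x = mixed_div G M (u, \<mu>) d i x + mixed_div G M (v, \<mu>') d i x"
    and mixed_div_scale: "u \<in> total_fluxes \<Longrightarrow>
      mixed_div G M (c *\<^sub>R u, c *\<^sub>R \<mu>) d i x = c * mixed_div G M (u, \<mu>) d i x"
proof -
  note tri = triangulates_MO[OF d i] Sub_aff_dim[OF d i]
  have el: "T \<in> mesh_elements G M d" if "T \<in> MO M d i" for T using that i by (auto simp: mesh_elements_def)
  have rt: "u d T \<in> rt0 T" if "u \<in> total_fluxes" "T \<in> MO M d i" for u T
    by (rule total_fluxes_rt0[OF that(1) d el[OF that(2)]])
  note lin = linear_flat_div[OF element_nonempty[OF d el]]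
  note pw = piecewise_def real_scaleR_def
  show "bounded_measurable (Sub G d i) (mixed_div G M (u, \<mu>) d i)" if u: "u \<in> total_fluxes"
  proof -
    have c: "piecewise (MO M d i) (\<lambda>T. flat_div T (u d T)) x =
        piecewise (MO M d i) (\<lambda>T _. flat_div T (u d T) 0) x" for x
      by (rule piecewise_cong) (rule flat_div_const[OF rt[OF u]])
    have "bounded_measurable (Sub G d i) (\<lambda>x. jump G M \<mu> d i x)"
      unfolding jump_def
    proof (intro bounded_measurable_minus bounded_measurable_sum)
      fix j assume j: "j \<in> interfaces G d i"
      show "bounded_measurable (Sub G d i) (mortar M d (\<mu> d) i j)"
      proof (cases "d < DIM('a)")
        case True
        then show ?thesis using interface_function_mortar i j by (simp add: interface_function_def)
      next
        case False
        \<comment> \<open>There are no interfaces of full dimension: a normal would have to be orthogonal to itself.\<close>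
        have "\<nu> \<bullet> y = 0" if "\<nu> \<in> tangent (Sub G (Suc d) (fst j))" "\<forall>y\<in>tangent (Sub G d i). \<nu> \<bullet> y = 0" for \<nu> y
        proof -
          have "dim (tangent (Sub G d i)) = DIM('a)"
            using dim_tangent[OF Sub_nonempty[OF d i]] Sub_aff_dim[OF d i] False d by simp
          then have "tangent (Sub G d i) = UNIV"
            by (metis dim_eq_full span_eq_iff subspace_tangent)
          then show ?thesis using that by simp
        qed
        from this[of "snd j" "snd j"] have "snd j = 0" using j by (auto simp: interfaces_def)
        then show ?thesis using j by (auto simp: interfaces_def)
      qed
    qed
    then show ?thesis
      unfolding mixed_div_def prod.case c
      by (intro bounded_measurable_add bounded_measurable_piecewise[OF tri])
  qed
  show "mixed_div G M (u + v, \<mu> + \<mu>') d i x = mixed_div G M (u, \<mu>) d i x + mixed_div G M (v, \<mu>') d i x"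
    if "u \<in> total_fluxes" "v \<in> total_fluxes"
  proof -
    have "piecewise (MO M d i) (\<lambda>T. flat_div T ((u + v) d T)) x =
        piecewise (MO M d i) (\<lambda>T. flat_div T (u d T)) x + piecewise (MO M d i) (\<lambda>T. flat_div T (v d T)) x"
      unfolding pw sum.distrib[symmetric]
      by (intro sum.cong refl) (simp add: linear_on_add[OF lin rt rt] that distrib_left)
    moreover have "jump G M (\<mu> + \<mu>') d i x = jump G M \<mu> d i x + jump G M \<mu>' d i x"
      using linear_on_add[OF linear_mortar] by (simp add: jump_def sum.distrib)
    ultimately show ?thesis by (simp add: mixed_div_def)
  qed
  show "mixed_div G M (c *\<^sub>R u, c *\<^sub>R \<mu>) d i x = c * mixed_div G M (u, \<mu>) d i x" if "u \<in> total_fluxes"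
  proof -
    have "piecewise (MO M d i) (\<lambda>T. flat_div T ((c *\<^sub>R u) d T)) x =
        c * piecewise (MO M d i) (\<lambda>T. flat_div T (u d T)) x"
      unfolding pw sum_distrib_left
      by (intro sum.cong refl) (simp add: linear_on_scale[OF lin rt] that)
    moreover have "jump G M (c *\<^sub>R \<mu>) d i x = c * jump G M \<mu> d i x"
      using linear_on_scale[OF linear_mortar] by (simp add: jump_def sum_distrib_left)
    ultimately show ?thesis by (simp add: mixed_div_def distrib_left)
  qed
qed

lemma linear_b_form:
  shows linear_b_form_left: "linear_on (Wh G M) (\<lambda>r. b_form G M r q)"
    and linear_b_form_right: "r \<in> Wh G M \<Longrightarrow> linear_on (Qh G M) (b_form G M r)"
proof -
  let ?p = "\<lambda>q d i x. piecewise (MO M d i) (\<lambda>T _. q d T) x"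
  let ?D = "\<lambda>r d i x. mixed_div G M (fst r + Rh G M (snd r), snd r) d i x"
  let ?I = "\<lambda>r q d i. LINT x:Sub G d i|flat_measure (Sub G d i). ?p q d i x * ?D r d i x"
  have b: "b_form G M r q = - (\<Sum>d\<le>DIM('a). \<Sum>i\<in>Idx G d. ?I r q d i)" for r q
    by (simp add: b_form_def case_prod_beta)
  have ext: "fst r + Rh G M (snd r) \<in> total_fluxes" if "r \<in> Wh G M" for r
    using extended_flux[of "fst r" "snd r"] that by simp
  have int: "set_integrable (flat_measure (Sub G d i)) (Sub G d i) (\<lambda>x. ?p q d i x * ?D r d i x)"
    if "d \<le> DIM('a)" "i \<in> Idx G d" "r \<in> Wh G M" for r q d i
    by (intro bounded_measurable_integrable bounded_measurable_mult Sub_bounded Sub_borel that(1,2)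
        bounded_measurable_piecewise[OF triangulates_MO[OF that(1,2)] Sub_aff_dim[OF that(1,2)]]
        bounded_measurable_mixed_div ext that(3))
  have p_add: "?p (q + q') d i x = ?p q d i x + ?p q' d i x"
    and p_scale: "?p (c *\<^sub>R q) d i x = c * ?p q d i x" for q q' c d i x
    by (simp_all add: piecewise_def distrib_left sum.distrib sum_distrib_left mult.left_commute)
  have neg: "linear_on V (\<lambda>x. - g x)" if "linear_on V g" for V :: "'z::real_vector set" and g :: "'z \<Rightarrow> real"
    using that by (auto simp: linear_on_def)
  have left: "linear_on (Wh G M) (\<lambda>r. ?I r q d i)" if d: "d \<le> DIM('a)" and i: "i \<in> Idx G d" for d i
  proof (rule linear_onI)
    fix r s assume r: "r \<in> Wh G M" and s: "s \<in> Wh G M"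
    have "?D (r + s) d i x = ?D r d i x + ?D s d i x" for x
      using mixed_div_add[OF d i ext[OF r] ext[OF s]] by (simp add: extended_flux_add)
    then show "?I (r + s) q d i = ?I r q d i + ?I s q d i"
      unfolding set_integral_add(2)[OF int[OF d i r] int[OF d i s], symmetric] by (simp add: distrib_left)
  next
    fix c r assume r: "r \<in> Wh G M"
    have "?D (c *\<^sub>R r) d i x = c * ?D r d i x" for x
      using mixed_div_scale[OF d i ext[OF r]] by (simp add: extended_flux_scale)
    then show "?I (c *\<^sub>R r) q d i = c *\<^sub>R ?I r q d i"
      unfolding real_scaleR_def set_integral_mult_right[symmetric] by (simp add: mult.left_commute)
  qed
  show "linear_on (Wh G M) (\<lambda>r. b_form G M r q)"
    unfolding b by (intro neg linear_on_sum_fun left) auto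
  have right: "linear_on (Qh G M) (\<lambda>q. ?I r q d i)"
    if r: "r \<in> Wh G M" and d: "d \<le> DIM('a)" and i: "i \<in> Idx G d" for r d i
  proof (rule linear_onI)
    show "?I r (q + q') d i = ?I r q d i + ?I r q' d i" for q q'
      unfolding set_integral_add(2)[OF int[OF d i r] int[OF d i r], symmetric]
      by (simp add: p_add[unfolded plus_fun_apply] distrib_right)
    show "?I r (c *\<^sub>R q) d i = c *\<^sub>R ?I r q d i" for c q
      unfolding real_scaleR_def set_integral_mult_right[symmetric]
      by (simp add: p_scale[unfolded scaleR_fun_apply real_scaleR_def] mult.assoc)
  qed
  show "linear_on (Qh G M) (b_form G M r)" if "r \<in> Wh G M"
    unfolding b[abs_def] by (intro neg linear_on_sum_fun right that) auto
qed

sublocale saddle_point "Wh G M" "Qh G M" "a_form G M P" "aD_form G M P" "b_form G M"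
  by unfold_locales
    (rule subspace_Wh subspace_Qh finite_dimensional_Wh finite_dimensional_Qh symmetric_a_form
      positive_aD_form linear_b_form_left linear_b_form_right; assumption?)+

lemma concrete_operators:
  shows "Dh G M P = grad"
    and "triple_norm G M P = energy_norm"
    and "L_form G M P = lform"
    and "saddle_op G M P = saddle"
    and "A_op G M P = form_operator (Wh G M) (a_form G M P)"
    and "q \<in> Qh G M \<Longrightarrow> schur G M P q = form_operator (Qh G M) schur_form q"
proof -
  show Dh: "Dh G M P = grad"
    by (simp add: Dh_def[abs_def] grad_def[abs_def])
  show "triple_norm G M P = energy_norm" "L_form G M P = lform"
    by (simp_all add: triple_norm_def energy_norm_def L_form_def lform_def Dh)
  show "saddle_op G M P = saddle"
    by (simp add: saddle_op_def saddle_def A_op_def BT_op_def B_op_def)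
  show "A_op G M P = form_operator (Wh G M) (a_form G M P)"
    by (simp add: fun_eq_iff A_op_def form_operator_def)
  show "schur G M P q = form_operator (Qh G M) schur_form q" if "q \<in> Qh G M"
    using schur_operator_eq[OF that] by (simp add: schur_def B_op_def BT_op_def DA_op_def[abs_def])
qed

end

theorem theorem4p5:
  fixes G :: "'a::euclidean_space geometry"
    and M :: "'p \<Rightarrow> 'a mesh"
    and P :: "'p \<Rightarrow> 'a params"
    and Hw :: "'p \<Rightarrow> ('a fluxes \<times> 'a mortars \<Rightarrow> real) \<Rightarrow> 'a fluxes \<times> 'a mortars"
    and Hp :: "'p \<Rightarrow> ('a pressures \<Rightarrow> real) \<Rightarrow> 'a pressures"
    and \<alpha> \<beta> :: "'p \<Rightarrow> real"
    and \<sigma> c1w c2w c1p c2p :: real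
  assumes dimension: "DIM('a) \<in> {2, 3}"
    and geometry: "fractured_medium G"
    and mesh: "\<And>p. admissible_mesh G \<sigma> (M p)"
    and parameters: "\<And>p. physical_parameters G (P p)"
    and Hw_spd: "\<And>p. spd_operator (Wh G (M p)) (Hw p)"
    and Hp_spd: "\<And>p. spd_operator (Qh G (M p)) (Hp p)"
    and constants_pos: "c1w > 0" "c2w > 0" "c1p > 0" "c2p > 0"
    and Hw_lower: "\<And>p r. r \<in> dual (Wh G (M p)) \<Longrightarrow>
          c1w * r (Hw p r) \<le> r (A_inv G (M p) (P p) r)"
    and Hw_upper: "\<And>p r. r \<in> dual (Wh G (M p)) \<Longrightarrow>
          r (A_inv G (M p) (P p) r) \<le> c2w * r (Hw p r)"
    and Hp_lower: "\<And>p q. q \<in> dual (Qh G (M p)) \<Longrightarrow>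
          c1p * q (Hp p q) \<le> q (schur_inv G (M p) (P p) q)"
    and Hp_upper: "\<And>p q. q \<in> dual (Qh G (M p)) \<Longrightarrow>
          q (schur_inv G (M p) (P p) q) \<le> c2p * q (Hp p q)"
    and \<alpha>_pos: "\<And>p. \<alpha> p > 0"
    and \<beta>_pos: "\<And>p. \<beta> p > 0"
    and continuity: "\<And>p x y. x \<in> Wh G (M p) \<times> Qh G (M p) \<Longrightarrow> y \<in> Wh G (M p) \<times> Qh G (M p) \<Longrightarrow>
          \<bar>L_form G (M p) (P p) x y\<bar>
            \<le> \<alpha> p * triple_norm G (M p) (P p) x * triple_norm G (M p) (P p) y"
    and inf_sup: "\<And>p. (INF y\<in>Wh G (M p) \<times> Qh G (M p) - {0}. SUP x\<in>Wh G (M p) \<times> Qh G (M p) - {0}.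
            L_form G (M p) (P p) x y
              / (triple_norm G (M p) (P p) x * triple_norm G (M p) (P p) y)) \<ge> \<beta> p"
  shows "\<forall>p. bij_betw (block_diag (Hw p) (Hp p) \<circ> saddle_op G (M p) (P p))
               (Wh G (M p) \<times> Qh G (M p)) (Wh G (M p) \<times> Qh G (M p)) \<and>
             condition_number (triple_norm G (M p) (P p)) (Wh G (M p) \<times> Qh G (M p))
               (block_diag (Hw p) (Hp p) \<circ> saddle_op G (M p) (P p))
             \<le> (\<alpha> p * max c2w c2p) / (\<beta> p * min c1w c1p)"
proof
  fix p
  interpret discretization G \<sigma> "M p" "P p"
    using geometry mesh parameters by unfold_locales
  note ops = concrete_operators(2-5)
  have A: "A_inv G (M p) (P p) = inv_into (Wh G (M p)) (form_operator (Wh G (M p)) (a_form G (M p) (P p)))"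
    by (simp add: A_inv_def concrete_operators(5))
  have "(q \<in> Qh G (M p) \<and> schur G (M p) (P p) q = r) =
      (q \<in> Qh G (M p) \<and> form_operator (Qh G (M p)) schur_form q = r)" for q r
    by (rule conj_cong[OF refl]) (simp only: concrete_operators(6))
  then have S: "schur_inv G (M p) (P p) = inv_into (Qh G (M p)) (form_operator (Qh G (M p)) schur_form)"
    by (intro ext) (simp only: schur_inv_def inv_into_def)
  note prem = Hw_spd[of p] Hp_spd[of p] constants_pos Hw_lower[of _ p, unfolded A] Hw_upper[of _ p, unfolded A]
    Hp_lower[of _ p, unfolded S] Hp_upper[of _ p, unfolded S] \<alpha>_pos[of p] \<beta>_pos[of p]
    continuity[of _ p, unfolded ops] inf_sup[of p, unfolded ops]
  have T: "block_diag (Hw p) (Hp p) \<circ> saddle_op G (M p) (P p) = preconditioned (Hw p) (Hp p)"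
    by (simp add: fun_eq_iff block_diag_def case_prod_beta preconditioned_def[OF prem] concrete_operators(4))
  show "bij_betw (block_diag (Hw p) (Hp p) \<circ> saddle_op G (M p) (P p))
         (Wh G (M p) \<times> Qh G (M p)) (Wh G (M p) \<times> Qh G (M p)) \<and>
       condition_number (triple_norm G (M p) (P p)) (Wh G (M p) \<times> Qh G (M p))
         (block_diag (Hw p) (Hp p) \<circ> saddle_op G (M p) (P p))
       \<le> (\<alpha> p * max c2w c2p) / (\<beta> p * min c1w c1p)"
    unfolding T concrete_operators(2)
    using preconditioned_bij[OF prem] condition_number_preconditioned[OF prem] by blast
qed

end
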